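(* Let $K$ be a field, let $t\geq 2$, and let $G$ be a complete $t$-partite graph on $n$ vertices. If $G$ is not a complete graph, then $\mathrm{reg}(J_G)=3$. In particular, for every complete $t$-partite graph $G$ on $n$ vertices which is not a path, $\mathrm{reg}(J_G)\leq n-1$.
   Context: For a finite simple graph $G$ on vertex set $[n]$, let $S=K[x_1,\ldots,x_n,y_1,\ldots,y_n]$ (standard grading). The binomial edge ideal $J_G\subset S$ is generated by $f_{ij}=x_iy_j-x_jy_i$ for all $i<j$ with $\{i,j\}\in E(G)$. For a finitely generated graded $S$-module $M$, $\mathrm{reg}(M)=\max\{j-i:\beta_{i,j}(M)\neq 0\}$. A complete $t$-partite graph has its vertex set partitioned into $t$ nonempty parts, two vertices being adjacent if and only if they lie in different parts. *)

theory Defs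
  imports
    "HOL-Library.Cardinality"
    "HOL-Library.Poly_Mapping"
    "HOL-Library.Disjoint_Sets"
    "Jordan_Normal_Form.Matrix"
begin

text \<open>
  \<open>('x, 'k) mpoly\<close> is the polynomial ring over \<open>'k\<close> whose variables are the elements of the
  finite type \<open>'x\<close>: a polynomial maps each exponent vector to its coefficient.
\<close>

type_synonym ('x, 'k) mpoly = "('x \<Rightarrow>\<^sub>0 nat) \<Rightarrow>\<^sub>0 'k"

definition indeterminate :: "'x \<Rightarrow> ('x, 'k::field) mpoly" where
  "indeterminate v = Poly_Mapping.single (Poly_Mapping.single v 1) 1"

definition monomial_degree :: "('x::finite \<Rightarrow>\<^sub>0 nat) \<Rightarrow> nat" where
  "monomial_degree m = (\<Sum>v\<in>UNIV. Poly_Mapping.lookup m v)"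

definition homogeneous :: "int \<Rightarrow> ('x::finite, 'k::field) mpoly set" where
  "homogeneous d = {p. \<forall>m\<in>Poly_Mapping.keys p. int (monomial_degree m) = d}"

definition irrelevant_ideal :: "('x::finite, 'k::field) mpoly set" where
  "irrelevant_ideal = module.span (*) (range indeterminate)"

text \<open>
  A graded module over \<open>S = ('x, 'k) mpoly\<close> is given by its carrier \<open>M\<close> inside an abelian group
  \<open>'m\<close>, the scalar multiplication \<open>scale\<close>, and its homogeneous components \<open>gr d\<close> for integers \<open>d\<close>.

  A graded resolution by finitely generated free modules
  \<open>\<dots> \<rightarrow> F 2 \<rightarrow> F 1 \<rightarrow> F 0 \<rightarrow> M \<rightarrow> 0\<close> is given by
  \<^item> the lists \<open>b i\<close> of degrees of the standard basis vectors of \<open>F i\<close>, i.e. \<open>F i\<close> is the direct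
    sum of the shifted modules \<open>S(- (b i ! q))\<close> for \<open>q < length (b i)\<close>;
  \<^item> the images \<open>g q\<close> in \<open>M\<close> of the basis vectors of \<open>F 0\<close>;
  \<^item> the matrices \<open>A i\<close> of the differentials from \<open>F (i + 1)\<close> to \<open>F i\<close>.
  The modules \<open>F i\<close> may vanish from some point on, so finite resolutions are included.
  Minimality says that every differential \<open>F (i + 1) \<rightarrow> F i\<close> has its image in the irrelevant
  ideal times \<open>F i\<close>, i.e. that its matrix has entries in the irrelevant ideal.
\<close>

definition augmentation ::
    "(('x::finite, 'k::field) mpoly \<Rightarrow> 'm \<Rightarrow> 'm::ab_group_add) \<Rightarrow> (nat \<Rightarrow> 'm) \<Rightarrow>
     ('x, 'k) mpoly vec \<Rightarrow> 'm" where
  "augmentation scale g v = (\<Sum>q<dim_vec v. scale (v $ q) (g q))"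

definition graded_free_resolution ::
    "(('x::finite, 'k::field) mpoly \<Rightarrow> 'm \<Rightarrow> 'm::ab_group_add) \<Rightarrow> 'm set \<Rightarrow> (int \<Rightarrow> 'm set) \<Rightarrow>
     (nat \<Rightarrow> int list) \<Rightarrow> (nat \<Rightarrow> 'm) \<Rightarrow> (nat \<Rightarrow> ('x, 'k) mpoly mat) \<Rightarrow> bool" where
  "graded_free_resolution scale M gr b g A \<longleftrightarrow>
     (\<forall>q<length (b 0). g q \<in> gr (b 0 ! q)) \<and>
     (\<forall>i. A i \<in> carrier_mat (length (b i)) (length (b (Suc i)))) \<and>
     (\<forall>i. \<forall>p<length (b i). \<forall>q<length (b (Suc i)).
        A i $$ (p, q) \<in> homogeneous (b (Suc i) ! q - b i ! p)) \<and>
     augmentation scale g ` carrier_vec (length (b 0)) = M \<and>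
     {v \<in> carrier_vec (length (b 0)). augmentation scale g v = 0} =
       (\<lambda>w. A 0 *\<^sub>v w) ` carrier_vec (length (b 1)) \<and>
     (\<forall>i. {v \<in> carrier_vec (length (b (Suc i))). A i *\<^sub>v v = 0\<^sub>v (length (b i))} =
        (\<lambda>w. A (Suc i) *\<^sub>v w) ` carrier_vec (length (b (Suc (Suc i)))))"

definition minimal_graded_free_resolution ::
    "(('x::finite, 'k::field) mpoly \<Rightarrow> 'm \<Rightarrow> 'm::ab_group_add) \<Rightarrow> 'm set \<Rightarrow> (int \<Rightarrow> 'm set) \<Rightarrow>
     (nat \<Rightarrow> int list) \<Rightarrow> (nat \<Rightarrow> 'm) \<Rightarrow> (nat \<Rightarrow> ('x, 'k) mpoly mat) \<Rightarrow> bool" where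
  "minimal_graded_free_resolution scale M gr b g A \<longleftrightarrow>
     graded_free_resolution scale M gr b g A \<and>
     (\<forall>i. \<forall>p<length (b i). \<forall>q<length (b (Suc i)). A i $$ (p, q) \<in> irrelevant_ideal)"

text \<open>
  A finitely generated graded module has a minimal graded free resolution, unique up to
  isomorphism, so the choice below is immaterial.
\<close>

definition betti ::
    "(('x::finite, 'k::field) mpoly \<Rightarrow> 'm \<Rightarrow> 'm::ab_group_add) \<Rightarrow> 'm set \<Rightarrow> (int \<Rightarrow> 'm set) \<Rightarrow>
     nat \<Rightarrow> int \<Rightarrow> nat" where
  "betti scale M gr i j =
     count_list ((SOME b. \<exists>g A. minimal_graded_free_resolution scale M gr b g A) i) j"

definition regularity ::
    "(('x::finite, 'k::field) mpoly \<Rightarrow> 'm \<Rightarrow> 'm::ab_group_add) \<Rightarrow> 'm set \<Rightarrow> (int \<Rightarrow> 'm set) \<Rightarrow>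
     int" where
  "regularity scale M gr = Max {j - int i | i j. betti scale M gr i j \<noteq> 0}"

text \<open>A homogeneous ideal is a graded module with the grading inherited from \<open>S\<close>.\<close>

definition ideal_regularity :: "('x::finite, 'k::field) mpoly set \<Rightarrow> int" where
  "ideal_regularity I = regularity (*) I (\<lambda>d. I \<inter> homogeneous d)"

text \<open>
  A graph has the finite linearly ordered type \<open>'v\<close> as its vertex set (in place of
  \<open>{1, \<dots>, n}\<close>, with \<open>n = CARD('v)\<close>) and is identified with its set of edges.
\<close>

definition simple_graph :: "'v set set \<Rightarrow> bool" where
  "simple_graph E \<longleftrightarrow> (\<forall>e\<in>E. card e = 2)"

definition complete_graph :: "'v set set \<Rightarrow> bool" where
  "complete_graph E \<longleftrightarrow> (\<forall>u v. u \<noteq> v \<longrightarrow> {u, v} \<in> E)"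

definition complete_multipartite :: "nat \<Rightarrow> 'v::finite set set \<Rightarrow> bool" where
  "complete_multipartite t E \<longleftrightarrow>
     (\<exists>P. partition_on UNIV P \<and> card P = t \<and>
        (\<forall>u v. {u, v} \<in> E \<longleftrightarrow> (\<exists>A\<in>P. \<exists>B\<in>P. A \<noteq> B \<and> u \<in> A \<and> v \<in> B)))"

definition path_graph :: "'v::finite set set \<Rightarrow> bool" where
  "path_graph E \<longleftrightarrow>
     (\<exists>vs. distinct vs \<and> set vs = UNIV \<and>
        E = {{vs ! i, vs ! Suc i} | i. Suc i < length vs})"

text \<open>The variables are \<open>x v = Inl v\<close> and \<open>y v = Inr v\<close>.\<close>

definition edge_binomial :: "'v \<Rightarrow> 'v \<Rightarrow> ('v + 'v, 'k::field) mpoly" where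
  "edge_binomial i j =
     indeterminate (Inl i) * indeterminate (Inr j) - indeterminate (Inl j) * indeterminate (Inr i)"

definition binomial_edge_ideal ::
    "'v::{finite, linorder} set set \<Rightarrow> ('v + 'v, 'k::field) mpoly set" where
  "binomial_edge_ideal E = module.span (*) {edge_binomial i j | i j. i < j \<and> {i, j} \<in> E}"

end

(*
  Upper bound. Bounds on the regularity pass through short exact sequences of graded subquotients.
  Complete graphs: J(V + w)/J(V) is isomorphic to (x_i : i in V)/J(V) shifted by one, so induction on
  the number of vertices gives reg <= 2. Turning the parts of a complete multipartite graph into
  cliques one at a time changes the ideal by a module J(V)/(T) J(V) of regularity <= 2, where T are
  the variables outside the part V; going back from the complete graph yields reg <= 3.

  Lower bound. Two nonadjacent vertices u, v have a common neighbour a, and the Koszul syzygy of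
  f_ua and f_av is a minimal first syzygy of degree 4.

  A minimal resolution exists because a minimal choice of generators can be made at every step, and
  Schanuel's lemma shows that any minimal resolution obeys the regularity bound.
*)

theory Submission
  imports Defs "HOL-Library.Function_Algebras"
begin

section \<open>Monomials and homogeneous components\<close>

text \<open>Regularity is defined by a \<open>Max\<close> over a resolution picked by choice. So
  three facts are shown for every minimal resolution: the degrees in step \<open>i\<close> are at
  most \<open>r + i\<close>; they are at least \<open>c + i\<close> for a constant \<open>c\<close>,
  without which the set under \<open>Max\<close> might be infinite; and some degree reaches
  \<open>3 + i\<close>. The bounds are carried by arbitrary resolutions, cut off after
  \<open>n\<close> steps so that induction on \<open>n\<close> is available. In an exact sequence 0
  -> A -> B -> C -> 0, bounds for B or for C come from joining generators or syzygies. Bounding A by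
  B and C is the hard direction; it goes through a pullback, and the comparison of different
  resolutions is a special case of it. The ideal of a complete graph is the kernel of the
  substitution y_i -> b x_i, which sends monomials to monomials; membership in it becomes an
  equation. The value 3 arises as 2 + 1: completing a part adds a quotient of regularity at most 2,
  and passing back to the smaller ideal costs one degree. The bound n - 1 could fail only for n <=
  3, or n <= 2 if the graph is complete, and then the graph is a path.\<close>

lemma poly_mapping_sum_single:
  assumes "finite A" "Poly_Mapping.keys p \<subseteq> A"
  shows "p = (\<Sum>m\<in>A. Poly_Mapping.single m (Poly_Mapping.lookup p m))"
proof (rule poly_mapping_eqI)
  fix k
  have "Poly_Mapping.lookup (\<Sum>m\<in>A. Poly_Mapping.single m (Poly_Mapping.lookup p m)) k
     = (\<Sum>m\<in>A. if m = k then Poly_Mapping.lookup p m else 0)"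
    by (simp add: lookup_sum lookup_single when_def)
  also have "\<dots> = Poly_Mapping.lookup p k"
    using assms by (auto simp: in_keys_iff)
  finally show "Poly_Mapping.lookup p k
    = Poly_Mapping.lookup (\<Sum>m\<in>A. Poly_Mapping.single m (Poly_Mapping.lookup p m)) k" by simp
qed

lemma poly_mapping_additive_induct [case_names single add]:
  assumes "\<And>m c. P (Poly_Mapping.single m c)" and "\<And>p q. P p \<Longrightarrow> P q \<Longrightarrow> P (p + q)"
  shows "P (p :: 'a \<Rightarrow>\<^sub>0 'b::comm_monoid_add)"
proof -
  have "P (\<Sum>m\<in>A. Poly_Mapping.single m (Poly_Mapping.lookup p m))" if "finite A" for A
    using that
  proof (induction A rule: finite_induct)
    case empty
    show ?case using assms(1)[of undefined 0] by simp
  qed (auto intro: assms)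
  then have "P (\<Sum>m\<in>Poly_Mapping.keys p. Poly_Mapping.single m (Poly_Mapping.lookup p m))"
    by simp
  then show ?thesis
    by (subst poly_mapping_sum_single[of "Poly_Mapping.keys p" p]) auto
qed

section \<open>Selecting the monomials of a polynomial by a predicate\<close>

lift_definition restr :: "('a \<Rightarrow> bool) \<Rightarrow> ('a \<Rightarrow>\<^sub>0 'b::zero) \<Rightarrow> ('a \<Rightarrow>\<^sub>0 'b)"
  is "\<lambda>P f m. if P m then f m else 0"
  by (rule finite_subset) auto

lemma lookup_restr: "Poly_Mapping.lookup (restr P p) m = (if P m then Poly_Mapping.lookup p m else 0)"
  by transfer simp

lemma restr_0 [simp]: "restr P 0 = 0"
  by (rule poly_mapping_eqI) (simp add: lookup_restr)

lemma restr_add: "restr P (p + q) = restr P p + restr P (q :: 'a \<Rightarrow>\<^sub>0 'b::monoid_add)"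
  by (rule poly_mapping_eqI) (simp add: lookup_restr lookup_add)

lemma restr_diff: "restr P (p - q) = restr P p - restr P (q :: 'a \<Rightarrow>\<^sub>0 'b::ab_group_add)"
  by (rule poly_mapping_eqI) (simp add: lookup_restr lookup_minus)

lemma restr_sum: "restr P (sum f A) = (\<Sum>x\<in>A. restr P (f x :: 'a \<Rightarrow>\<^sub>0 'b::comm_monoid_add))"
  by (induction A rule: infinite_finite_induct) (auto simp: restr_add)

lemma restr_single: "restr P (Poly_Mapping.single m c) = (if P m then Poly_Mapping.single m c else 0)"
  by (rule poly_mapping_eqI) (auto simp: lookup_restr lookup_single when_def)

lemma restr_restr: "restr P (restr Q p) = restr (\<lambda>m. P m \<and> Q m) p"
  by (rule poly_mapping_eqI) (auto simp: lookup_restr)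

lemma keys_restr: "Poly_Mapping.keys (restr P p) = {m \<in> Poly_Mapping.keys p. P m}"
  by (auto simp: in_keys_iff lookup_restr split: if_splits)

lemma restr_eq_self: "(\<And>m. m \<in> Poly_Mapping.keys p \<Longrightarrow> P m) \<Longrightarrow> restr P p = p"
  by (rule poly_mapping_eqI) (auto simp: lookup_restr in_keys_iff)

lemma restr_eq_0: "(\<And>m. m \<in> Poly_Mapping.keys p \<Longrightarrow> \<not> P m) \<Longrightarrow> restr P p = 0"
  by (rule poly_mapping_eqI) (auto simp: lookup_restr in_keys_iff)

text \<open>When \<open>p\<close> is a single term with exponent \<open>m\<close>, all terms of the
  product get the same verdict from \<open>P\<close>, namely \<open>Q m\<close>; additivity does the
  rest. Degree conditions for \<open>P\<close> and \<open>Q\<close> give the homogeneous components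
  of a product, and \<open>P = Q = avoids T\<close> treats factors free of the variables in
  \<open>T\<close>.\<close>

lemma restr_mult:
  fixes p q :: "'a::monoid_add \<Rightarrow>\<^sub>0 'b::semiring_0"
  assumes "\<And>m n. n \<in> Poly_Mapping.keys q \<Longrightarrow> P (m + n) \<longleftrightarrow> Q m"
  shows "restr P (p * q) = restr Q p * q"
proof (induction p rule: poly_mapping_additive_induct)
  case (single m c)
  let ?s = "\<lambda>n. Poly_Mapping.single n (Poly_Mapping.lookup q n)"
  have q: "q = (\<Sum>n\<in>Poly_Mapping.keys q. ?s n)"
    by (rule poly_mapping_sum_single) auto
  have "Poly_Mapping.single m c * q = (\<Sum>n\<in>Poly_Mapping.keys q. Poly_Mapping.single m c * ?s n)"
    by (subst q) (simp add: sum_distrib_left)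
  then have e: "Poly_Mapping.single m c * q
     = (\<Sum>n\<in>Poly_Mapping.keys q. Poly_Mapping.single (m + n) (c * Poly_Mapping.lookup q n))"
    by (simp add: mult_single)
  have "restr P (Poly_Mapping.single m c * q) = (if Q m then Poly_Mapping.single m c * q else 0)"
    unfolding e restr_sum restr_single using assms by auto
  then show ?case by (simp add: restr_single)
next
  case (add p q)
  then show ?case by (simp add: restr_add distrib_right)
qed

text \<open>Exponents are natural numbers, so \<open>m + n = 0\<close> forces both to vanish. The
  constant coefficient is thus the residue map at the irrelevant ideal, on which the minimality
  arguments rest.\<close>

lemma lookup_mult_0:
  fixes p q :: "('x \<Rightarrow>\<^sub>0 nat) \<Rightarrow>\<^sub>0 'k::comm_semiring_0"
  shows "Poly_Mapping.lookup (p * q) 0 = Poly_Mapping.lookup p 0 * Poly_Mapping.lookup q 0"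
proof (induction p rule: poly_mapping_additive_induct)
  case (single m c)
  show ?case
  proof (induction q rule: poly_mapping_additive_induct)
    case (single n d)
    have "m + n = 0 \<longleftrightarrow> m = 0 \<and> n = 0"
      by (auto simp: poly_mapping_eq_iff fun_eq_iff lookup_add)
    then show ?case by (auto simp: mult_single lookup_single when_def)
  qed (simp add: lookup_add distrib_left)
qed (simp add: lookup_add distrib_right)

lemma lookup_single_mult:
  fixes q :: "('x \<Rightarrow>\<^sub>0 nat) \<Rightarrow>\<^sub>0 'k::comm_semiring_0"
  shows "Poly_Mapping.lookup (Poly_Mapping.single m c * q) (m + n) = c * Poly_Mapping.lookup q n"
  by (induction q rule: poly_mapping_additive_induct)
    (auto simp: mult_single lookup_single when_def lookup_add distrib_left)

lemma in_keys_single_mult: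
  fixes q :: "('x \<Rightarrow>\<^sub>0 nat) \<Rightarrow>\<^sub>0 'k::comm_semiring_0"
  assumes "k \<in> Poly_Mapping.keys (Poly_Mapping.single m c * q)"
  shows "\<exists>n\<in>Poly_Mapping.keys q. k = m + n"
  using keys_mult[of "Poly_Mapping.single m c" q] assms by (fastforce split: if_splits)

lemma monomial_degree_add: "monomial_degree (m + n) = monomial_degree m + monomial_degree n"
  by (simp add: monomial_degree_def lookup_add sum.distrib)

lemma monomial_degree_single: "monomial_degree (Poly_Mapping.single v n) = n"
  by (simp add: monomial_degree_def lookup_single when_def)

lemma monomial_degree_eq_0: "monomial_degree m = 0 \<longleftrightarrow> m = 0"
  by (auto simp: monomial_degree_def poly_mapping_eq_iff fun_eq_iff)

lemma monomial_degree_0 [simp]: "monomial_degree 0 = 0"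
  by (simp add: monomial_degree_eq_0)

section \<open>Homogeneous components\<close>

definition hcomp :: "int \<Rightarrow> ('x::finite, 'k::field) mpoly \<Rightarrow> ('x, 'k) mpoly" where
  "hcomp e = restr (\<lambda>m. int (monomial_degree m) = e)"

lemma hcomp_0 [simp]: "hcomp e 0 = 0"
  by (simp add: hcomp_def)

lemma hcomp_add: "hcomp e (p + q) = hcomp e p + hcomp e q"
  by (simp add: hcomp_def restr_add)

lemma hcomp_diff: "hcomp e (p - q) = hcomp e p - hcomp e q"
  by (simp add: hcomp_def restr_diff)

lemma hcomp_sum: "hcomp e (sum f A) = (\<Sum>x\<in>A. hcomp e (f x))"
  by (simp add: hcomp_def restr_sum)

lemma homogeneous_hcomp: "hcomp e p \<in> homogeneous e"
  by (auto simp: hcomp_def homogeneous_def keys_restr)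

lemma hcomp_homogeneous: "p \<in> homogeneous e \<Longrightarrow> hcomp e p = p"
  by (auto simp: hcomp_def homogeneous_def intro!: restr_eq_self)

lemma homogeneous_iff_hcomp: "p \<in> homogeneous e \<longleftrightarrow> hcomp e p = p"
  using hcomp_homogeneous homogeneous_hcomp by metis

lemma hcomp_mult:
  assumes "q \<in> homogeneous f"
  shows "hcomp e (p * q) = hcomp (e - f) p * q"
  unfolding hcomp_def by (rule restr_mult) (use assms in \<open>auto simp: homogeneous_def monomial_degree_add\<close>)

lemma homogeneous_0 [simp]: "0 \<in> homogeneous e"
  by (simp add: homogeneous_def)

lemma homogeneous_1: "1 \<in> homogeneous 0"
  by (simp add: homogeneous_def)

lemma homogeneous_diff: "p \<in> homogeneous e \<Longrightarrow> q \<in> homogeneous e \<Longrightarrow> p - q \<in> homogeneous e"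
  by (simp add: homogeneous_iff_hcomp hcomp_diff)

lemma homogeneous_sum: "(\<And>x. x \<in> A \<Longrightarrow> f x \<in> homogeneous e) \<Longrightarrow> sum f A \<in> homogeneous e"
  by (simp add: homogeneous_iff_hcomp hcomp_sum)

lemma homogeneous_mult:
  assumes "p \<in> homogeneous d" "q \<in> homogeneous e"
  shows "p * q \<in> homogeneous (d + e)"
  using assms hcomp_mult[OF assms(2), of "d + e" p] by (simp add: homogeneous_iff_hcomp)

lemma homogeneous_single: "int (monomial_degree m) = e \<Longrightarrow> Poly_Mapping.single m c \<in> homogeneous e"
  by (simp add: homogeneous_def)

lemma homogeneous_indeterminate: "indeterminate v \<in> homogeneous 1"
  by (simp add: homogeneous_def indeterminate_def monomial_degree_single)

lemma lookup_0_neq_0_homogeneous: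
  assumes "p \<in> homogeneous e" "Poly_Mapping.lookup p 0 \<noteq> 0"
  shows "e = 0"
proof -
  have "0 \<in> Poly_Mapping.keys p" using assms by (simp add: in_keys_iff)
  then show ?thesis using assms(1) by (force simp: homogeneous_def)
qed

lemma homogeneous_0_const: 
  assumes "p \<in> homogeneous 0"
  shows "p = Poly_Mapping.single 0 (Poly_Mapping.lookup p 0)"
proof -
  have "Poly_Mapping.keys p \<subseteq> {0}"
    using assms by (auto simp: homogeneous_def monomial_degree_eq_0)
  then show ?thesis using poly_mapping_sum_single[of "{0}" p] by simp
qed

lemma lookup_hcomp_0: "Poly_Mapping.lookup (hcomp 0 p) 0 = Poly_Mapping.lookup p 0"
  by (simp add: hcomp_def lookup_restr)

lemma homogeneous_neg: "p \<in> homogeneous e \<Longrightarrow> e < 0 \<Longrightarrow> p = 0"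
  by (rule poly_mapping_eqI) (auto simp: homogeneous_def in_keys_iff)

global_interpretation poly_module: Modules.module "(*) :: ('x, 'k::field) mpoly \<Rightarrow> _"
  by standard (auto simp: algebra_simps)

section \<open>Ideals generated by variables\<close>

text \<open>Described by monomials, not by generators, so that membership becomes the equation
  \<open>restr (avoids T) p = 0\<close>; \<open>var_ideal_span\<close> recovers the
  generators.\<close>

definition var_ideal :: "'x set \<Rightarrow> ('x, 'k::field) mpoly set" where
  "var_ideal T = {p. \<forall>m\<in>Poly_Mapping.keys p. \<exists>v\<in>T. Poly_Mapping.lookup m v \<noteq> 0}"

definition avoids :: "'x set \<Rightarrow> ('x \<Rightarrow>\<^sub>0 nat) \<Rightarrow> bool" where
  "avoids T m \<longleftrightarrow> (\<forall>v\<in>T. Poly_Mapping.lookup m v = 0)"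

lemma avoids_add: "avoids T (m + n) \<longleftrightarrow> avoids T m \<and> avoids T n"
  by (auto simp: avoids_def lookup_add)

lemma var_ideal_iff: "p \<in> var_ideal T \<longleftrightarrow> restr (avoids T) p = 0"
proof -
  have "restr (avoids T) p = 0 \<longleftrightarrow> Poly_Mapping.keys (restr (avoids T) p) = {}"
    by (metis empty_iff in_keys_iff keys_zero lookup_zero poly_mapping_eqI)
  then show ?thesis by (auto simp: keys_restr var_ideal_def avoids_def)
qed

lemma restr_avoids_mult:
  fixes p q :: "('x, 'k::field) mpoly"
  assumes "\<And>m. m \<in> Poly_Mapping.keys q \<Longrightarrow> avoids T m"
  shows "restr (avoids T) (p * q) = restr (avoids T) p * q"
  by (rule restr_mult) (use assms in \<open>auto simp: avoids_add\<close>)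

lemma single_in_var_ideal:
  "v \<in> T \<Longrightarrow> Poly_Mapping.lookup m v \<noteq> 0 \<Longrightarrow> Poly_Mapping.single m c \<in> var_ideal T"
  by (auto simp: var_ideal_def)

lemma var_ideal_add: "p \<in> var_ideal T \<Longrightarrow> q \<in> var_ideal T \<Longrightarrow> p + q \<in> var_ideal T"
  by (simp add: var_ideal_iff restr_add)

lemma var_ideal_diff: "p \<in> var_ideal T \<Longrightarrow> q \<in> var_ideal T \<Longrightarrow> p - q \<in> var_ideal T"
  by (simp add: var_ideal_iff restr_diff)

lemma var_ideal_mult:
  assumes "p \<in> var_ideal T"
  shows "c * p \<in> var_ideal T"
  unfolding var_ideal_def
proof (intro CollectI ballI)
  fix m assume "m \<in> Poly_Mapping.keys (c * p)"
  then obtain a b where "m = a + b" "b \<in> Poly_Mapping.keys p" using keys_mult[of c p] by blast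
  then show "\<exists>v\<in>T. Poly_Mapping.lookup m v \<noteq> 0"
    using assms by (auto simp: var_ideal_def lookup_add)
qed

lemma var_ideal_empty: "var_ideal {} = {0}"
  by (auto simp: var_ideal_def)

lemma single_divide_indeterminate:
  assumes "Poly_Mapping.lookup m v \<noteq> 0"
  shows "Poly_Mapping.single m c
    = Poly_Mapping.single (m - Poly_Mapping.single v 1) c * (indeterminate v :: ('x, 'k::field) mpoly)"
proof -
  have "m = (m - Poly_Mapping.single v 1) + Poly_Mapping.single v 1"
    using assms by (intro poly_mapping_eqI) (auto simp: lookup_add lookup_minus lookup_single when_def)
  then show ?thesis by (simp add: indeterminate_def mult_single)
qed

lemma var_ideal_span: "var_ideal T = poly_module.span (indeterminate ` T)"
proof (intro equalityI subsetI)
  fix p :: "('a, 'b) mpoly" assume p: "p \<in> var_ideal T"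
  have "Poly_Mapping.single m (Poly_Mapping.lookup p m) \<in> poly_module.span (indeterminate ` T)"
    if "m \<in> Poly_Mapping.keys p" for m
  proof -
    have "\<exists>v\<in>T. Poly_Mapping.lookup m v \<noteq> 0" using p that unfolding var_ideal_def by simp
    then obtain v where v: "v \<in> T" "Poly_Mapping.lookup m v \<noteq> 0" ..
    show ?thesis
      by (subst single_divide_indeterminate[OF v(2)])
        (use v in \<open>simp add: poly_module.span_scale poly_module.span_base\<close>)
  qed
  then have "(\<Sum>m\<in>Poly_Mapping.keys p. Poly_Mapping.single m (Poly_Mapping.lookup p m))
      \<in> poly_module.span (indeterminate ` T)"
    by (intro poly_module.span_sum)
  then show "p \<in> poly_module.span (indeterminate ` T)"
    by (subst poly_mapping_sum_single[of "Poly_Mapping.keys p" p]) auto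
next
  fix p :: "('a, 'b) mpoly" assume "p \<in> poly_module.span (indeterminate ` T)"
  then show "p \<in> var_ideal T"
  proof (induction p rule: poly_module.span_induct_alt)
    case (step c f y)
    then have "f \<in> var_ideal T"
      by (auto simp: indeterminate_def intro: single_in_var_ideal)
    then show ?case using step by (intro var_ideal_add var_ideal_mult)
  qed (simp add: var_ideal_def)
qed

text \<open>This is \<open>var_ideal UNIV\<close>, and only the exponent 0 avoids every variable.
  Minimality of a resolution turns into a condition on constant coefficients.\<close>

lemma irrelevant_ideal_iff:
  "p \<in> (irrelevant_ideal :: ('x::finite, 'k::field) mpoly set) \<longleftrightarrow> Poly_Mapping.lookup p 0 = 0"
proof -
  have "avoids UNIV m \<longleftrightarrow> m = 0" for m :: "'x \<Rightarrow>\<^sub>0 nat"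
    by (auto simp: avoids_def poly_mapping_eq_iff fun_eq_iff)
  then have "restr (avoids UNIV) p = Poly_Mapping.single 0 (Poly_Mapping.lookup p 0)"
    by (intro poly_mapping_eqI) (auto simp: lookup_restr lookup_single when_def)
  moreover have "Poly_Mapping.single 0 c = (0 :: ('x, 'k) mpoly) \<longleftrightarrow> c = 0" for c
    by (metis lookup_single_eq lookup_zero single_zero)
  ultimately show ?thesis by (simp add: irrelevant_ideal_def var_ideal_iff flip: var_ideal_span)
qed

section \<open>Graded submodules of free modules\<close>

text \<open>Elements of free modules are functions on \<open>nat\<close>, so that one type serves
  all modules of a resolution whatever their ranks; the rank enters through \<open>supp\<close>, and
  the degrees of the basis vectors through a function \<open>d\<close>.\<close>

definition smul :: "('x, 'k::field) mpoly \<Rightarrow> (nat \<Rightarrow> ('x, 'k) mpoly) \<Rightarrow> nat \<Rightarrow> ('x, 'k) mpoly" where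
  "smul p u = (\<lambda>j. p * u j)"

definition vcomp :: "(nat \<Rightarrow> int) \<Rightarrow> int \<Rightarrow> (nat \<Rightarrow> ('x::finite, 'k::field) mpoly) \<Rightarrow> nat \<Rightarrow> ('x, 'k) mpoly" where
  "vcomp d e u = (\<lambda>j. hcomp (e - d j) (u j))"

definition hom :: "(nat \<Rightarrow> int) \<Rightarrow> int \<Rightarrow> (nat \<Rightarrow> ('x::finite, 'k::field) mpoly) \<Rightarrow> bool" where
  "hom d e u \<longleftrightarrow> (\<forall>j. u j \<in> homogeneous (e - d j))"

definition lc :: "nat \<Rightarrow> (nat \<Rightarrow> ('x, 'k::field) mpoly) \<Rightarrow> (nat \<Rightarrow> nat \<Rightarrow> ('x, 'k) mpoly) \<Rightarrow> nat \<Rightarrow> ('x, 'k) mpoly" where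
  "lc k c g = (\<lambda>j. \<Sum>i<k. c i * g i j)"

definition supp :: "nat \<Rightarrow> (nat \<Rightarrow> 'b::zero) set" where
  "supp k = {u. \<forall>i\<ge>k. u i = 0}"

definition trunc :: "nat \<Rightarrow> (nat \<Rightarrow> 'b::zero) \<Rightarrow> nat \<Rightarrow> 'b" where
  "trunc k u = (\<lambda>i. if i < k then u i else 0)"

definition shift :: "nat \<Rightarrow> (nat \<Rightarrow> 'b) \<Rightarrow> nat \<Rightarrow> 'b" where
  "shift k u = (\<lambda>j. u (k + j))"

definition cat :: "nat \<Rightarrow> (nat \<Rightarrow> 'b) \<Rightarrow> (nat \<Rightarrow> 'b) \<Rightarrow> nat \<Rightarrow> 'b" where
  "cat k u v = (\<lambda>i. if i < k then u i else v (i - k))"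

definition gsub :: "(nat \<Rightarrow> int) \<Rightarrow> (nat \<Rightarrow> ('x::finite, 'k::field) mpoly) set \<Rightarrow> bool" where
  "gsub d A \<longleftrightarrow> 0 \<in> A \<and> (\<forall>u\<in>A. \<forall>v\<in>A. u + v \<in> A) \<and> (\<forall>p. \<forall>u\<in>A. smul p u \<in> A)
     \<and> (\<forall>e. \<forall>u\<in>A. vcomp d e u \<in> A)"

text \<open>A graded submodule of a product of two free modules. Isomorphisms of subquotients are
  given by such relations because correspondences of the form "equal modulo \<open>A\<close>" are
  multivalued on representatives.\<close>

definition glin :: "(nat \<Rightarrow> int) \<Rightarrow> (nat \<Rightarrow> int) \<Rightarrow>
    ((nat \<Rightarrow> ('x::finite, 'k::field) mpoly) \<Rightarrow> (nat \<Rightarrow> ('x, 'k) mpoly) \<Rightarrow> bool) \<Rightarrow> bool" where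
  "glin d d' \<rho> \<longleftrightarrow> \<rho> 0 0 \<and> (\<forall>u u' v v'. \<rho> u u' \<longrightarrow> \<rho> v v' \<longrightarrow> \<rho> (u + v) (u' + v'))
     \<and> (\<forall>p u u'. \<rho> u u' \<longrightarrow> \<rho> (smul p u) (smul p u'))
     \<and> (\<forall>e u u'. \<rho> u u' \<longrightarrow> \<rho> (vcomp d e u) (vcomp d' e u'))"

definition gmap :: "(nat \<Rightarrow> int) \<Rightarrow> (nat \<Rightarrow> int) \<Rightarrow>
    ((nat \<Rightarrow> ('x::finite, 'k::field) mpoly) \<Rightarrow> (nat \<Rightarrow> ('x, 'k) mpoly)) \<Rightarrow> bool" where
  "gmap d d' F \<longleftrightarrow> (\<forall>u v. F (u + v) = F u + F v) \<and> (\<forall>p u. F (smul p u) = smul p (F u))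
     \<and> (\<forall>e u. F (vcomp d e u) = vcomp d' e (F u))"

definition syz :: "nat \<Rightarrow> (nat \<Rightarrow> nat \<Rightarrow> ('x, 'k::field) mpoly) \<Rightarrow> (nat \<Rightarrow> ('x, 'k) mpoly) set \<Rightarrow>
    (nat \<Rightarrow> ('x, 'k) mpoly) set" where
  "syz k g A = {c \<in> supp k. lc k c g \<in> A}"

lemma vcomp_diff: "vcomp d e (u - v) = vcomp d e u - vcomp d e v"
  by (simp add: vcomp_def hcomp_diff fun_eq_iff)

lemma vcomp_0 [simp]: "vcomp d e 0 = 0"
  by (simp add: vcomp_def fun_eq_iff)

lemma smul_0 [simp]: "smul p 0 = 0"
  by (simp add: smul_def fun_eq_iff)

lemma smul_0_left [simp]: "smul 0 u = 0"
  by (simp add: smul_def fun_eq_iff)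

lemma smul_diff: "smul p (u - v) = smul p u - smul p v"
  by (simp add: smul_def fun_eq_iff right_diff_distrib)

lemma smul_minus_1: "smul (- 1) u = - u"
  by (simp add: smul_def fun_eq_iff)

lemma hom_vcomp: "hom d e (vcomp d e u)"
  by (simp add: hom_def vcomp_def homogeneous_hcomp)

lemma vcomp_hom: "hom d e u \<Longrightarrow> vcomp d e u = u"
  by (simp add: hom_def vcomp_def hcomp_homogeneous fun_eq_iff)

lemma lc_0 [simp]: "lc 0 c g = 0"
  by (simp add: lc_def fun_eq_iff)

lemma lc_0_left [simp]: "lc k 0 g = 0"
  by (simp add: lc_def fun_eq_iff)

lemma lc_Suc: "lc (Suc k) c g = lc k c g + smul (c k) (g k)"
  by (simp add: lc_def smul_def fun_eq_iff)

lemma lc_add: "lc k (c + c') g = lc k c g + lc k c' g"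
  by (simp add: lc_def fun_eq_iff distrib_right sum.distrib)

lemma lc_diff: "lc k (c - c') g = lc k c g - lc k c' g"
  by (simp add: lc_def fun_eq_iff left_diff_distrib sum_subtractf)

lemma lc_smul: "lc k (smul p c) g = smul p (lc k c g)"
  by (simp only: lc_def smul_def sum_distrib_left mult.assoc)

lemma lc_vcomp:
  assumes "\<And>i. i < k \<Longrightarrow> hom d (e i) (g i)"
  shows "lc k (vcomp e f c) g = vcomp d f (lc k c g)"
proof
  fix j
  have "hcomp (f - e i) (c i) * g i j = hcomp (f - d j) (c i * g i j)" if "i < k" for i
    using assms[OF that] hcomp_mult[of "g i j" "e i - d j" "f - d j" "c i"] by (simp add: hom_def)
  then show "lc k (vcomp e f c) g j = vcomp d f (lc k c g) j"
    by (simp add: lc_def vcomp_def hcomp_sum)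
qed

lemma lc_trunc [simp]: "lc k (trunc k c) g = lc k c g"
  by (simp add: lc_def trunc_def fun_eq_iff)

lemma trunc_supp [simp]: "trunc k c \<in> supp k"
  by (simp add: trunc_def supp_def)

lemma trunc_self: "c \<in> supp k \<Longrightarrow> trunc k c = c"
  by (auto simp: trunc_def supp_def fun_eq_iff)

lemma lc_cat: "lc (k + l) c (cat k g h) = lc k c g + lc l (shift k c) h"
proof (induction l)
  case 0
  show ?case by (simp add: lc_def cat_def)
next
  case (Suc l)
  have "cat k g h (k + l) = h l" "shift k c l = c (k + l)" by (simp_all add: cat_def shift_def)
  with Suc show ?case by (simp add: lc_Suc add.assoc)
qed

lemma gsubD:
  assumes "gsub d A"
  shows gsub_0: "0 \<in> A" and gsub_add: "u \<in> A \<Longrightarrow> v \<in> A \<Longrightarrow> u + v \<in> A"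
    and gsub_smul: "u \<in> A \<Longrightarrow> smul p u \<in> A" and gsub_vcomp: "u \<in> A \<Longrightarrow> vcomp d e u \<in> A"
  using assms by (auto simp: gsub_def)

lemma gsub_minus: "gsub d A \<Longrightarrow> u \<in> A \<Longrightarrow> - u \<in> A"
  using gsub_smul[of d A u "- 1"] by (simp add: smul_minus_1)

lemma gsub_diff: "gsub d A \<Longrightarrow> u \<in> A \<Longrightarrow> v \<in> A \<Longrightarrow> u - v \<in> A"
  using gsub_add[of d A u "- v"] gsub_minus[of d A v] by simp

lemma gsub_diff_iff: "gsub d A \<Longrightarrow> u - v \<in> A \<Longrightarrow> u \<in> A \<longleftrightarrow> v \<in> A"
  using gsub_diff[of d A u "u - v"] gsub_add[of d A "u - v" v] by auto

lemma gsub_lc: "gsub d A \<Longrightarrow> (\<And>i. i < k \<Longrightarrow> g i \<in> A) \<Longrightarrow> lc k c g \<in> A"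
  by (induction k) (auto simp: lc_Suc gsub_0 gsub_add gsub_smul)

lemma gsub_zero [simp]: "gsub d {0}"
  by (simp add: gsub_def)

lemma gsub_supp [simp]: "gsub d (supp k)"
  by (auto simp: gsub_def supp_def smul_def vcomp_def)

lemma gsub_Int: "gsub d A \<Longrightarrow> gsub d B \<Longrightarrow> gsub d (A \<inter> B)"
  by (simp add: gsub_def)

lemma gmap_0:
  assumes "gmap d d' F"
  shows "F 0 = 0"
proof -
  have "F (smul 0 0) = smul 0 (F 0)" using assms unfolding gmap_def by blast
  then show ?thesis by simp
qed

lemma gsub_vimage: "gmap d d' F \<Longrightarrow> gsub d' A \<Longrightarrow> gsub d {u. F u \<in> A}"
  unfolding gsub_def using gmap_0[of d d' F] by (simp add: gmap_def)

lemma gmap_lc: "(\<And>i. i < k \<Longrightarrow> hom d (e i) (g i)) \<Longrightarrow> gmap e d (\<lambda>c. lc k c g)"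
  by (simp add: gmap_def lc_add lc_smul lc_vcomp)

lemma gmap_diff: "gmap d d' F \<Longrightarrow> gmap d d' G \<Longrightarrow> gmap d d' (\<lambda>u. F u - G u)"
  by (simp add: gmap_def smul_diff vcomp_diff)

lemma gmap_comp: "gmap d d' F \<Longrightarrow> gmap d' d'' G \<Longrightarrow> gmap d d'' (\<lambda>u. G (F u))"
  by (simp add: gmap_def)

lemma gmap_trunc: "(\<And>i. i < k \<Longrightarrow> d i = d' i) \<Longrightarrow> gmap d d' (trunc k)"
  by (auto simp: gmap_def trunc_def smul_def vcomp_def fun_eq_iff)

lemma gmap_shift: "(\<And>i. d (k + i) = d' i) \<Longrightarrow> gmap d d' (shift k)"
  by (auto simp: gmap_def shift_def smul_def vcomp_def fun_eq_iff)

lemma gsub_syz: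
  assumes "gsub d A" "\<And>i. i < k \<Longrightarrow> hom d (e i) (g i)"
  shows "gsub e (syz k g A)"
proof -
  have "syz k g A = supp k \<inter> {c. lc k c g \<in> A}" by (auto simp: syz_def)
  then show ?thesis
    by (auto intro!: gsub_Int gsub_vimage gmap_lc assms)
qed

lemma glinD:
  assumes "glin d d' \<rho>"
  shows glin_0: "\<rho> 0 0" and glin_add: "\<rho> u u' \<Longrightarrow> \<rho> v v' \<Longrightarrow> \<rho> (u + v) (u' + v')"
    and glin_smul: "\<rho> u u' \<Longrightarrow> \<rho> (smul p u) (smul p u')"
    and glin_vcomp: "\<rho> u u' \<Longrightarrow> \<rho> (vcomp d e u) (vcomp d' e u')"
  using assms by (auto simp: glin_def)

lemma glin_diff: "glin d d' \<rho> \<Longrightarrow> \<rho> u u' \<Longrightarrow> \<rho> v v' \<Longrightarrow> \<rho> (u - v) (u' - v')"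
  using glin_add[of d d' \<rho> u u' "- v" "- v'"] glin_smul[of d d' \<rho> v v' "- 1"]
  by (simp add: smul_minus_1)

lemma glin_lc: "glin d d' \<rho> \<Longrightarrow> (\<And>i. i < k \<Longrightarrow> \<rho> (g i) (g' i)) \<Longrightarrow> \<rho> (lc k c g) (lc k c g')"
  by (induction k) (auto simp: lc_Suc glin_0 glin_add glin_smul)

section \<open>Bounds on the regularity of a graded subquotient\<close>

definition generates :: "int \<Rightarrow> (nat \<Rightarrow> int) \<Rightarrow> (nat \<Rightarrow> ('x::finite, 'k::field) mpoly) set \<Rightarrow>
    (nat \<Rightarrow> ('x, 'k) mpoly) set \<Rightarrow> nat \<Rightarrow> (nat \<Rightarrow> nat \<Rightarrow> ('x, 'k) mpoly) \<Rightarrow> (nat \<Rightarrow> int) \<Rightarrow> bool" where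
  "generates r d A B k g e \<longleftrightarrow> (\<forall>i<k. g i \<in> B \<and> hom d (e i) (g i) \<and> e i \<le> r) \<and>
     (\<forall>b\<in>B. \<exists>c. b - lc k c g \<in> A)"

text \<open>
  \<open>reg_upto n r d A B\<close> says that \<open>B/A\<close> has the first \<open>n\<close> steps of a graded free resolution in which
  the generators of the \<open>i\<close>-th module have degree at most \<open>r + i\<close>; here \<open>d\<close> gives the degrees of the
  standard basis vectors of the ambient free module. Holding for all \<open>n\<close>, it means that the
  regularity of \<open>B/A\<close> is at most \<open>r\<close>.
\<close>

primrec reg_upto :: "nat \<Rightarrow> int \<Rightarrow> (nat \<Rightarrow> int) \<Rightarrow> (nat \<Rightarrow> ('x::finite, 'k::field) mpoly) set \<Rightarrow>
    (nat \<Rightarrow> ('x, 'k) mpoly) set \<Rightarrow> bool" where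
  "reg_upto 0 r d A B \<longleftrightarrow> True"
| "reg_upto (Suc n) r d A B \<longleftrightarrow>
     (\<exists>k g e. generates r d A B k g e \<and> reg_upto n (r + 1) e {0} (syz k g A))"

lemma reg_upto_SucI:
  "generates r d A B k g e \<Longrightarrow> reg_upto n (r + 1) e {0} (syz k g A) \<Longrightarrow> reg_upto (Suc n) r d A B"
  by auto

lemma reg_upto_SucE:
  assumes "reg_upto (Suc n) r d A B"
  obtains k g e where "generates r d A B k g e" "reg_upto n (r + 1) e {0} (syz k g A)"
  using assms by auto

declare reg_upto.simps(2) [simp del]

text \<open>The relation induces an isomorphism of \<open>B/A\<close> with \<open>B'/A'\<close>.
  Corresponding generators have literally the same syzygies, so only the first step of the
  resolution has to be transported.\<close>

lemma reg_upto_rel: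
  assumes R: "reg_upto n r d A B" and rho: "glin d d' \<rho>"
    and B: "\<And>u. u \<in> B \<longleftrightarrow> (\<exists>u'. \<rho> u u')" and B': "\<And>u'. u' \<in> B' \<longleftrightarrow> (\<exists>u. \<rho> u u')"
    and A: "\<And>u u'. \<rho> u u' \<Longrightarrow> u \<in> A \<longleftrightarrow> u' \<in> A'"
  shows "reg_upto n r d' A' B'"
proof (cases n)
  case (Suc m)
  obtain k g e where g: "generates r d A B k g e" and K: "reg_upto m (r + 1) e {0} (syz k g A)"
    using R unfolding Suc by (rule reg_upto_SucE)
  have "\<forall>i. \<exists>u'. i < k \<longrightarrow> \<rho> (g i) u'" using g B by (auto simp: generates_def)
  then obtain h where h: "\<And>i. i < k \<Longrightarrow> \<rho> (g i) (h i)" by metis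
  \<comment> \<open>The chosen partner \<open>h i\<close> need not be homogeneous; its component of
    degree \<open>e i\<close> is, and it is still related to \<open>g i\<close>.\<close>
  define g' where "g' i = vcomp d' (e i) (h i)" for i
  have g': "\<rho> (g i) (g' i)" if "i < k" for i
    using glin_vcomp[OF rho h[OF that], of "e i"] g that unfolding g'_def
    by (simp add: generates_def vcomp_hom)
  have l: "\<rho> (lc k c g) (lc k c g')" for c by (rule glin_lc[OF rho g'])
  have "syz k g' A' = syz k g A" using A[OF l] by (auto simp: syz_def)
  moreover have "generates r d' A' B' k g' e"
    unfolding generates_def
  proof (intro conjI allI impI ballI)
    fix b' assume "b' \<in> B'"
    then obtain b where b: "\<rho> b b'" using B' by auto
    then have "b \<in> B" using B by auto
    then obtain c where "b - lc k c g \<in> A" using g unfolding generates_def by blast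
    then show "\<exists>c. b' - lc k c g' \<in> A'" using A glin_diff[OF rho b l] by blast
  qed (use g g' B' in \<open>auto simp: generates_def g'_def hom_vcomp\<close>)
  ultimately show ?thesis
    using K unfolding Suc by (intro reg_upto_SucI) auto
qed simp

lemma reg_upto_map:
  assumes F: "gmap d d' F" and B: "gsub d B" and B': "F ` B = B'"
    and A: "\<And>u. u \<in> B \<Longrightarrow> F u \<in> A' \<longleftrightarrow> u \<in> A"
  shows "reg_upto n r d A B \<longleftrightarrow> reg_upto n r d' A' B'"
proof
  have F0: "F 0 = 0" by (rule gmap_0[OF F])
  assume R: "reg_upto n r d A B"
  have "glin d d' (\<lambda>u u'. u \<in> B \<and> u' = F u)"
    using F B F0 by (auto simp: glin_def gmap_def gsub_def)
  then show "reg_upto n r d' A' B'"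
    by (rule reg_upto_rel[OF R]) (use A B' in auto)
next
  have F0: "F 0 = 0" by (rule gmap_0[OF F])
  assume R: "reg_upto n r d' A' B'"
  have "glin d' d (\<lambda>u' u. u \<in> B \<and> u' = F u)"
    using F B F0 by (auto simp: glin_def gmap_def gsub_def)
  then show "reg_upto n r d A B"
    by (rule reg_upto_rel[OF R]) (use A B' in auto)
qed

lemma reg_upto_mono: "reg_upto n r d A B \<Longrightarrow> r \<le> r' \<Longrightarrow> reg_upto n r' d A B"
proof (induction n arbitrary: r r' d A B)
  case (Suc n)
  from Suc.prems(1) obtain k g e
    where g: "generates r d A B k g e" and K: "reg_upto n (r + 1) e {0} (syz k g A)"
    by (rule reg_upto_SucE)
  have "generates r' d A B k g e" using g Suc.prems(2) by (auto simp: generates_def)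
  then show ?case using Suc.IH[OF K, of "r' + 1"] Suc.prems(2) by (intro reg_upto_SucI) auto
qed simp

lemma reg_upto_shift:
  "reg_upto n r d A B \<Longrightarrow> reg_upto n (r + s) (\<lambda>i. d i + s) A B"
proof (induction n arbitrary: r d A B)
  case (Suc n)
  from Suc.prems obtain k g e
    where g: "generates r d A B k g e" and K: "reg_upto n (r + 1) e {0} (syz k g A)"
    by (rule reg_upto_SucE)
  have "generates (r + s) (\<lambda>i. d i + s) A B k g (\<lambda>i. e i + s)"
    using g by (auto simp: generates_def hom_def)
  moreover have "reg_upto n (r + s + 1) (\<lambda>i. e i + s) {0} (syz k g A)"
    using Suc.IH[OF K] by (simp add: algebra_simps)
  ultimately show ?case by (rule reg_upto_SucI)
qed simp

lemma syz_0: "gsub d A \<Longrightarrow> syz 0 g A = {0}"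
  by (auto simp: syz_def supp_def fun_eq_iff gsub_0)

lemma reg_upto_refl: "gsub d A \<Longrightarrow> reg_upto n r d A A"
proof (induction n arbitrary: r d A)
  case (Suc n)
  have "generates r d A A 0 undefined undefined" using Suc.prems by (auto simp: generates_def)
  moreover have "reg_upto n (r + 1) undefined {0} (syz 0 undefined A)"
    using Suc.IH[of undefined "{0}" "r + 1"] by (simp add: syz_0[OF Suc.prems])
  ultimately show ?case by (rule reg_upto_SucI)
qed simp

lemma reg_upto_supp:
  assumes "\<And>i. i < k \<Longrightarrow> d i \<le> r"
  shows "reg_upto n r d {0} (supp k :: (nat \<Rightarrow> ('x::finite, 'k::field) mpoly) set)"
proof (cases n)
  case (Suc m)
  define g :: "nat \<Rightarrow> nat \<Rightarrow> ('x, 'k) mpoly" where "g i = (\<lambda>j. if j = i then 1 else 0)" for i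
  have l: "lc k c g = trunc k c" for c
    by (auto simp: lc_def g_def trunc_def fun_eq_iff if_distrib[of "\<lambda>x. _ * x"] cong: if_cong)
  have "generates r d {0} (supp k) k g d"
    unfolding generates_def
  proof (intro conjI allI impI ballI)
    fix b :: "nat \<Rightarrow> ('x, 'k) mpoly" assume "b \<in> supp k"
    then show "\<exists>c. b - lc k c g \<in> {0}" by (intro exI[of _ b]) (simp add: l trunc_self)
  qed (use assms in \<open>auto simp: g_def hom_def supp_def homogeneous_1\<close>)
  moreover have "syz k g {0} = {0}"
    by (auto simp: syz_def l trunc_self supp_def)
  ultimately show ?thesis using Suc reg_upto_refl[of d "{0}" m "r + 1"]
    unfolding Suc by (intro reg_upto_SucI) auto
qed simp

text \<open>Horseshoe lemma: generators of \<open>B/A\<close> followed by lifted generators of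
  \<open>C/B\<close> generate \<open>C/A\<close>, and the syzygies of the joint system again form an
  extension, to which the induction hypothesis applies.\<close>

lemma reg_upto_extension:
  "reg_upto n r d A B \<Longrightarrow> reg_upto n r d B C \<Longrightarrow> gsub d A \<Longrightarrow> gsub d B \<Longrightarrow> gsub d C \<Longrightarrow>
    A \<subseteq> B \<Longrightarrow> B \<subseteq> C \<Longrightarrow> reg_upto n r d A C"
proof (induction n arbitrary: r d A B C)
  case (Suc n)
  obtain k g e where g: "generates r d A B k g e" and K1: "reg_upto n (r + 1) e {0} (syz k g A)"
    using Suc.prems(1) by (rule reg_upto_SucE)
  obtain l h f where h: "generates r d B C l h f" and K2: "reg_upto n (r + 1) f {0} (syz l h B)"
    using Suc.prems(2) by (rule reg_upto_SucE)
  define E where "E = cat k e f"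
  define G where "G = cat k g h"
  have gh: "\<And>i. i < k \<Longrightarrow> hom d (e i) (g i)" "\<And>i. i < l \<Longrightarrow> hom d (f i) (h i)" 
    "\<And>i. i < k + l \<Longrightarrow> hom d (E i) (G i)"
    using g h by (auto simp: generates_def E_def G_def cat_def)
  have lcB: "lc k c g \<in> B" for c using gsub_lc[OF Suc.prems(4)] g by (auto simp: generates_def)
  \<comment> \<open>Coefficients \<open>c\<close> for \<open>h\<close> that leave a remainder in
    \<open>B\<close> are completed by coefficients for \<open>g\<close>, placed in front, so that
    the remainder falls into \<open>A\<close>.\<close>
  have gen: "\<exists>c'. shift k c' = c \<and> b - lc (k + l) c' G \<in> A" if b: "b - lc l c h \<in> B" for b c
  proof -
    obtain c' where "b - lc l c h - lc k c' g \<in> A" using b g by (auto simp: generates_def)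
    moreover have "lc k (cat k c' c) g = lc k c' g"
      by (simp add: lc_def cat_def)
    moreover have "shift k (cat k c' c) = c" by (simp add: shift_def cat_def fun_eq_iff)
    ultimately show ?thesis
      by (intro exI[of _ "cat k c' c"]) (simp add: G_def lc_cat algebra_simps)
  qed
  have 1: "generates r d A C (k + l) G E"
    unfolding generates_def
  proof (intro conjI allI impI ballI)
    fix i assume "i < k + l"
    then show "G i \<in> C" "E i \<le> r"
      using g h Suc.prems(7) by (auto simp: generates_def G_def E_def cat_def)
  next
    fix b assume "b \<in> C"
    then obtain c where "b - lc l c h \<in> B" using h by (auto simp: generates_def)
    then show "\<exists>c. b - lc (k + l) c G \<in> A" using gen by blast
  qed (use gh in auto)
  have shift0: "shift k u = 0 \<longleftrightarrow> u \<in> supp k" for u :: "nat \<Rightarrow> ('a, 'b) mpoly"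
    by (auto simp: shift_def supp_def fun_eq_iff le_iff_add)
  have lcs: "lc (k + l) u G = lc k u g" if "u \<in> supp k" for u
    using that shift0[of u] by (simp add: G_def lc_cat)
  have sub: "syz k g A \<subseteq> syz (k + l) G A"
    using lcs by (auto simp: syz_def) (auto simp: supp_def)
  have gsubs: "gsub e (syz k g A)" "gsub E (syz (k + l) G A)"
    using gsub_syz[OF Suc.prems(3)] gh by blast+
  have gE: "gsub E (syz k g A)"
    by (rule gsub_syz[OF Suc.prems(3)]) (use gh(1) in \<open>simp add: E_def cat_def\<close>)
  have "trunc k ` syz k g A = syz k g A"
    by (force simp: syz_def trunc_self)
  then have "reg_upto n (r + 1) E {0} (syz k g A)"
    using reg_upto_map[of e E "trunc k" "syz k g A" "syz k g A" "{0}" "{0}"] K1 gsubs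
    by (auto simp: gmap_trunc E_def cat_def trunc_self syz_def)
  \<comment> \<open>Dropping the first \<open>k\<close> coefficients maps the joint syzygies onto
    those of \<open>h\<close> modulo \<open>B\<close>; its kernel consists of the syzygies of
    \<open>g\<close> modulo \<open>A\<close>.\<close>
  moreover have "reg_upto n (r + 1) E (syz k g A) (syz (k + l) G A)"
  proof -
    have "shift k ` syz (k + l) G A = syz l h B"
    proof (intro equalityI subsetI)
      fix c assume "c \<in> shift k ` syz (k + l) G A"
      then obtain u where u: "u \<in> supp (k + l)" "lc k u g + lc l (shift k u) h \<in> A" "c = shift k u"
        by (auto simp: syz_def G_def lc_cat)
      then have "lc l c h \<in> B"
        using Suc.prems(6) gsub_diff[OF Suc.prems(4), of "lc k u g + lc l c h" "lc k u g"] lcB by auto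
      then show "c \<in> syz l h B"
        using u by (auto simp: syz_def supp_def shift_def)
    next
      fix c assume c: "c \<in> syz l h B"
      then have "0 - lc l c h \<in> B"
        by (auto simp: syz_def gsub_minus[OF Suc.prems(4)])
      then obtain c' where c': "shift k c' = c" "0 - lc (k + l) c' G \<in> A" using gen by blast
      then have "lc (k + l) c' G \<in> A" using gsub_minus[OF Suc.prems(3)] by fastforce
      moreover have "c' \<in> supp (k + l)"
        unfolding supp_def
      proof (safe)
        fix i assume i: "k + l \<le> i"
        then have "c' i = c (i - k)" using c'(1) by (auto simp: shift_def)
        then show "c' i = 0" using i c by (auto simp: syz_def supp_def)
      qed
      ultimately show "c \<in> shift k ` syz (k + l) G A" using c' by (auto simp: syz_def)
    qed
    moreover have "shift k u \<in> {0} \<longleftrightarrow> u \<in> syz k g A" if "u \<in> syz (k + l) G A" for u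
      using that by (auto simp: syz_def shift0 lcs)
    moreover have "gmap E f (shift k)" by (rule gmap_shift) (simp add: E_def cat_def)
    ultimately show ?thesis using reg_upto_map[of E f "shift k"] gsubs K2 by blast
  qed
  ultimately have "reg_upto n (r + 1) E {0} (syz (k + l) G A)"
    by (rule Suc.IH[OF _ _ gsub_zero gE gsubs(2) _ sub]) (use gsub_0[OF gE] in auto)
  with 1 show ?case by (rule reg_upto_SucI)
qed simp

text \<open>The free cover of \<open>B/A\<close> given by \<open>g\<close> identifies
  \<open>C/A\<close> with the preimage of \<open>C\<close> modulo the preimage of \<open>A\<close>.
  The relation \<open>\<rho>\<close> pairs \<open>u\<close> with every coefficient vector that
  represents it modulo \<open>A\<close>.\<close>

lemma generates_syz_rel:
  assumes "generates r d A B k g e" and A: "gsub d A" and C: "gsub d C" and "A \<subseteq> C" "C \<subseteq> B"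
  shows "reg_upto n s d A C \<longleftrightarrow> reg_upto n s e (syz k g A) (syz k g C)"
proof -
  have hom: "\<And>i. i < k \<Longrightarrow> hom d (e i) (g i)" using assms(1) by (auto simp: generates_def)
  define \<rho> where "\<rho> u c \<longleftrightarrow> u \<in> C \<and> c \<in> syz k g C \<and> u - lc k c g \<in> A" for u c
  have lin: "\<rho> 0 0" "\<And>u u' v v'. \<rho> u u' \<Longrightarrow> \<rho> v v' \<Longrightarrow> \<rho> (u + v) (u' + v')"
    "\<And>p u u'. \<rho> u u' \<Longrightarrow> \<rho> (smul p u) (smul p u')" "\<And>f u u'. \<rho> u u' \<Longrightarrow> \<rho> (vcomp d f u) (vcomp e f u')"
  proof -
    have G: "gsub e (syz k g C)" by (rule gsub_syz[OF C hom])
    show "\<rho> 0 0" using A C G by (simp add: \<rho>_def gsub_0)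
    show "\<rho> (u + v) (u' + v')" if "\<rho> u u'" "\<rho> v v'" for u u' v v'
      using that A C G gsub_add[OF A, of "u - lc k u' g" "v - lc k v' g"]
      by (simp add: \<rho>_def lc_add gsub_add algebra_simps)
    show "\<rho> (smul p u) (smul p u')" if "\<rho> u u'" for p u u'
      using that A C G gsub_smul[OF A, of "u - lc k u' g" p]
      by (simp add: \<rho>_def lc_smul gsub_smul smul_diff)
    show "\<rho> (vcomp d f u) (vcomp e f u')" if "\<rho> u u'" for f u u'
      using that A C G gsub_vcomp[OF A, of "u - lc k u' g" f]
      by (simp add: \<rho>_def gsub_vcomp vcomp_diff lc_vcomp[of k d e g, OF hom])
  qed
  have "\<exists>c. \<rho> u c" if "u \<in> C" for u
  proof -
    have "u \<in> B" using that assms(5) by auto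
    then obtain c where c: "u - lc k c g \<in> A" using assms(1) unfolding generates_def by blast
    then have "lc k c g \<in> C"
      using that gsub_diff_iff[OF C, of u "lc k c g"] assms(4) by auto
    then have "\<rho> u (trunc k c)" using c that by (simp add: \<rho>_def syz_def)
    then show ?thesis by blast
  qed
  then have l: "u \<in> C \<longleftrightarrow> (\<exists>c. \<rho> u c)" for u by (auto simp: \<rho>_def)
  have "\<rho> (lc k c g) c" if "c \<in> syz k g C" for c
    using that A by (simp add: \<rho>_def syz_def gsub_0)
  moreover have "c \<in> syz k g C" if "\<rho> u c" for u c using that by (simp add: \<rho>_def)
  ultimately have r: "c \<in> syz k g C \<longleftrightarrow> (\<exists>u. \<rho> u c)" for c by blast
  have eq: "u \<in> A \<longleftrightarrow> c \<in> syz k g A" if "\<rho> u c" for u c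
    using that gsub_diff_iff[OF A, of u "lc k c g"] by (auto simp: \<rho>_def syz_def)
  show ?thesis
  proof
    have "glin d e \<rho>" using lin unfolding glin_def by blast
    then show "reg_upto n s e (syz k g A) (syz k g C)" if "reg_upto n s d A C"
      by (rule reg_upto_rel[OF that _ l r eq])
    have "glin e d (\<lambda>c u. \<rho> u c)" using lin unfolding glin_def by blast
    then show "reg_upto n s d A C" if "reg_upto n s e (syz k g A) (syz k g C)"
      by (rule reg_upto_rel[OF that _ r l]) (simp add: eq)
  qed
qed

text \<open>The generators of \<open>C/A\<close> also generate \<open>C/B\<close>, and their
  syzygies modulo \<open>B\<close> are an extension of a copy of \<open>B/A\<close> by their
  syzygies modulo \<open>A\<close>. As \<open>B/A\<close> enters one step later, the bound
  \<open>r + 1\<close> suffices for it.\<close>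

lemma reg_upto_quotient:
  assumes C: "reg_upto (Suc n) r d A C" and B: "reg_upto n (r + 1) d A B"
    and gs: "gsub d A" "gsub d B" and sub: "A \<subseteq> B" "B \<subseteq> C"
  shows "reg_upto (Suc n) r d B C"
proof -
  obtain k g e where g: "generates r d A C k g e" and K: "reg_upto n (r + 1) e {0} (syz k g A)"
    using C by (rule reg_upto_SucE)
  have hom: "\<And>i. i < k \<Longrightarrow> hom d (e i) (g i)" using g by (auto simp: generates_def)
  have G: "gsub e (syz k g A)" "gsub e (syz k g B)"
    by (rule gsub_syz[OF gs(1) hom], assumption, rule gsub_syz[OF gs(2) hom])
  have "generates r d B C k g e"
    using g sub(1) unfolding generates_def by blast
  moreover have "reg_upto n (r + 1) e (syz k g A) (syz k g B)"
    using generates_syz_rel[OF g gs sub] B by simp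
  then have "reg_upto n (r + 1) e {0} (syz k g B)"
    using reg_upto_extension[OF K _ gsub_zero G] gsub_0[OF G(1)] sub(1) by (auto simp: syz_def)
  ultimately show ?thesis by (rule reg_upto_SucI)
qed

text \<open>
  The pullback \<open>W\<close> of \<open>C \<rightarrow> C/B\<close> along a free cover \<open>F \<rightarrow> C/B\<close> is an extension of \<open>C/A\<close> by the
  syzygies of \<open>C/B\<close>, and \<open>B/A\<close> is the quotient of \<open>W/A\<close> by a copy of \<open>F\<close>.
\<close>

lemma reg_upto_kernel:
  assumes C: "reg_upto n (r + 1) d A C" and CB: "reg_upto (Suc n) r d B C"
    and gs: "gsub d A" "gsub d B" "gsub d C" and sub: "A \<subseteq> B" "B \<subseteq> C" "C \<subseteq> supp N"
  shows "reg_upto n (r + 1) d A B"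
proof (cases n)
  case (Suc m)
  obtain l h f where h: "generates r d B C l h f" and K: "reg_upto n (r + 1) f {0} (syz l h B)"
    using CB by (rule reg_upto_SucE)
  have hom: "\<And>i. i < l \<Longrightarrow> hom d (f i) (h i)" using h by (auto simp: generates_def)
  have lcC: "lc l c h \<in> C" for c using gsub_lc[OF gs(3)] h by (auto simp: generates_def)
  \<comment> \<open>A pair from \<open>C\<close> and the free cover is stored in one vector: the
    slots below \<open>N\<close> hold the element of \<open>C\<close>, the later ones the
    coefficients for \<open>h\<close>. \<open>\<delta>\<close> is the difference of the two values,
    \<open>W\<close> the pullback, and \<open>P\<close> the kernel of the map from \<open>W\<close>
    to \<open>B/A\<close> induced by \<open>\<delta>\<close>; \<open>A1\<close> and
    \<open>A2\<close> are \<open>A\<close> paired with 0 and with the syzygies of \<open>h\<close>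
    modulo \<open>B\<close>.\<close>
  define D where "D = cat N d f"
  define \<delta> where "\<delta> u = trunc N u - lc l (shift N u) h" for u
  define A1 where "A1 = {u. trunc N u \<in> A} \<inter> {u. shift N u \<in> {0}}"
  define A2 where "A2 = {u. trunc N u \<in> A} \<inter> {u. shift N u \<in> syz l h B}"
  define W where "W = {u. trunc N u \<in> C} \<inter> {u. shift N u \<in> supp l} \<inter> {u. \<delta> u \<in> B}"
  define P where "P = {u. shift N u \<in> supp l} \<inter> {u. \<delta> u \<in> A}"
  have maps: "gmap D d (trunc N)" "gmap D f (shift N)"
    by (auto intro!: gmap_trunc gmap_shift simp: D_def cat_def)
  then have dmap: "gmap D d \<delta>"
    unfolding \<delta>_def by (intro gmap_diff gmap_comp[OF _ gmap_lc]) (auto intro: hom)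
  have syzh: "gsub f (syz l h B)" by (rule gsub_syz[OF gs(2) hom])
  have G: "gsub D A1" "gsub D A2" "gsub D W" "gsub D P"
    unfolding A1_def A2_def W_def P_def
    using gs syzh gsub_vimage[OF maps(2) gsub_zero]
    by (auto intro!: gsub_Int intro: gsub_vimage[OF maps(1)] gsub_vimage[OF maps(2)]
        gsub_vimage[OF dmap] gsub_supp simp del: singleton_iff)
  have tr: "trunc N (cat N u v) = trunc N u" "shift N (cat N u v) = v" for u v :: "nat \<Rightarrow> ('a, 'b) mpoly"
    by (auto simp: trunc_def cat_def shift_def fun_eq_iff)
  have trC: "trunc N u = u" if "u \<in> C" for u using that sub(3) by (auto simp: trunc_self)
  have A12: "A1 \<subseteq> A2" "A1 \<subseteq> P" "P \<subseteq> W" "A2 \<subseteq> W"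
  proof -
    show "A1 \<subseteq> A2" using gsub_0[OF gs(2)] by (auto simp: A1_def A2_def syz_def supp_def)
    show "A1 \<subseteq> P" using gsub_0[OF gs(2)] by (auto simp: A1_def P_def \<delta>_def supp_def)
    show "P \<subseteq> W"
    proof
      fix u assume u: "u \<in> P"
      then have "\<delta> u + lc l (shift N u) h \<in> C"
        using sub by (intro gsub_add[OF gs(3)] lcC) (auto simp: P_def)
      then have "trunc N u \<in> C" by (simp add: \<delta>_def)
      then show "u \<in> W" using u sub(1) by (auto simp: W_def P_def)
    qed
    show "A2 \<subseteq> W" using sub gsub_diff[OF gs(2)] by (auto simp: A2_def W_def \<delta>_def syz_def)
  qed
  have "shift N ` A2 = syz l h B"
  proof (intro equalityI subsetI)
    fix v assume "v \<in> syz l h B"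
    then show "v \<in> shift N ` A2"
      using gsub_0[OF gs(1)] by (intro image_eqI[of _ _ "cat N 0 v"]) (auto simp: A2_def tr, simp add: trunc_def zero_fun_def)
  qed (auto simp: A2_def)
  then have 1: "reg_upto n (r + 1) D A1 A2"
    using reg_upto_map[OF maps(2) G(2), of "syz l h B" "{0}" A1] K by (auto simp: A1_def A2_def)
  have "trunc N ` W = C"
  proof (intro equalityI subsetI)
    fix v assume v: "v \<in> C"
    then obtain c where "v - lc l c h \<in> B" using h unfolding generates_def by blast
    then show "v \<in> trunc N ` W"
      using v trC by (intro image_eqI[of _ _ "cat N v (trunc l c)"]) (auto simp: W_def tr \<delta>_def)
  qed (auto simp: W_def)
  moreover have "trunc N u \<in> A \<longleftrightarrow> u \<in> A2" if "u \<in> W" for u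
    using that gsub_diff_iff[OF gs(2), of "trunc N u" "lc l (shift N u) h"] sub(1)
    by (auto simp: W_def A2_def \<delta>_def syz_def)
  ultimately have 2: "reg_upto n (r + 1) D A2 W"
    using reg_upto_map[OF maps(1) G(3), of C A A2] C by blast
  have "shift N ` P = supp l"
  proof (intro equalityI subsetI)
    fix v :: "nat \<Rightarrow> ('a, 'b) mpoly" assume v: "v \<in> supp l"
    then show "v \<in> shift N ` P"
      using gsub_0[OF gs(1)]
      by (intro image_eqI[of _ _ "cat N (lc l v h) v"]) (auto simp: P_def tr \<delta>_def trC[OF lcC])
  qed (auto simp: P_def)
  moreover have "shift N u \<in> {0} \<longleftrightarrow> u \<in> A1" if "u \<in> P" for u
    using that by (auto simp: P_def A1_def \<delta>_def)
  \<comment> \<open>The free cover has generators of degree at most \<open>r\<close>, well below the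
    \<open>r + 2\<close> that the quotient step asks of the submodule.\<close>
  moreover have "reg_upto m (r + 1 + 1) f {0} (supp l :: (nat \<Rightarrow> ('a, 'b) mpoly) set)"
    using h by (intro reg_upto_supp) (auto simp: generates_def)
  ultimately have 3: "reg_upto m (r + 1 + 1) D A1 P"
    using reg_upto_map[OF maps(2) G(4), of "supp l" "{0}" A1] by blast
  have "reg_upto n (r + 1) D A1 W"
    by (rule reg_upto_extension[OF 1 2 G(1-3) A12(1,4)])
  then have 4: "reg_upto n (r + 1) D P W"
    using reg_upto_quotient[OF _ 3 G(1,4) A12(2,3)] Suc by auto
  \<comment> \<open>An element of \<open>B\<close> paired with zero coefficients lies in
    \<open>W\<close> and is its own difference, so \<open>W/P\<close> is a copy of
    \<open>B/A\<close>.\<close>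
  have "\<delta> ` W = B"
  proof (intro equalityI subsetI)
    fix v assume v: "v \<in> B"
    then have "trunc N v = v" using trC sub(2) by auto
    then show "v \<in> \<delta> ` W"
      using v sub(2) by (intro image_eqI[of _ _ "cat N v 0"]) (auto simp: W_def tr \<delta>_def supp_def)
  qed (auto simp: W_def)
  moreover have "\<delta> u \<in> A \<longleftrightarrow> u \<in> P" if "u \<in> W" for u
    using that by (auto simp: W_def P_def)
  ultimately show ?thesis
    using reg_upto_map[OF dmap G(3), of B A P] 4 by blast
qed simp

text \<open>This is the use made of Schanuel's lemma: the bound passes to the syzygies of any
  generating system in degrees at most \<open>r\<close>, not only of the one that witnesses it. The
  preimage of \<open>B\<close> is the whole free module, so the kernel lemma applies to that module
  and its quotient \<open>B/A\<close>.\<close>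

lemma reg_upto_syz:
  assumes B: "reg_upto (Suc n) r d A B" and g: "generates r d A B k g e"
    and gs: "gsub d A" "gsub d B" and sub: "A \<subseteq> B"
  shows "reg_upto n (r + 1) e {0} (syz k g A)"
proof -
  have hom: "\<And>i. i < k \<Longrightarrow> hom d (e i) (g i)" using g by (auto simp: generates_def)
  have G: "gsub e (syz k g A)" by (rule gsub_syz[OF gs(1) hom])
  have "syz k g B = supp k"
    using gsub_lc[OF gs(2), of k g] g by (auto simp: syz_def generates_def)
  then have "reg_upto (Suc n) r e (syz k g A) (supp k)"
    using generates_syz_rel[OF g gs sub order_refl] B by simp
  moreover have "reg_upto n (r + 1) e {0} (supp k :: (nat \<Rightarrow> ('a, 'b) mpoly) set)"
    using g by (intro reg_upto_supp) (auto simp: generates_def)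
  ultimately show ?thesis
    using reg_upto_kernel[of n r e "{0}" "supp k" "syz k g A" k] G gsub_0[OF G]
    by (auto simp: syz_def)
qed

text \<open>All syzygies lie in the irrelevant ideal times the free module. Since the columns of the
  next differential are syzygies, this is minimality of a resolution read off one step.\<close>

definition minimal_gens :: "nat \<Rightarrow> (nat \<Rightarrow> nat \<Rightarrow> ('x, 'k::field) mpoly) \<Rightarrow> bool" where
  "minimal_gens k g \<longleftrightarrow> (\<forall>c\<in>syz k g {0}. \<forall>i<k. Poly_Mapping.lookup (c i) 0 = 0)"

lemma lc_remove:
  assumes "c i0 = 0" "i0 < k"
  shows "lc k c g = lc (k - 1) (\<lambda>i. c (if i < i0 then i else Suc i)) (\<lambda>i. g (if i < i0 then i else Suc i))"
proof
  fix j
  let ?s = "\<lambda>i. if i < i0 then i else Suc i"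
  have "bij_betw ?s {..<k - 1} ({..<k} - {i0})"
    unfolding bij_betw_def
  proof
    show "?s ` {..<k - 1} = {..<k} - {i0}"
    proof (intro equalityI subsetI)
      fix i assume i: "i \<in> {..<k} - {i0}"
      then show "i \<in> ?s ` {..<k - 1}"
        using assms(2) by (intro image_eqI[of _ _ "if i < i0 then i else i - 1"]) auto
    qed (use assms(2) in auto)
  qed (auto simp: inj_on_def split: if_splits)
  from sum.reindex_bij_betw[OF this, of "\<lambda>i. c i * g i j"]
  have "(\<Sum>i<k - 1. c (?s i) * g (?s i) j) = (\<Sum>i\<in>{..<k} - {i0}. c i * g i j)" by simp
  also have "\<dots> = (\<Sum>i<k. c i * g i j)"
    using assms by (subst (2) sum.remove[of _ i0]) auto
  finally show "lc k c g j = lc (k - 1) (\<lambda>i. c (?s i)) (\<lambda>i. g (?s i)) j"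
    by (simp add: lc_def)
qed

lemma minimal_gens_exist:
  assumes "reg_upto (Suc n) r d {0} B" and B: "gsub d B"
  shows "\<exists>k g e. generates r d {0} B k g e \<and> minimal_gens k g"
proof -
  define Q where "Q k \<longleftrightarrow> (\<exists>g e. generates r d {0} B k g e)" for k
  define k where "k = (LEAST k. Q k)"
  have "\<exists>k. Q k" unfolding Q_def using assms(1) reg_upto_SucE by blast
  then have "Q k" unfolding k_def by (rule LeastI_ex)
  then obtain g e where g: "generates r d {0} B k g e" by (auto simp: Q_def)
  have hom: "\<And>i. i < k \<Longrightarrow> hom d (e i) (g i)" using g by (auto simp: generates_def)
  have "minimal_gens k g"
    unfolding minimal_gens_def
  proof (intro ballI allI impI, rule ccontr)
    fix c i0 assume c: "c \<in> syz k g {0}" and i0: "i0 < k" and nz: "Poly_Mapping.lookup (c i0) 0 \<noteq> 0"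
    define a where "a = Poly_Mapping.lookup (c i0) 0"
    \<comment> \<open>In the component of degree \<open>e i0\<close> the coefficient at
      \<open>i0\<close> has degree 0, so it becomes the scalar \<open>a\<close> and can be
      inverted.\<close>
    define c' where "c' = vcomp e (e i0) c"
    have "gsub e (syz k g {0})" by (rule gsub_syz[OF gsub_zero hom])
    then have "c' \<in> syz k g {0}" unfolding c'_def by (rule gsub_vcomp[OF _ c])
    then have c'0: "lc k c' g = 0" by (simp add: syz_def)
    have "c' i0 \<in> homogeneous 0" "Poly_Mapping.lookup (c' i0) 0 = a"
      by (simp_all add: c'_def vcomp_def homogeneous_hcomp lookup_hcomp_0 a_def)
    then have c'i0: "c' i0 = Poly_Mapping.single 0 a"
      using homogeneous_0_const by metis
    define s where "s i = (if i < i0 then i else Suc i)" for i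
    have "generates r d {0} B (k - 1) (\<lambda>i. g (s i)) (\<lambda>i. e (s i))"
      unfolding generates_def
    proof (intro conjI allI impI ballI)
      fix b assume "b \<in> B"
      then obtain x where x: "b = lc k x g" using g unfolding generates_def by auto
      \<comment> \<open>Subtracting this multiple of the syzygy leaves the combination
        \<open>b\<close> unchanged and cancels the coefficient of \<open>g i0\<close>.\<close>
      define x' where "x' = x - smul (Poly_Mapping.single 0 (1 / a) * x i0) c'"
      have "lc k x' g = b" by (simp add: x'_def lc_diff lc_smul c'0 x)
      moreover have "x' i0 = 0"
      proof -
        have "Poly_Mapping.single 0 (1 / a) * x i0 * Poly_Mapping.single 0 a
            = x i0 * (Poly_Mapping.single 0 (1 / a) * Poly_Mapping.single 0 a)"
          by (simp only: mult.assoc mult.left_commute)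
        also have "\<dots> = x i0" using nz by (simp add: mult_single a_def)
        finally show ?thesis by (simp add: x'_def smul_def c'i0)
      qed
      ultimately have "b = lc (k - 1) (\<lambda>i. x' (s i)) (\<lambda>i. g (s i))"
        using lc_remove[of x' i0 k g] i0 by (simp add: s_def)
      then show "\<exists>c. b - lc (k - 1) c (\<lambda>i. g (s i)) \<in> {0}" by auto
    qed (use g in \<open>auto simp: generates_def s_def\<close>)
    then have "Q (k - 1)" by (auto simp: Q_def)
    then have "k \<le> k - 1" unfolding k_def by (rule Least_le)
    then show False using i0 by simp
  qed
  then show ?thesis using g by blast
qed

text \<open>Write \<open>g q\<close> homogeneously through a system \<open>h\<close> of degrees at
  most \<open>r\<close>, and \<open>h\<close> through \<open>g\<close>. Minimality forces some
  coefficient \<open>C i\<close> in the first expression to have a nonzero constant term; being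
  homogeneous of degree \<open>e q - f i\<close>, it gives \<open>e q = f i\<close>.\<close>

lemma minimal_gens_degree:
  assumes R: "reg_upto (Suc n) r d {0} B" and g: "generates r' d {0} B k g e"
    and m: "minimal_gens k g"
  shows "generates r d {0} B k g e"
proof -
  obtain l h f where h: "generates r d {0} B l h f" using R by (rule reg_upto_SucE)
  have hhom: "\<And>i. i < l \<Longrightarrow> hom d (f i) (h i)" using h by (auto simp: generates_def)
  have "e q \<le> r" if q: "q < k" for q
  proof -
    have gq: "g q \<in> B" "hom d (e q) (g q)" using g q by (auto simp: generates_def)
    then obtain c where c: "g q = lc l c h" using h unfolding generates_def by auto
    define C where "C = vcomp f (e q) c"
    have C: "g q = lc l C h"
      unfolding C_def using lc_vcomp[of l d f h "e q" c, OF hhom] vcomp_hom[OF gq(2)] c by simp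
    have "\<forall>i. \<exists>x. i < l \<longrightarrow> h i = lc k x g"
      using h g unfolding generates_def by auto
    then obtain D where D: "\<And>i. i < l \<Longrightarrow> h i = lc k (D i) g" by metis
    \<comment> \<open>The trivial expression of \<open>g q\<close> minus the one obtained by
      substituting \<open>h\<close> back: a syzygy, whose entry at \<open>q\<close> must have
      constant term 0.\<close>
    define z where "z = (\<lambda>j. (if j = q then 1 else 0) - (\<Sum>i<l. C i * D i j))"
    have "lc k z g = 0"
    proof
      fix j
      have "(\<Sum>p<k. (\<Sum>i<l. C i * D i p) * g p j) = (\<Sum>p<k. \<Sum>i<l. C i * (D i p * g p j))"
        by (simp only: sum_distrib_right mult.assoc)
      also have "\<dots> = (\<Sum>i<l. \<Sum>p<k. C i * (D i p * g p j))" by (rule sum.swap)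
      also have "\<dots> = (\<Sum>i<l. C i * h i j)"
        by (intro sum.cong refl) (simp add: D lc_def sum_distrib_left)
      also have "\<dots> = g q j" by (simp add: C lc_def)
      finally show "lc k z g j = 0 j"
        using q by (simp add: lc_def z_def left_diff_distrib sum_subtractf if_distrib[of "\<lambda>x. x * _"] cong: if_cong)
    qed
    then have "trunc k z \<in> syz k g {0}" by (simp add: syz_def)
    then have "Poly_Mapping.lookup (z q) 0 = 0"
      using m q by (force simp: minimal_gens_def trunc_def)
    then have "(\<Sum>i<l. Poly_Mapping.lookup (C i) 0 * Poly_Mapping.lookup (D i q) 0) = 1"
      by (simp add: z_def lookup_minus lookup_sum lookup_mult_0)
    then obtain i where i: "i < l" "Poly_Mapping.lookup (C i) 0 \<noteq> 0"
      by (metis (no_types, lifting) lessThan_iff mult_zero_left sum.neutral zero_neq_one)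
    have "C i \<in> homogeneous (e q - f i)" by (simp add: C_def vcomp_def homogeneous_hcomp)
    then have "e q - f i = 0" using i(2) by (rule lookup_0_neq_0_homogeneous)
    then show ?thesis using h i(1) by (auto simp: generates_def)
  qed
  then show ?thesis using g by (auto simp: generates_def)
qed

section \<open>Resolutions\<close>

definition embv :: "('x, 'k::field) mpoly \<Rightarrow> nat \<Rightarrow> ('x, 'k) mpoly" where
  "embv p = (\<lambda>i. if i = 0 then p else 0)"

abbreviation "deg0 \<equiv> (\<lambda>i::nat. 0::int)"

definition gideal :: "('x::finite, 'k::field) mpoly set \<Rightarrow> bool" where
  "gideal I \<longleftrightarrow> 0 \<in> I \<and> (\<forall>p\<in>I. \<forall>q\<in>I. p + q \<in> I) \<and> (\<forall>c. \<forall>p\<in>I. c * p \<in> I)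
    \<and> (\<forall>e. \<forall>p\<in>I. hcomp e p \<in> I)"

lemma embv_simps: "embv (p + q) = embv p + embv q" "embv (c * p) = smul c (embv p)"
  "embv (hcomp e p) = vcomp deg0 e (embv p)" "embv 0 = 0"
  by (auto simp: embv_def smul_def vcomp_def fun_eq_iff)

lemma embv_inj: "embv p = embv q \<longleftrightarrow> p = q"
  by (auto simp: embv_def fun_eq_iff)

lemma hom_embv: "p \<in> homogeneous e \<Longrightarrow> hom deg0 e (embv p)"
  by (auto simp: hom_def embv_def)

lemma gsub_embv: "gideal I \<Longrightarrow> gsub deg0 (embv ` I)"
  unfolding gideal_def gsub_def
  by (auto simp flip: embv_simps)

text \<open>A minimal resolution without matrices: \<open>g (Suc i)\<close> lists the images of the
  basis vectors in the previous free module. The bounds \<open>r\<close> are existential because a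
  minimal resolution comes with no regularity bound; \<open>minimal_resolution_seq_bound\<close>
  supplies it.\<close>

definition minimal_resolution_seq :: "('x::finite, 'k::field) mpoly set \<Rightarrow> (nat \<Rightarrow> nat) \<Rightarrow>
    (nat \<Rightarrow> nat \<Rightarrow> int) \<Rightarrow> (nat \<Rightarrow> nat \<Rightarrow> nat \<Rightarrow> ('x, 'k) mpoly) \<Rightarrow> bool" where
  "minimal_resolution_seq I k e g \<longleftrightarrow>
    (\<exists>r. generates r deg0 {0} (embv ` I) (k 0) (g 0) (e 0)) \<and>
    (\<forall>i. \<exists>r. generates r (e i) {0} (syz (k i) (g i) {0}) (k (Suc i)) (g (Suc i)) (e (Suc i))) \<and>
    (\<forall>i. minimal_gens (k i) (g i))"

text \<open>By induction on the step: minimal generators inherit the bound on degrees, hence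
  \<open>reg_upto_syz\<close> applies to them and bounds the next syzygy module. Each step uses up
  one unit of \<open>n\<close>, so the hypothesis is needed for all \<open>n\<close>.\<close>

lemma minimal_resolution_seq_bound:
  assumes I: "gideal I" and R: "\<And>n. reg_upto n r deg0 {0} (embv ` I)"
    and s: "minimal_resolution_seq I k e g"
  shows "p < k i \<Longrightarrow> e i p \<le> r + int i"
proof -
  define B where "B i = (case i of 0 \<Rightarrow> embv ` I | Suc j \<Rightarrow> syz (k j) (g j) {0})" for i
  define d where "d i = (case i of 0 \<Rightarrow> deg0 | Suc j \<Rightarrow> e j)" for i
  have gen: "\<exists>r. generates r (d i) {0} (B i) (k i) (g i) (e i)" for i
    using s by (auto simp: minimal_resolution_seq_def B_def d_def split: nat.splits)
  have min: "minimal_gens (k i) (g i)" for i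
    using s by (auto simp: minimal_resolution_seq_def)
  have sub: "gsub (d i) (B i)" for i
  proof (cases i)
    case (Suc j)
    obtain r where "generates r (d j) {0} (B j) (k j) (g j) (e j)" using gen by blast
    then show ?thesis
      unfolding Suc B_def d_def by (auto intro!: gsub_syz[OF gsub_zero] simp: generates_def)
  qed (simp add: B_def d_def gsub_embv I)
  have reg: "\<forall>n. reg_upto n (r + int i) (d i) {0} (B i)" for i
  proof (induction i)
    case 0
    show ?case using R by (simp add: d_def B_def zero_fun_def)
  next
    case (Suc i)
    show ?case
    proof
      fix n
      obtain r' where "generates r' (d i) {0} (B i) (k i) (g i) (e i)" using gen by blast
      then have "generates (r + int i) (d i) {0} (B i) (k i) (g i) (e i)"
        using minimal_gens_degree[OF Suc.IH[rule_format, of "Suc 0"]] min by blast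
      then have "reg_upto n (r + int i + 1) (e i) {0} (syz (k i) (g i) {0})"
        by (rule reg_upto_syz[OF Suc.IH[rule_format, of "Suc n"] _ gsub_zero sub])
          (simp add: gsub_0[OF sub])
      then show "reg_upto n (r + int (Suc i)) (d (Suc i)) {0} (B (Suc i))"
        by (simp add: B_def d_def algebra_simps)
    qed
  qed
  assume p: "p < k i"
  obtain r' where "generates r' (d i) {0} (B i) (k i) (g i) (e i)" using gen by blast
  then have "generates (r + int i) (d i) {0} (B i) (k i) (g i) (e i)"
    using minimal_gens_degree[OF reg[rule_format, of "Suc 0"]] min by blast
  then show "e i p \<le> r + int i" using p by (auto simp: generates_def)
qed

lemma minimal_resolution_seq_exists:
  assumes I: "gideal I" and R: "\<And>n. reg_upto n r deg0 {0} (embv ` I)"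
  shows "\<exists>k e g. minimal_resolution_seq I k e g"
proof -
  \<comment> \<open>Dependent choice over triples. \<open>P i\<close> says that the syzygies left
    after step \<open>i\<close> satisfy the bound \<open>r + i + 1\<close>, which lets the
    construction continue; its last clause ties the first triple to \<open>I\<close>.\<close>
  define P where "P i s = (case s of (k, e, g) \<Rightarrow> minimal_gens k g \<and>
      (\<forall>n. reg_upto n (r + int i + 1) e {0} (syz k g {0})) \<and> gsub e (syz k g {0}) \<and>
      (i = 0 \<longrightarrow> generates r deg0 {0} (embv ` I) k g e))"
    for i :: nat and s :: "nat \<times> (nat \<Rightarrow> int) \<times> (nat \<Rightarrow> nat \<Rightarrow> ('a, 'b) mpoly)"
  define Q where "Q i s s' = (case s of (k, e, g) \<Rightarrow> case s' of (k', e', g') \<Rightarrow>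
      generates (r + int i + 1) e {0} (syz k g {0}) k' g' e')"
    for i :: nat and s s' :: "nat \<times> (nat \<Rightarrow> int) \<times> (nat \<Rightarrow> nat \<Rightarrow> ('a, 'b) mpoly)"
  have step: "\<exists>k g e. generates r d {0} B k g e \<and> minimal_gens k g \<and>
      (\<forall>n. reg_upto n (r + 1) e {0} (syz k g {0})) \<and> gsub e (syz k g {0})"
    if R: "\<And>n. reg_upto n r d {0} B" and B: "gsub d B" for r d and B :: "(nat \<Rightarrow> ('a, 'b) mpoly) set"
  proof -
    obtain k g e where g: "generates r d {0} B k g e" "minimal_gens k g"
      using minimal_gens_exist[OF R B] by blast
    have "gsub e (syz k g {0})" using g(1) by (auto intro!: gsub_syz[OF gsub_zero] simp: generates_def)
    moreover have "reg_upto n (r + 1) e {0} (syz k g {0})" for n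
      by (rule reg_upto_syz[OF R g(1) gsub_zero B]) (simp add: gsub_0[OF B])
    ultimately show ?thesis using g by blast
  qed
  have "\<exists>s. P 0 s"
    using step[OF R gsub_embv[OF I]] by (auto simp: P_def)
  moreover have "\<exists>s'. P (Suc i) s' \<and> Q i s s'" if "P i s" for i s
  proof -
    obtain k e g where s: "s = (k, e, g)" by (cases s)
    have "\<And>n. reg_upto n (r + int i + 1) e {0} (syz k g {0})" "gsub e (syz k g {0})"
      using that by (auto simp: P_def s)
    from step[OF this] show ?thesis by (auto simp: P_def Q_def s algebra_simps)
  qed
  ultimately obtain s where s: "\<And>i. P i (s i)" "\<And>i. Q i (s i) (s (Suc i))"
    using dependent_nat_choice[of P Q] by blast
  have "minimal_resolution_seq I (\<lambda>i. fst (s i)) (\<lambda>i. fst (snd (s i))) (\<lambda>i. snd (snd (s i)))"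
    unfolding minimal_resolution_seq_def
  proof (intro conjI allI)
    show "\<exists>r. generates r deg0 {0} (embv ` I) (fst (s 0)) (snd (snd (s 0))) (fst (snd (s 0)))"
      using s(1)[of 0] by (auto simp: P_def split: prod.splits)
  next
    fix i
    show "\<exists>r. generates r (fst (snd (s i))) {0} (syz (fst (s i)) (snd (snd (s i))) {0})
           (fst (s (Suc i))) (snd (snd (s (Suc i)))) (fst (snd (s (Suc i))))"
      using s(2)[of i] by (auto simp: Q_def split: prod.splits)
    show "minimal_gens (fst (s i)) (snd (snd (s i)))"
      using s(1)[of i] by (auto simp: P_def split: prod.splits)
  qed
  then show ?thesis by blast
qed

section \<open>Translation between vectors and matrices and functions on the natural numbers\<close>

definition vfun :: "('x, 'k::field) mpoly vec \<Rightarrow> nat \<Rightarrow> ('x, 'k) mpoly" where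
  "vfun v = (\<lambda>i. if i < dim_vec v then v $ i else 0)"

lemma vfun_supp: "v \<in> carrier_vec k \<Longrightarrow> vfun v \<in> supp k"
  by (auto simp: vfun_def supp_def)

lemma vfun_vec: "u \<in> supp k \<Longrightarrow> vfun (vec k u) = u"
  by (auto simp: vfun_def supp_def fun_eq_iff)

lemma vfun_eq_iff: "v \<in> carrier_vec k \<Longrightarrow> w \<in> carrier_vec k \<Longrightarrow> vfun v = vfun w \<longleftrightarrow> v = w"
  by (auto simp: vfun_def fun_eq_iff intro!: eq_vecI split: if_splits)

lemma vfun_zero: "vfun (0\<^sub>v k) = 0"
  by (auto simp: vfun_def fun_eq_iff)

lemma vfun_mult_mat_vec:
  assumes "A \<in> carrier_mat k l" "w \<in> carrier_vec l"
  shows "vfun (A *\<^sub>v w) = lc l (vfun w) (\<lambda>q. vfun (col A q))"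
proof
  fix p
  show "vfun (A *\<^sub>v w) p = lc l (vfun w) (\<lambda>q. vfun (col A q)) p"
    using assms
    by (auto simp: vfun_def lc_def scalar_prod_def mult.commute atLeast0LessThan intro!: sum.cong)
qed

lemma embv_augmentation:
  assumes "v \<in> carrier_vec k"
  shows "embv (augmentation (*) g v) = lc k (vfun v) (\<lambda>q. embv (g q))"
  using assms by (auto simp: augmentation_def embv_def lc_def vfun_def fun_eq_iff)

lemma vfun_image_kernel:
  assumes "\<And>v. v \<in> carrier_vec k \<Longrightarrow> P v \<longleftrightarrow> lc k (vfun v) G = 0"
  shows "vfun ` {v \<in> carrier_vec k. P v} = syz k G {0}"
proof (intro equalityI subsetI)
  fix u assume "u \<in> syz k G {0}"
  then have "u \<in> supp k" "lc k u G = 0" by (auto simp: syz_def)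
  then show "u \<in> vfun ` {v \<in> carrier_vec k. P v}"
    using assms[of "vec k u"] by (intro image_eqI[of _ _ "vec k u"]) (auto simp: vfun_vec)
qed (auto simp: syz_def vfun_supp assms)

lemma vfun_image_range:
  assumes "A \<in> carrier_mat k l"
  shows "vfun ` (\<lambda>w. A *\<^sub>v w) ` carrier_vec l = (\<Union>c. {lc l c (\<lambda>q. vfun (col A q))})"
proof (intro equalityI subsetI)
  fix u assume "u \<in> (\<Union>c. {lc l c (\<lambda>q. vfun (col A q))})"
  then obtain c where "u = lc l (trunc l c) (\<lambda>q. vfun (col A q))" by auto
  then have "u = vfun (A *\<^sub>v vec l (trunc l c))"
    using vfun_mult_mat_vec[OF assms, of "vec l (trunc l c)"] by (simp add: vfun_vec)
  then show "u \<in> vfun ` (\<lambda>w. A *\<^sub>v w) ` carrier_vec l" by auto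
qed (auto simp: vfun_mult_mat_vec[OF assms])

lemma list_upper_bound: "\<exists>r. \<forall>p<length xs. xs ! p \<le> (r::int)"
  by (intro exI[of _ "Max (set xs)"]) auto

text \<open>The columns of \<open>A j\<close> are the generators chosen in step
  \<open>j + 1\<close>, whence the offset in the case distinction; step 0 consists of the images in
  \<open>I\<close>.\<close>

lemma minimal_resolution_seq_of_resolution:
  assumes "minimal_graded_free_resolution (*) I (\<lambda>d. I \<inter> homogeneous d) b g A"
  shows "minimal_resolution_seq I (\<lambda>i. length (b i)) (\<lambda>i. (!) (b i))
    (\<lambda>i. case i of 0 \<Rightarrow> \<lambda>q. embv (g q) | Suc j \<Rightarrow> \<lambda>q. vfun (col (A j) q))"
    (is "minimal_resolution_seq I ?k ?e ?G")
proof -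
  have g: "\<And>q. q < ?k 0 \<Longrightarrow> g q \<in> I \<inter> homogeneous (b 0 ! q)"
    and A: "\<And>i. A i \<in> carrier_mat (?k i) (?k (Suc i))"
    and Ah: "\<And>i p q. p < ?k i \<Longrightarrow> q < ?k (Suc i) \<Longrightarrow> A i $$ (p, q) \<in> homogeneous (b (Suc i) ! q - b i ! p)"
    and aug: "augmentation (*) g ` carrier_vec (?k 0) = I"
    and ker0: "{v \<in> carrier_vec (?k 0). augmentation (*) g v = 0} = (\<lambda>w. A 0 *\<^sub>v w) ` carrier_vec (?k 1)"
    and ker: "\<And>i. {v \<in> carrier_vec (?k (Suc i)). A i *\<^sub>v v = 0\<^sub>v (?k i)} =
        (\<lambda>w. A (Suc i) *\<^sub>v w) ` carrier_vec (?k (Suc (Suc i)))"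
    and Am: "\<And>i p q. p < ?k i \<Longrightarrow> q < ?k (Suc i) \<Longrightarrow> Poly_Mapping.lookup (A i $$ (p, q)) 0 = 0"
    using assms unfolding minimal_graded_free_resolution_def graded_free_resolution_def
    by (auto simp: irrelevant_ideal_iff)
  \<comment> \<open>Exactness, rewritten: the kernel of a differential and the image of the next one
    have the same image under \<open>vfun\<close>.\<close>
  have syz: "syz (?k i) (?G i) {0} = (\<Union>c. {lc (?k (Suc i)) c (?G (Suc i))})" for i
  proof (cases i)
    case 0
    have "vfun ` {v \<in> carrier_vec (?k 0). augmentation (*) g v = 0} = syz (?k 0) (?G 0) {0}"
      by (rule vfun_image_kernel) (simp flip: embv_augmentation embv_simps(4) add: embv_inj)
    then show ?thesis unfolding ker0 using vfun_image_range[OF A[of 0]] 0 by simp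
  next
    case (Suc j)
    have "vfun ` {v \<in> carrier_vec (?k (Suc j)). A j *\<^sub>v v = 0\<^sub>v (?k j)} = syz (?k (Suc j)) (?G (Suc j)) {0}"
    proof (rule vfun_image_kernel)
      fix v :: "('a, 'b) mpoly vec" assume v: "v \<in> carrier_vec (?k (Suc j))"
      have "A j *\<^sub>v v = 0\<^sub>v (?k j) \<longleftrightarrow> vfun (A j *\<^sub>v v) = vfun (0\<^sub>v (?k j))"
        using mult_mat_vec_carrier[OF A[of j] v] by (intro vfun_eq_iff[symmetric, of _ "?k j"]) auto
      then show "A j *\<^sub>v v = 0\<^sub>v (?k j) \<longleftrightarrow> lc (?k (Suc j)) (vfun v) (?G (Suc j)) = 0"
        using vfun_mult_mat_vec[OF A v] by (simp add: vfun_zero)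
    qed
    then show ?thesis unfolding ker using vfun_image_range[OF A[of "Suc j"]] Suc by simp
  qed
  have col: "vfun (col (A i) q) p = (if p < ?k i then A i $$ (p, q) else 0)" if "q < ?k (Suc i)" for i p q
    using A[of i] that by (auto simp: vfun_def)
  have unit: "lc l (\<lambda>j. if j = q then 1 else 0) h = h q" if "q < l"
    for l q and h :: "nat \<Rightarrow> nat \<Rightarrow> ('a, 'b) mpoly"
    using that by (auto simp: lc_def fun_eq_iff if_distrib[of "\<lambda>x. x * _"] cong: if_cong)
  have mem: "?G (Suc i) q \<in> syz (?k i) (?G i) {0}" if "q < ?k (Suc i)" for i q
    unfolding syz using unit[OF that, of "?G (Suc i)", symmetric] by (intro UN_I[OF UNIV_I]) blast
  show ?thesis
    unfolding minimal_resolution_seq_def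
  proof (intro conjI allI)
    obtain r where r: "\<forall>p<?k 0. b 0 ! p \<le> r" using list_upper_bound by blast
    have "generates r deg0 {0} (embv ` I) (?k 0) (?G 0) ((!) (b 0))"
      unfolding generates_def
    proof (intro conjI allI impI ballI)
      fix u assume "u \<in> embv ` I"
      then obtain v where "v \<in> carrier_vec (?k 0)" "u = embv (augmentation (*) g v)"
        using aug by blast
      then show "\<exists>c. u - lc (?k 0) c (?G 0) \<in> {0}" by (auto simp: embv_augmentation)
    qed (use g r in \<open>auto simp: hom_embv\<close>)
    then show "\<exists>r. generates r deg0 {0} (embv ` I) (?k 0) (?G 0) ((!) (b 0))" by (intro exI[of _ r])
  next
    fix i
    obtain r where r: "\<forall>p<?k (Suc i). b (Suc i) ! p \<le> r" using list_upper_bound by blast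
    have "generates r ((!) (b i)) {0} (syz (?k i) (?G i) {0}) (?k (Suc i)) (?G (Suc i)) ((!) (b (Suc i)))"
      unfolding generates_def
    proof (intro conjI allI impI ballI)
      fix u assume "u \<in> syz (?k i) (?G i) {0}"
      then show "\<exists>c. u - lc (?k (Suc i)) c (?G (Suc i)) \<in> {0}" unfolding syz by auto
    next
      fix q assume q: "q < ?k (Suc i)"
      show "?G (Suc i) q \<in> syz (?k i) (?G i) {0}" by (rule mem[OF q])
      show "hom ((!) (b i)) (b (Suc i) ! q) (?G (Suc i) q)"
        using Ah q by (auto simp: hom_def col)
    qed (use r in auto)
    then show "\<exists>r. generates r ((!) (b i)) {0} (syz (?k i) (?G i) {0}) (?k (Suc i)) (?G (Suc i)) ((!) (b (Suc i)))" by (intro exI[of _ r])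
  next
    fix i
    show "minimal_gens (?k i) (?G i)"
      unfolding minimal_gens_def
    proof (intro ballI allI impI)
      fix c p assume "c \<in> syz (?k i) (?G i) {0}" and p: "p < ?k i"
      then obtain x where x: "c = lc (?k (Suc i)) x (\<lambda>q. vfun (col (A i) q))" unfolding syz by auto
      show "Poly_Mapping.lookup (c p) 0 = 0"
        using p Am by (auto simp: x lc_def lookup_sum lookup_mult_0 col intro!: sum.neutral)
    qed
  qed
qed

lemma resolution_of_minimal_resolution_seq:
  assumes I: "gideal I" and s: "minimal_resolution_seq I k e g"
  shows "\<exists>b g A. minimal_graded_free_resolution (*) I (\<lambda>d. I \<inter> homogeneous d) b g A"
proof -
  define b where "b i = map (e i) [0..<k i]" for i
  define A where "A i = mat (k i) (k (Suc i)) (\<lambda>(p, q). g (Suc i) q p)" for i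
  define h where "h q = g 0 q 0" for q
  have len: "length (b i) = k i" for i by (simp add: b_def)
  have A: "A i \<in> carrier_mat (k i) (k (Suc i))" for i by (simp add: A_def)
  obtain r where g0: "generates r deg0 {0} (embv ` I) (k 0) (g 0) (e 0)"
    using s by (auto simp: minimal_resolution_seq_def)
  have "\<forall>i. \<exists>r. generates r (e i) {0} (syz (k i) (g i) {0}) (k (Suc i)) (g (Suc i)) (e (Suc i))"
    using s by (auto simp: minimal_resolution_seq_def)
  then obtain r where gS: "\<And>i. generates (r i) (e i) {0} (syz (k i) (g i) {0}) (k (Suc i)) (g (Suc i)) (e (Suc i))"
    by metis
  have min: "minimal_gens (k i) (g i)" for i using s by (auto simp: minimal_resolution_seq_def)
  have g0h: "g 0 q = embv (h q)" "h q \<in> I" if "q < k 0" for q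
  proof -
    obtain p where p: "p \<in> I" "g 0 q = embv p" using g0 \<open>q < k 0\<close> by (auto simp: generates_def)
    then have "h q = p" by (simp add: h_def embv_def)
    then show "g 0 q = embv (h q)" "h q \<in> I" using p by auto
  qed
  have gsyz: "g (Suc i) q \<in> syz (k i) (g i) {0}" if "q < k (Suc i)" for i q
    using gS that by (auto simp: generates_def)
  have col: "vfun (col (A i) q) = g (Suc i) q" if "q < k (Suc i)" for i q
    using gsyz[OF that] that by (auto simp: vfun_def A_def fun_eq_iff syz_def supp_def)
  have lccol: "lc (k (Suc i)) c (\<lambda>q. vfun (col (A i) q)) = lc (k (Suc i)) c (g (Suc i))" for i c
    by (simp add: lc_def col)
  have sub: "gsub (e i) (syz (k i) (g i) {0})" for i
  proof (cases i)
    case 0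
    show ?thesis using g0 by (auto simp: generates_def 0 intro!: gsub_syz[OF gsub_zero])
  next
    case (Suc j)
    show ?thesis using gS[of j] by (auto simp: generates_def Suc intro!: gsub_syz[OF gsub_zero])
  qed
  have range: "vfun ` (\<lambda>w. A i *\<^sub>v w) ` carrier_vec (k (Suc i)) = syz (k i) (g i) {0}" for i
  proof -
    have "lc (k (Suc i)) c (g (Suc i)) \<in> syz (k i) (g i) {0}" for c
      by (rule gsub_lc[OF sub gsyz])
    moreover have "\<exists>c. u = lc (k (Suc i)) c (g (Suc i))" if "u \<in> syz (k i) (g i) {0}" for u
      using gS[of i] that unfolding generates_def by auto
    ultimately show ?thesis unfolding vfun_image_range[OF A] lccol by blast
  qed
  have lc0: "lc (k 0) c (g 0) = lc (k 0) c (\<lambda>q. embv (h q))" for c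
    by (simp add: lc_def g0h)
  \<comment> \<open>Exactness can be checked after applying \<open>vfun\<close>, since it is
    injective on vectors of a fixed dimension.\<close>
  have inj: "X = Y" if "vfun ` X = vfun ` Y" "X \<subseteq> carrier_vec n" "Y \<subseteq> carrier_vec n"
    for X Y :: "('a, 'b) mpoly vec set" and n
  proof -
    have "inj_on vfun (carrier_vec n :: ('a, 'b) mpoly vec set)"
      by (auto simp: inj_on_def vfun_eq_iff)
    then show ?thesis using that by (metis inj_on_image_eq_iff)
  qed
  have aug: "augmentation (*) h ` carrier_vec (k 0) = I"
  proof (intro equalityI subsetI)
    fix p assume "p \<in> augmentation (*) h ` carrier_vec (k 0)"
    then obtain v where "v \<in> carrier_vec (k 0)" "p = augmentation (*) h v" by auto
    then have "embv p = lc (k 0) (vfun v) (g 0)" by (simp add: embv_augmentation lc0)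
    moreover have "lc (k 0) (vfun v) (g 0) \<in> embv ` I"
      using g0 by (intro gsub_lc[OF gsub_embv[OF I]]) (auto simp: generates_def)
    ultimately have "embv p \<in> embv ` I" by simp
    then show "p \<in> I" by (auto simp: embv_inj)
  next
    fix p assume "p \<in> I"
    then have "\<exists>c. embv p = lc (k 0) (trunc (k 0) c) (g 0)"
      using g0 unfolding generates_def by auto
    then obtain c where "embv p = lc (k 0) (trunc (k 0) c) (g 0)" ..
    then have "embv p = embv (augmentation (*) h (vec (k 0) (trunc (k 0) c)))"
      by (subst embv_augmentation[of _ "k 0"]) (auto simp: vfun_vec lc0)
    then have "p = augmentation (*) h (vec (k 0) (trunc (k 0) c))" by (simp only: embv_inj)
    then show "p \<in> augmentation (*) h ` carrier_vec (k 0)" by auto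
  qed
  have "vfun ` {v \<in> carrier_vec (k 0). augmentation (*) h v = 0} = syz (k 0) (g 0) {0}"
    by (rule vfun_image_kernel) (simp add: lc0 embv_inj flip: embv_augmentation embv_simps(4))
  then have ker0: "{v \<in> carrier_vec (k 0). augmentation (*) h v = 0} = (\<lambda>w. A 0 *\<^sub>v w) ` carrier_vec (k 1)"
    using range[of 0] A[of 0] by (intro inj[of _ _ "k 0"]) auto
  have ker: "{v \<in> carrier_vec (k (Suc i)). A i *\<^sub>v v = 0\<^sub>v (k i)} =
        (\<lambda>w. A (Suc i) *\<^sub>v w) ` carrier_vec (k (Suc (Suc i)))" for i
  proof -
    have "vfun ` {v \<in> carrier_vec (k (Suc i)). A i *\<^sub>v v = 0\<^sub>v (k i)} = syz (k (Suc i)) (g (Suc i)) {0}"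
    proof (rule vfun_image_kernel)
      fix v :: "('a, 'b) mpoly vec" assume v: "v \<in> carrier_vec (k (Suc i))"
      have "A i *\<^sub>v v = 0\<^sub>v (k i) \<longleftrightarrow> vfun (A i *\<^sub>v v) = vfun (0\<^sub>v (k i))"
        using mult_mat_vec_carrier[OF A[of i] v] by (intro vfun_eq_iff[symmetric, of _ "k i"]) auto
      then show "A i *\<^sub>v v = 0\<^sub>v (k i) \<longleftrightarrow> lc (k (Suc i)) (vfun v) (g (Suc i)) = 0"
        using vfun_mult_mat_vec[OF A v] by (simp add: vfun_zero lccol)
    qed
    then show ?thesis
      using range[of "Suc i"] A[of "Suc i"] by (intro inj[of _ _ "k (Suc i)"]) auto
  qed
  have "h q \<in> homogeneous (e 0 q)" if "q < k 0" for q
    using g0 that by (auto simp: generates_def hom_def h_def dest!: spec[of _ 0])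
  moreover have "g (Suc i) q p \<in> homogeneous (e (Suc i) q - e i p)" if "q < k (Suc i)" for i p q
    using gS[of i] that by (auto simp: generates_def hom_def)
  moreover have "Poly_Mapping.lookup (g (Suc i) q p) 0 = 0" if "q < k (Suc i)" "p < k i" for i p q
    using min[of i] gsyz[OF that(1)] that(2) by (auto simp: minimal_gens_def)
  ultimately have "minimal_graded_free_resolution (*) I (\<lambda>d. I \<inter> homogeneous d) b h A"
    unfolding minimal_graded_free_resolution_def graded_free_resolution_def len irrelevant_ideal_iff
    using aug ker0 ker g0h(2) by (auto simp: b_def A_def)
  then show ?thesis by blast
qed

section \<open>Bounds on the regularity of subquotients of the polynomial ring\<close>

definition ideal_reg_le :: "int \<Rightarrow> ('x::finite, 'k::field) mpoly set \<Rightarrow> ('x, 'k) mpoly set \<Rightarrow> bool" where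
  "ideal_reg_le r I J \<longleftrightarrow> (\<forall>n. reg_upto n r deg0 (embv ` I) (embv ` J))"

lemma gidealD:
  assumes "gideal I"
  shows gideal_0: "0 \<in> I" and gideal_add: "p \<in> I \<Longrightarrow> q \<in> I \<Longrightarrow> p + q \<in> I"
    and gideal_mult: "p \<in> I \<Longrightarrow> c * p \<in> I" and gideal_hcomp: "p \<in> I \<Longrightarrow> hcomp e p \<in> I"
  using assms by (auto simp: gideal_def)

lemma gideal_diff: "gideal I \<Longrightarrow> p \<in> I \<Longrightarrow> q \<in> I \<Longrightarrow> p - q \<in> I"
  using gideal_add[of I p "- 1 * q"] gideal_mult[of I q "- 1"] by simp

lemma gideal_zero [simp]: "gideal {0}"
  by (simp add: gideal_def)

lemma gideal_UNIV [simp]: "gideal UNIV"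
  by (simp add: gideal_def)

lemma gideal_Int: "gideal I \<Longrightarrow> gideal J \<Longrightarrow> gideal (I \<inter> J)"
  by (simp add: gideal_def)

lemma span_step:
  "f \<in> F \<Longrightarrow> y \<in> poly_module.span F \<Longrightarrow> c * f + y \<in> poly_module.span F"
  by (simp add: poly_module.span_add poly_module.span_scale poly_module.span_base)

lemma gideal_span:
  fixes F :: "('x::finite, 'k::field) mpoly set"
  assumes "\<And>f. f \<in> F \<Longrightarrow> \<exists>d. f \<in> homogeneous d"
  shows "gideal (poly_module.span F)"
proof -
  have "hcomp e p \<in> poly_module.span F" if "p \<in> poly_module.span F" for e p
    using that
  proof (induction p rule: poly_module.span_induct_alt)
    case base
    show ?case by (simp add: poly_module.span_zero)
  next
    case (step c f y)
    obtain d where "f \<in> homogeneous d" using assms step.hyps by blast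
    then show ?case
      using step by (simp add: hcomp_add hcomp_mult span_step)
  qed
  then show ?thesis
    by (simp add: gideal_def poly_module.span_zero poly_module.span_add poly_module.span_scale)
qed

lemma ideal_reg_le_extension:
  assumes "ideal_reg_le r I J" "ideal_reg_le r J K" "gideal I" "gideal J" "gideal K" "I \<subseteq> J" "J \<subseteq> K"
  shows "ideal_reg_le r I K"
  unfolding ideal_reg_le_def
proof
  fix n
  show "reg_upto n r deg0 (embv ` I) (embv ` K)"
    by (rule reg_upto_extension[where B = "embv ` J"])
      (use assms in \<open>auto simp: ideal_reg_le_def intro: gsub_embv\<close>)
qed

lemma ideal_reg_le_quotient:
  assumes "ideal_reg_le r I K" "ideal_reg_le (r + 1) I J" "gideal I" "gideal J" "I \<subseteq> J" "J \<subseteq> K"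
  shows "ideal_reg_le r J K"
  unfolding ideal_reg_le_def
proof
  fix n
  show "reg_upto n r deg0 (embv ` J) (embv ` K)"
  proof (cases n)
    case (Suc m)
    show ?thesis unfolding Suc
      by (rule reg_upto_quotient[where A = "embv ` I"])
        (use assms in \<open>auto simp: ideal_reg_le_def intro: gsub_embv\<close>)
  qed simp
qed

lemma ideal_reg_le_kernel:
  assumes "ideal_reg_le (r + 1) I K" "ideal_reg_le r J K" "gideal I" "gideal J" "gideal K" "I \<subseteq> J" "J \<subseteq> K"
  shows "ideal_reg_le (r + 1) I J"
  unfolding ideal_reg_le_def
proof
  fix n
  show "reg_upto n (r + 1) deg0 (embv ` I) (embv ` J)"
    by (rule reg_upto_kernel[where C = "embv ` K" and N = 1])
      (use assms in \<open>auto simp: ideal_reg_le_def intro: gsub_embv, auto simp: embv_def supp_def\<close>)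
qed

lemma ideal_reg_le_mono: "ideal_reg_le r I J \<Longrightarrow> r \<le> s \<Longrightarrow> ideal_reg_le s I J"
  unfolding ideal_reg_le_def using reg_upto_mono by blast

lemma ideal_reg_le_refl: "gideal I \<Longrightarrow> ideal_reg_le r I I"
  by (auto simp: ideal_reg_le_def intro!: reg_upto_refl gsub_embv)

lemma ideal_reg_le_UNIV: "ideal_reg_le 0 {0} (UNIV :: ('x::finite, 'k::field) mpoly set)"
proof -
  have "embv ` (UNIV :: ('x, 'k) mpoly set) = supp 1"
  proof (intro equalityI subsetI)
    fix u :: "nat \<Rightarrow> ('x, 'k) mpoly" assume "u \<in> supp 1"
    then have "u = embv (u 0)" by (auto simp: embv_def supp_def fun_eq_iff)
    then show "u \<in> range embv" by blast
  qed (auto simp: embv_def supp_def)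
  then show ?thesis
    using reg_upto_supp[of 1 deg0 0, where ?'x = 'x and ?'k = 'k]
    unfolding ideal_reg_le_def by (simp add: embv_simps(4))
qed

text \<open>The relation is an isomorphism that raises degrees by \<open>s\<close>, such as
  multiplication by a form of degree \<open>s\<close>; the regularity rises with it.\<close>

lemma ideal_reg_le_rel:
  assumes R: "ideal_reg_le r I J"
    and lin: "\<rho> 0 0" "\<And>p p' q q'. \<rho> p p' \<Longrightarrow> \<rho> q q' \<Longrightarrow> \<rho> (p + q) (p' + q')"
      "\<And>c p p'. \<rho> p p' \<Longrightarrow> \<rho> (c * p) (c * p')" 
      "\<And>e p p'. \<rho> p p' \<Longrightarrow> \<rho> (hcomp e p) (hcomp (e + s) p')"
    and J: "\<And>p. p \<in> J \<longleftrightarrow> (\<exists>p'. \<rho> p p')" and J': "\<And>p'. p' \<in> J' \<longleftrightarrow> (\<exists>p. \<rho> p p')"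
    and I: "\<And>p p'. \<rho> p p' \<Longrightarrow> p \<in> I \<longleftrightarrow> p' \<in> I'"
  shows "ideal_reg_le (r + s) I' J'"
  unfolding ideal_reg_le_def
proof
  fix n
  define \<sigma> where "\<sigma> u u' \<longleftrightarrow> (\<exists>p p'. \<rho> p p' \<and> u = embv p \<and> u' = embv p')" for u u'
  have \<sigma>I: "\<sigma> (embv p) (embv p')" if "\<rho> p p'" for p p' using that by (auto simp: \<sigma>_def)
  have "reg_upto n (r + s) (\<lambda>i. deg0 i + s) (embv ` I) (embv ` J)"
    using R by (intro reg_upto_shift) (auto simp: ideal_reg_le_def)
  moreover have "glin (\<lambda>i. deg0 i + s) deg0 \<sigma>"
    unfolding glin_def
  proof (intro conjI allI impI)
    show "\<sigma> 0 0" using \<sigma>I[OF lin(1)] by (simp add: embv_simps)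
  next
    fix u u' v v' assume "\<sigma> u u'" "\<sigma> v v'"
    then show "\<sigma> (u + v) (u' + v')"
      by (auto simp: \<sigma>_def[of u] \<sigma>_def[of v] simp flip: embv_simps intro!: \<sigma>I lin)
  next
    fix c u u' assume "\<sigma> u u'"
    then show "\<sigma> (smul c u) (smul c u')"
      by (auto simp: \<sigma>_def[of u] simp flip: embv_simps intro!: \<sigma>I lin)
  next
    fix e u u' assume "\<sigma> u u'"
    then obtain p p' where p: "\<rho> p p'" "u = embv p" "u' = embv p'" by (auto simp: \<sigma>_def)
    \<comment> \<open>Shifting the basis vector of the source to degree \<open>s\<close> turns the
      relation into one of degree 0.\<close>
    have "vcomp (\<lambda>i. deg0 i + s) e u = embv (hcomp (e - s) p)"
      by (auto simp: vcomp_def embv_def p fun_eq_iff)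
    moreover have "vcomp deg0 e u' = embv (hcomp (e - s + s) p')" by (simp add: embv_simps p)
    ultimately show "\<sigma> (vcomp (\<lambda>i. deg0 i + s) e u) (vcomp deg0 e u')"
      using \<sigma>I[OF lin(4)[OF p(1), of "e - s"]] by simp
  qed
  ultimately show "reg_upto n (r + s) deg0 (embv ` I') (embv ` J')"
  proof (rule reg_upto_rel)
    show "u \<in> embv ` J \<longleftrightarrow> (\<exists>u'. \<sigma> u u')" for u unfolding \<sigma>_def using J by blast
    show "u' \<in> embv ` J' \<longleftrightarrow> (\<exists>u. \<sigma> u u')" for u' unfolding \<sigma>_def using J' by blast
    show "u \<in> embv ` I \<longleftrightarrow> u' \<in> embv ` I'" if "\<sigma> u u'" for u u'
      using that I by (auto simp: \<sigma>_def embv_inj image_iff)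
  qed
qed

section \<open>Killing variables\<close>

lemma gideal_var_ideal: "gideal (var_ideal T)"
  unfolding gideal_def
  by (auto simp: var_ideal_add var_ideal_mult) (auto simp: var_ideal_def hcomp_def keys_restr)

lemma add_diff_diff: "(a - b - c) + (a' - b' - c') = (a + a') - (b + b') - (c + (c' :: 'a::ab_group_add))"
  by (simp add: algebra_simps)

text \<open>Each monomial is divisible by a variable of \<open>T\<close>, or else by
  \<open>x\<close>, or else avoids all of them; the three groups are the three summands.\<close>

lemma split_off_variable:
  fixes c :: "('x, 'k::field) mpoly"
  shows "\<exists>d. c - indeterminate x * d - restr (avoids (insert x T)) c \<in> var_ideal T"
proof (induction c rule: poly_mapping_additive_induct)
  case (single m a)
  consider "\<exists>v\<in>T. Poly_Mapping.lookup m v \<noteq> 0" | "Poly_Mapping.lookup m x \<noteq> 0" "avoids T m"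
    | "avoids (insert x T) m"
    unfolding avoids_def by blast
  then show ?case
  proof cases
    case 1
    then show ?thesis
      by (intro exI[of _ 0]) (auto simp: restr_single avoids_def intro: single_in_var_ideal)
  next
    case 2
    then have "restr (avoids (insert x T)) (Poly_Mapping.single m a) = 0"
      by (simp add: restr_single avoids_def)
    moreover have "Poly_Mapping.single m a
        - indeterminate x * Poly_Mapping.single (m - Poly_Mapping.single x 1) a = 0"
      using single_divide_indeterminate[OF 2(1), of a] by (simp only: mult.commute diff_self)
    ultimately show ?thesis
      by (intro exI[of _ "Poly_Mapping.single (m - Poly_Mapping.single x 1) a"]) (simp add: var_ideal_def)
  next
    case 3
    then show ?thesis by (intro exI[of _ 0]) (auto simp: restr_single var_ideal_def)
  qed
next
  case (add p q)
  then obtain d d' where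
    "p - indeterminate x * d - restr (avoids (insert x T)) p \<in> var_ideal T"
    "q - indeterminate x * d' - restr (avoids (insert x T)) q \<in> var_ideal T" by blast
  from var_ideal_add[OF this] show ?case
    by (intro exI[of _ "d + d'"]) (simp only: restr_add distrib_left add_diff_diff)
qed

text \<open>A variable outside \<open>T\<close> is a nonzerodivisor modulo
  \<open>var_ideal T\<close>, since multiplying by it commutes with discarding the monomials that
  involve \<open>T\<close>.\<close>

lemma mult_indeterminate_in_var_ideal:
  fixes p :: "('x, 'k::field) mpoly"
  assumes "x \<notin> T" "indeterminate x * p \<in> var_ideal T"
  shows "p \<in> var_ideal T"
proof -
  have "indeterminate x * restr (avoids T) p = restr (avoids T) (indeterminate x * p)"
  proof -
    have "avoids T m" if "m \<in> Poly_Mapping.keys (indeterminate x :: ('x, 'k) mpoly)" for m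
      using that assms(1) by (auto simp: indeterminate_def avoids_def lookup_single when_def)
    then have "restr (avoids T) (p * indeterminate x) = restr (avoids T) p * indeterminate x"
      by (rule restr_avoids_mult)
    then show ?thesis by (simp only: mult.commute)
  qed
  also have "\<dots> = 0" using assms(2) by (simp add: var_ideal_iff)
  finally have "Poly_Mapping.lookup (restr (avoids T) p) n = 0" for n
    using lookup_single_mult[of "Poly_Mapping.single x 1" 1 "restr (avoids T) p" n]
    by (simp add: indeterminate_def)
  then show ?thesis by (simp add: var_ideal_iff poly_mapping_eq_iff fun_eq_iff)
qed

text \<open>The generators of \<open>J\<close> are free of \<open>T\<close>, so the variables of
  \<open>T\<close> form a regular sequence on \<open>J\<close>. Adding \<open>x\<close> to
  \<open>S\<close>, multiplication by \<open>x\<close> identifies \<open>J\<close> modulo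
  \<open>J \<inter> (S)\<close>, shifted by one, with \<open>J \<inter> (S, x)\<close> modulo
  \<open>J \<inter> (S)\<close>. The submodule thus has bound \<open>r + 1\<close>, which preserves
  the bound \<open>r\<close> on the quotient.\<close>

lemma ideal_reg_le_mod_variables:
  fixes F :: "('x::finite, 'k::field) mpoly set"
  assumes F: "\<And>f. f \<in> F \<Longrightarrow> \<exists>d. f \<in> homogeneous d"
    "\<And>f m. f \<in> F \<Longrightarrow> m \<in> Poly_Mapping.keys f \<Longrightarrow> avoids T m"
    and R: "ideal_reg_le r {0} (poly_module.span F)"
  shows "ideal_reg_le r (poly_module.span F \<inter> var_ideal T) (poly_module.span F)"
proof -
  define J where "J = poly_module.span F"
  have J: "gideal J" unfolding J_def by (rule gideal_span) (rule F)
  have "ideal_reg_le r (J \<inter> var_ideal S) J" if "S \<subseteq> T" for S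
    using finite[of S] that
  proof (induction S rule: finite_induct)
    case empty
    then show ?case using R by (simp add: var_ideal_empty gideal_0[OF J] flip: J_def)
  next
    case (insert x S)
    have av: "avoids (insert x S) m" if "f \<in> F" "m \<in> Poly_Mapping.keys f" for f m
      using F(2)[OF that] insert.prems by (auto simp: avoids_def)
    have sub: "var_ideal S \<subseteq> (var_ideal (insert x S) :: ('x, 'k) mpoly set)"
      by (force simp: var_ideal_def)
    \<comment> \<open>The factor \<open>p\<close> has to stay in \<open>J\<close>. This is achieved
      by splitting the coefficients of the generators, which themselves involve neither
      \<open>x\<close> nor \<open>S\<close>. For \<open>q\<close> in \<open>(S, x)\<close> the
      restricted term vanishes.\<close>
    have split: "\<exists>p\<in>J. q - indeterminate x * p - restr (avoids (insert x S)) q \<in> var_ideal S"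
      if "q \<in> J" for q
      using that unfolding J_def
    proof (induction q rule: poly_module.span_induct_alt)
      case base
      show ?case by (intro bexI[of _ 0]) (auto simp: var_ideal_def poly_module.span_zero)
    next
      case (step c f y)
      obtain p where p: "p \<in> poly_module.span F"
        "y - indeterminate x * p - restr (avoids (insert x S)) y \<in> var_ideal S"
        using step by blast
      obtain d where "c - indeterminate x * d - restr (avoids (insert x S)) c \<in> var_ideal S"
        using split_off_variable[of c x S] by blast
      from var_ideal_mult[OF this, of f]
      have "(c - indeterminate x * d - restr (avoids (insert x S)) c) * f \<in> var_ideal S"
        by (simp only: mult.commute)
      moreover have "restr (avoids (insert x S)) (c * f) = restr (avoids (insert x S)) c * f"
        by (rule restr_avoids_mult) (rule av[OF step(1)])
      ultimately have "c * f - indeterminate x * (d * f) - restr (avoids (insert x S)) (c * f) \<in> var_ideal S"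
        by (simp only: left_diff_distrib mult.assoc)
      from var_ideal_add[OF this p(2)]
      have "c * f + y - indeterminate x * (d * f + p) - restr (avoids (insert x S)) (c * f + y) \<in> var_ideal S"
        by (simp only: restr_add distrib_left add_diff_diff)
      then show ?case
        using p(1) step(1) by (intro bexI[of _ "d * f + p"]) (simp_all add: span_step)
    qed
    define \<rho> where "\<rho> p q \<longleftrightarrow> p \<in> J \<and> q \<in> J \<and> q - indeterminate x * p \<in> var_ideal S" for p q
    have IH: "ideal_reg_le r (J \<inter> var_ideal S) J" using insert by simp
    have "ideal_reg_le (r + 1) (J \<inter> var_ideal S) (J \<inter> var_ideal (insert x S))"
    proof (rule ideal_reg_le_rel[OF IH, of \<rho>])
      show "\<rho> 0 0" by (simp add: \<rho>_def gideal_0[OF J] var_ideal_def)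
      show "\<rho> (p + q) (p' + q')" if "\<rho> p p'" "\<rho> q q'" for p p' q q'
        using that var_ideal_add[of "p' - indeterminate x * p" S "q' - indeterminate x * q"]
        by (auto simp: \<rho>_def gideal_add[OF J] algebra_simps)
      show "\<rho> (c * p) (c * p')" if "\<rho> p p'" for c p p'
      proof -
        have "c * p' - indeterminate x * (c * p) = c * (p' - indeterminate x * p)"
          by (simp only: right_diff_distrib mult.left_commute)
        then show ?thesis using that by (simp add: \<rho>_def gideal_mult[OF J] var_ideal_mult)
      qed
      show "\<rho> (hcomp e p) (hcomp (e + 1) p')" if "\<rho> p p'" for e p p'
        using that gideal_hcomp[OF gideal_var_ideal, of "p' - indeterminate x * p" S "e + 1"]
          hcomp_mult[OF homogeneous_indeterminate[of x], of "e + 1" p]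
        by (auto simp: \<rho>_def gideal_hcomp[OF J] hcomp_diff mult.commute)
      have "\<rho> p (indeterminate x * p)" if "p \<in> J" for p
        using that by (simp add: \<rho>_def gideal_mult[OF J] var_ideal_def)
      then show "p \<in> J \<longleftrightarrow> (\<exists>q. \<rho> p q)" for p unfolding \<rho>_def by blast
      show "q \<in> J \<inter> var_ideal (insert x S) \<longleftrightarrow> (\<exists>p. \<rho> p q)" for q
      proof
        assume q: "q \<in> J \<inter> var_ideal (insert x S)"
        then show "\<exists>p. \<rho> p q" using split[of q] by (auto simp: \<rho>_def var_ideal_iff)
      next
        assume "\<exists>p. \<rho> p q"
        then obtain p where p: "q \<in> J" "q - indeterminate x * p \<in> var_ideal S" by (auto simp: \<rho>_def)
        have "p * indeterminate x \<in> var_ideal (insert x S)"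
          by (intro var_ideal_mult) (auto simp: indeterminate_def intro: single_in_var_ideal)
        then have "(q - indeterminate x * p) + indeterminate x * p \<in> var_ideal (insert x S)"
          using p sub by (intro var_ideal_add) (auto simp: mult.commute)
        then show "q \<in> J \<inter> var_ideal (insert x S)" using p by simp
      qed
      show "p \<in> J \<inter> var_ideal S \<longleftrightarrow> q \<in> J \<inter> var_ideal S" if "\<rho> p q" for p q
      proof -
        have *: "p \<in> J" "q \<in> J" "q - indeterminate x * p \<in> var_ideal S" using that by (auto simp: \<rho>_def)
        have "q \<in> var_ideal S" if "p \<in> var_ideal S"
          using var_ideal_add[OF *(3) var_ideal_mult[OF that, of "indeterminate x"]] by simp
        moreover have "p \<in> var_ideal S" if "q \<in> var_ideal S"
          using var_ideal_diff[OF that *(3)] insert.hyps by (intro mult_indeterminate_in_var_ideal[of x S p]) auto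
        ultimately show ?thesis using * by blast
      qed
    qed
    then show ?case
      by (rule ideal_reg_le_quotient[OF IH]) (use sub J in \<open>auto intro!: gideal_Int gideal_var_ideal\<close>)
  qed
  then show ?thesis by (auto simp: J_def)
qed

text \<open>Killing variables in the ring, of regularity 0, leaves a quotient of regularity at most
  0; the kernel has at most one more.\<close>

lemma ideal_reg_le_var_ideal: "ideal_reg_le 1 {0} (var_ideal T :: ('x::finite, 'k::field) mpoly set)"
proof -
  have u: "poly_module.span {1} = (UNIV :: ('x, 'k) mpoly set)"
    by (auto simp: poly_module.span_singleton)
  have "ideal_reg_le 0 (poly_module.span {1} \<inter> var_ideal T) (poly_module.span {1} :: ('x, 'k) mpoly set)"
    by (rule ideal_reg_le_mod_variables)
      (auto simp: u ideal_reg_le_UNIV avoids_def intro: homogeneous_1)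
  then have "ideal_reg_le (0 + 1) {0} (var_ideal T :: ('x, 'k) mpoly set)"
    using ideal_reg_le_mono[OF ideal_reg_le_UNIV, of "0 + 1"]
    by (intro ideal_reg_le_kernel[of 0 "{0}" UNIV "var_ideal T"])
      (auto simp: u gideal_var_ideal gideal_0[OF gideal_var_ideal])
  then show ?thesis by simp
qed

section \<open>Binomial edge ideals of complete graphs\<close>

text \<open>The effect on polynomials of substituting a monomial for each monomial; for additive
  \<open>\<psi>\<close> it is a ring homomorphism.\<close>

definition push :: "('a \<Rightarrow> 'c) \<Rightarrow> ('a \<Rightarrow>\<^sub>0 'b) \<Rightarrow> ('c \<Rightarrow>\<^sub>0 'b::comm_monoid_add)" where
  "push \<psi> p = (\<Sum>m\<in>Poly_Mapping.keys p. Poly_Mapping.single (\<psi> m) (Poly_Mapping.lookup p m))"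

lemma push_superset:
  assumes "finite A" "Poly_Mapping.keys p \<subseteq> A"
  shows "push \<psi> p = (\<Sum>m\<in>A. Poly_Mapping.single (\<psi> m) (Poly_Mapping.lookup p m))"
  unfolding push_def using assms by (intro sum.mono_neutral_left) (auto simp: in_keys_iff)

lemma push_0 [simp]: "push \<psi> 0 = 0"
  by (simp add: push_def)

lemma push_single [simp]: "push \<psi> (Poly_Mapping.single m c) = Poly_Mapping.single (\<psi> m) c"
  by (simp add: push_def)

lemma push_add: "push \<psi> (p + q) = push \<psi> p + push \<psi> q"
proof -
  let ?A = "Poly_Mapping.keys p \<union> Poly_Mapping.keys q"
  have "Poly_Mapping.keys (p + q) \<subseteq> ?A" by (rule keys_add)
  then show ?thesis
    by (simp add: push_superset[of ?A] lookup_add single_add sum.distrib)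
qed

lemma push_diff: "push \<psi> (p - q) = push \<psi> p - push \<psi> (q :: 'a \<Rightarrow>\<^sub>0 'b::ab_group_add)"
  using push_add[of \<psi> "p - q" q] by simp

lemma push_mult:
  fixes p q :: "'a::comm_monoid_add \<Rightarrow>\<^sub>0 'b::comm_semiring_0"
  assumes "\<And>m n. \<psi> (m + n) = \<psi> m + (\<psi> n :: 'c::comm_monoid_add)"
  shows "push \<psi> (p * q) = push \<psi> p * push \<psi> q"
proof (induction p rule: poly_mapping_additive_induct)
  case (single m c)
  show ?case
    by (induction q rule: poly_mapping_additive_induct)
      (simp_all add: mult_single assms distrib_left push_add)
qed (simp add: distrib_right push_add)

lemma push_push: "push \<phi> (push \<psi> p) = push (\<lambda>m. \<phi> (\<psi> m)) p"
  by (induction p rule: poly_mapping_additive_induct) (simp_all add: push_add)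

lemma restr_push: "restr P (push \<psi> p) = push \<psi> (restr (\<lambda>m. P (\<psi> m)) p)"
  by (induction p rule: poly_mapping_additive_induct) (simp_all add: push_add restr_add restr_single)

text \<open>Choose a monomial \<open>m\<close> of \<open>p\<close> with the largest exponent of
  \<open>z\<close>. Then \<open>s + m\<close> has a larger exponent of \<open>z\<close> than any
  \<open>t + m'\<close>, so nothing cancels it.\<close>

lemma mult_binomial_eq_0:
  fixes p :: "('x \<Rightarrow>\<^sub>0 nat) \<Rightarrow>\<^sub>0 'k::field"
  assumes eq: "p * (Poly_Mapping.single s 1 - Poly_Mapping.single t 1) = 0"
    and less: "Poly_Mapping.lookup t z < Poly_Mapping.lookup s z"
  shows "p = 0"
proof (rule ccontr)
  assume "p \<noteq> 0"
  then have "Poly_Mapping.keys p \<noteq> {}"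
    by (metis empty_iff in_keys_iff lookup_zero poly_mapping_eqI)
  then have "Max ((\<lambda>m. Poly_Mapping.lookup m z) ` Poly_Mapping.keys p)
      \<in> (\<lambda>m. Poly_Mapping.lookup m z) ` Poly_Mapping.keys p"
    by (intro Max_in) auto
  then obtain m where m: "m \<in> Poly_Mapping.keys p"
    "Poly_Mapping.lookup m z = Max ((\<lambda>m. Poly_Mapping.lookup m z) ` Poly_Mapping.keys p)"
    by auto
  have "Poly_Mapping.single s 1 * p = Poly_Mapping.single t 1 * p"
    using eq by (simp only: right_diff_distrib mult.commute[of p] eq_iff_diff_eq_0[symmetric])
  then have "Poly_Mapping.lookup (Poly_Mapping.single t 1 * p) (s + m) = Poly_Mapping.lookup p m"
    using lookup_single_mult[of s 1 p m] by simp
  then have "s + m \<in> Poly_Mapping.keys (Poly_Mapping.single t 1 * p)"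
    using m(1) by (simp add: in_keys_iff)
  then obtain m' where m': "m' \<in> Poly_Mapping.keys p" "s + m = t + m'"
    using in_keys_single_mult by blast
  have "Poly_Mapping.lookup s z + Poly_Mapping.lookup m z = Poly_Mapping.lookup t z + Poly_Mapping.lookup m' z"
    using arg_cong[OF m'(2), of "\<lambda>m. Poly_Mapping.lookup m z"] by (simp add: lookup_add)
  moreover have "Poly_Mapping.lookup m' z \<le> Poly_Mapping.lookup m z"
    unfolding m(2) using m'(1) by (intro Max_ge) auto
  ultimately show False using less by simp
qed

section \<open>Edge binomials and the ideals they generate\<close>

abbreviation xvar :: "'v \<Rightarrow> ('v + 'v) \<Rightarrow>\<^sub>0 nat" where
  "xvar v \<equiv> Poly_Mapping.single (Inl v) 1"

abbreviation yvar :: "'v \<Rightarrow> ('v + 'v) \<Rightarrow>\<^sub>0 nat" where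
  "yvar v \<equiv> Poly_Mapping.single (Inr v) 1"

lemma edge_binomial_eq:
  "edge_binomial u v = Poly_Mapping.single (xvar u + yvar v) 1 - Poly_Mapping.single (xvar v + yvar u) 1"
  by (simp add: edge_binomial_def indeterminate_def mult_single)

lemma edge_binomial_homogeneous: "edge_binomial u v \<in> homogeneous 2"
  unfolding edge_binomial_eq
  by (intro homogeneous_diff homogeneous_single) (auto simp: monomial_degree_add monomial_degree_single)

lemma edge_binomial_self [simp]: "edge_binomial u u = 0"
  by (simp add: edge_binomial_def)

lemma edge_binomial_swap: "edge_binomial v u = - edge_binomial u v"
  by (simp add: edge_binomial_def)

lemma keys_edge_binomial: "Poly_Mapping.keys (edge_binomial u v) \<subseteq> {xvar u + yvar v, xvar v + yvar u}"
  unfolding edge_binomial_eq by (auto simp: in_keys_iff lookup_minus lookup_single when_def split: if_splits)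

lemma keys_edge_binomialD:
  "m \<in> Poly_Mapping.keys (edge_binomial u v) \<Longrightarrow> m = xvar u + yvar v \<or> m = xvar v + yvar u"
  by (drule subsetD[OF keys_edge_binomial]) (simp only: insert_iff empty_iff simp_thms)

text \<open>Endpoints may come in either order, and \<open>R\<close> may hold on the diagonal, where
  the binomial is 0. This frees the ideals from the order of the vertices.\<close>

definition edge_ideal :: "('v \<Rightarrow> 'v \<Rightarrow> bool) \<Rightarrow> ('v::finite + 'v, 'k::field) mpoly set" where
  "edge_ideal R = poly_module.span {edge_binomial u v | u v. R u v}"

lemma edge_ideal_base: "R u v \<Longrightarrow> edge_binomial u v \<in> edge_ideal R"
  unfolding edge_ideal_def by (rule poly_module.span_base) auto

lemma gideal_edge_ideal: "gideal (edge_ideal R)"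
  unfolding edge_ideal_def by (rule gideal_span) (auto intro: edge_binomial_homogeneous)

lemma edge_ideal_induct [consumes 1, case_names zero step]:
  assumes "p \<in> edge_ideal R" "P 0" "\<And>c u v q. R u v \<Longrightarrow> q \<in> edge_ideal R \<Longrightarrow> P q \<Longrightarrow> P (c * edge_binomial u v + q)"
  shows "P p"
proof -
  have "p \<in> poly_module.span {edge_binomial u v | u v. R u v}"
    using assms(1) by (simp add: edge_ideal_def)
  then have "p \<in> edge_ideal R \<and> P p"
  proof (induction p rule: poly_module.span_induct_alt)
    case base
    show ?case using assms(2) gideal_0[OF gideal_edge_ideal] by simp
  next
    case (step c f y)
    then obtain u v where "R u v" "f = edge_binomial u v" by auto
    then show ?case
      using step assms(3) by (auto intro: gideal_add gideal_mult gideal_edge_ideal edge_ideal_base)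
  qed
  then show ?thesis ..
qed

lemma edge_ideal_subset:
  fixes I :: "('v::finite + 'v, 'k::field) mpoly set"
  assumes "gideal I" "\<And>u v. R u v \<Longrightarrow> edge_binomial u v \<in> I"
  shows "edge_ideal R \<subseteq> I"
proof
  fix p :: "('v + 'v, 'k) mpoly" assume "p \<in> edge_ideal R"
  then show "p \<in> I"
    by (induction rule: edge_ideal_induct) (auto intro: gideal_0 gideal_add gideal_mult assms)
qed

abbreviation "complete_ideal V \<equiv> edge_ideal (\<lambda>u v. u \<in> V \<and> v \<in> V)"

text \<open>
  The exponent map of the substitution \<open>y\<^sub>i \<mapsto> b x\<^sub>i\<close> for \<open>i \<in> V\<close>, where \<open>None\<close> stands for the new
  variable \<open>b\<close>.
\<close>

definition param :: "'v set \<Rightarrow> ('v::finite + 'v \<Rightarrow>\<^sub>0 nat) \<Rightarrow> ('v + 'v) option \<Rightarrow>\<^sub>0 nat" where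
  "param V m = Abs_poly_mapping (\<lambda>t. case t of
      None \<Rightarrow> \<Sum>i\<in>V. Poly_Mapping.lookup m (Inr i)
    | Some (Inl i) \<Rightarrow> Poly_Mapping.lookup m (Inl i) + (if i \<in> V then Poly_Mapping.lookup m (Inr i) else 0)
    | Some (Inr i) \<Rightarrow> if i \<in> V then 0 else Poly_Mapping.lookup m (Inr i))"

lemma lookup_param:
  "Poly_Mapping.lookup (param V m) None = (\<Sum>i\<in>V. Poly_Mapping.lookup m (Inr i))"
  "Poly_Mapping.lookup (param V m) (Some (Inl i)) =
     Poly_Mapping.lookup m (Inl i) + (if i \<in> V then Poly_Mapping.lookup m (Inr i) else 0)"
  "Poly_Mapping.lookup (param V m) (Some (Inr i)) = (if i \<in> V then 0 else Poly_Mapping.lookup m (Inr i))"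
  by (simp_all add: param_def)

lemma poly_mapping_option_sum_eqI:
  fixes m n :: "('v + 'v) option \<Rightarrow>\<^sub>0 nat"
  assumes "Poly_Mapping.lookup m None = Poly_Mapping.lookup n None"
    "\<And>i. Poly_Mapping.lookup m (Some (Inl i)) = Poly_Mapping.lookup n (Some (Inl i))"
    "\<And>i. Poly_Mapping.lookup m (Some (Inr i)) = Poly_Mapping.lookup n (Some (Inr i))"
  shows "m = n"
proof (rule poly_mapping_eqI)
  fix k :: "('v + 'v) option"
  show "Poly_Mapping.lookup m k = Poly_Mapping.lookup n k"
    using assms by (cases k) (auto, metis sum.exhaust)
qed

lemma param_add: "param V (m + n) = param V m + param V n"
  by (rule poly_mapping_option_sum_eqI) (simp_all add: lookup_param lookup_add sum.distrib)

lemma param_xvar: "param V (xvar i) = Poly_Mapping.single (Some (Inl i)) 1"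
  by (rule poly_mapping_option_sum_eqI) (simp_all add: lookup_param lookup_single when_def)

lemma param_yvar:
  "i \<in> V \<Longrightarrow> param V (yvar i) = Poly_Mapping.single None 1 + Poly_Mapping.single (Some (Inl i)) 1"
  "i \<notin> V \<Longrightarrow> param V (yvar i) = Poly_Mapping.single (Some (Inr i)) 1"
  by (rule poly_mapping_option_sum_eqI; auto simp: lookup_param lookup_single when_def lookup_add)+

text \<open>Monomials with the same image are joined by exchanges of x_i y_j for x_j y_i, each of
  which changes a monomial by a multiple of an edge binomial. The measure is the total excess of
  y-exponents over those of \<open>m'\<close>; truncated subtraction ignores the deficits.\<close>

lemma param_eq_imp_congruent:
  "param V m = param V m' \<Longrightarrow> Poly_Mapping.single m 1 - Poly_Mapping.single m' (1 :: 'k::field) \<in> complete_ideal V"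
proof (induction "\<Sum>i\<in>V. Poly_Mapping.lookup m (Inr i) - Poly_Mapping.lookup m' (Inr i)"
    arbitrary: m rule: less_induct)
  case less
  let ?y = "\<lambda>m i. Poly_Mapping.lookup m (Inr i)" and ?x = "\<lambda>m i. Poly_Mapping.lookup m (Inl i)"
  have eq: "(\<Sum>i\<in>V. ?y m i) = (\<Sum>i\<in>V. ?y m' i)"
    "\<And>i. i \<in> V \<Longrightarrow> ?x m i + ?y m i = ?x m' i + ?y m' i"
    "\<And>i. i \<notin> V \<Longrightarrow> ?x m i = ?x m' i" "\<And>i. i \<notin> V \<Longrightarrow> ?y m i = ?y m' i"
  proof -
    have P: "Poly_Mapping.lookup (param V m) t = Poly_Mapping.lookup (param V m') t" for t
      by (simp only: less.prems)
    show "(\<Sum>i\<in>V. ?y m i) = (\<Sum>i\<in>V. ?y m' i)" using P[of None] by (simp add: lookup_param)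
    show "?x m i + ?y m i = ?x m' i + ?y m' i" if "i \<in> V" for i
      using P[of "Some (Inl i)"] that by (simp add: lookup_param)
    show "?x m i = ?x m' i" if "i \<notin> V" for i
      using P[of "Some (Inl i)"] that by (simp add: lookup_param)
    show "?y m i = ?y m' i" if "i \<notin> V" for i
      using P[of "Some (Inr i)"] that by (simp add: lookup_param)
  qed
  show ?case
  proof (cases "\<exists>j\<in>V. ?y m' j < ?y m j")
    case True
    then obtain j where j: "j \<in> V" "?y m' j < ?y m j" by blast
    \<comment> \<open>The total y-degree over \<open>V\<close> is recorded as the exponent of b, so
      an excess at \<open>j\<close> is matched by a deficit at some \<open>i\<close>.\<close>
    have "\<exists>i\<in>V. ?y m i < ?y m' i"
    proof (rule ccontr)
      assume "\<not> ?thesis"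
      then have "(\<Sum>i\<in>V. ?y m' i) < (\<Sum>i\<in>V. ?y m i)"
        using j by (intro sum_strict_mono_ex1) (auto simp: not_less)
      then show False using eq(1) by simp
    qed
    then obtain i where i: "i \<in> V" "?y m i < ?y m' i" by blast
    have ij: "i \<noteq> j" using i j by auto
    \<comment> \<open>The image fixes the sum of the exponents of x_i and y_i, so the deficit in y_i
      leaves an x_i to exchange.\<close>
    have xi: "?x m i > 0" using eq(2)[OF i(1)] i(2) by simp
    define m0 where "m0 = m - (xvar i + yvar j)"
    have m: "m = m0 + (xvar i + yvar j)"
      using xi j(2) by (intro poly_mapping_eqI) (auto simp: m0_def lookup_add lookup_minus lookup_single when_def)
    define n where "n = m0 + (xvar j + yvar i)"
    have "param V n = param V m'"
      unfolding less.prems[symmetric] m n_def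
      using i(1) j(1) by (simp add: param_add param_xvar[simplified] param_yvar[simplified] add_ac)
    moreover have "(\<Sum>k\<in>V. ?y n k - ?y m' k) < (\<Sum>k\<in>V. ?y m k - ?y m' k)"
    proof (rule sum_strict_mono_ex1)
      have y: "?y m k = ?y m0 k + (if k = j then 1 else 0)" "?y n k = ?y m0 k + (if k = i then 1 else 0)" for k
        by (simp_all add: m n_def lookup_add lookup_single when_def)
      show "\<forall>k\<in>V. ?y n k - ?y m' k \<le> ?y m k - ?y m' k"
        using i(2) ij by (auto simp: y)
      show "\<exists>k\<in>V. ?y n k - ?y m' k < ?y m k - ?y m' k"
        using j ij by (intro bexI[of _ j]) (auto simp: y)
    qed simp
    ultimately have "Poly_Mapping.single n 1 - Poly_Mapping.single m' (1 :: 'k) \<in> complete_ideal V"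
      using less.hyps by blast
    moreover have "Poly_Mapping.single m 1 - Poly_Mapping.single n (1 :: 'k)
        = Poly_Mapping.single m0 1 * edge_binomial i j"
      by (simp add: m n_def edge_binomial_eq right_diff_distrib mult_single)
    then have "Poly_Mapping.single m 1 - Poly_Mapping.single n (1 :: 'k) \<in> complete_ideal V"
      using i(1) j(1) by (auto intro!: gideal_mult[OF gideal_edge_ideal] edge_ideal_base)
    ultimately show ?thesis
      using gideal_add[OF gideal_edge_ideal] by fastforce
  next
    case False
    have "?y m j = ?y m' j" if "j \<in> V" for j
    proof (rule ccontr)
      assume "?y m j \<noteq> ?y m' j"
      then have "(\<Sum>i\<in>V. ?y m i) < (\<Sum>i\<in>V. ?y m' i)"
        using False that by (intro sum_strict_mono_ex1) (auto simp: not_less intro!: bexI[of _ j] le_neq_implies_less)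
      then show False using eq(1) by simp
    qed
    then have yy: "?y m j = ?y m' j" for j using eq(4) by (cases "j \<in> V") auto
    then have "?x m j = ?x m' j" for j using eq(2,3)[of j] by (cases "j \<in> V") auto
    then have "m = m'"
      using yy by (intro poly_mapping_eqI) (metis sum.exhaust)
    then show ?thesis by (simp add: gideal_0[OF gideal_edge_ideal])
  qed
qed

lemma push_param_edge_binomial:
  assumes "u \<in> V" "v \<in> V"
  shows "push (param V) (edge_binomial u v) = 0"
  using assms by (simp add: edge_binomial_eq push_diff param_add param_xvar[simplified] param_yvar[simplified] add_ac)

text \<open>Conversely, fix one representative for each image monomial. Modulo the ideal
  \<open>p\<close> equals the polynomial rewritten in representatives, which depends only on the
  image of \<open>p\<close>.\<close>

lemma complete_ideal_iff: "p \<in> complete_ideal V \<longleftrightarrow> push (param V) (p :: ('v::finite + 'v, 'k::field) mpoly) = 0"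
proof
  assume "p \<in> complete_ideal V"
  then show "push (param V) p = 0"
    by (induction rule: edge_ideal_induct) (simp_all add: push_add push_mult param_add push_param_edge_binomial)
next
  assume p: "push (param V) p = 0"
  define rep where "rep n = (SOME m. param V m = n)" for n
  have rep: "param V (rep (param V m)) = param V m" for m
    unfolding rep_def by (rule someI) (rule refl)
  have "q - push (\<lambda>m. rep (param V m)) q \<in> complete_ideal V" for q :: "('v + 'v, 'k) mpoly"
  proof (induction q rule: poly_mapping_additive_induct)
    case (single m c)
    have "Poly_Mapping.single 0 c * (Poly_Mapping.single m 1 - Poly_Mapping.single (rep (param V m)) 1) \<in> complete_ideal V"
      by (intro gideal_mult[OF gideal_edge_ideal] param_eq_imp_congruent) (simp add: rep)
    then show ?case by (simp add: right_diff_distrib mult_single)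
  next
    case (add q q')
    from gideal_add[OF gideal_edge_ideal this] show ?case by (simp add: push_add algebra_simps)
  qed
  moreover have "push (\<lambda>m. rep (param V m)) p = 0"
    using p by (simp flip: push_push)
  ultimately show "p \<in> complete_ideal V" by (metis diff_zero)
qed

lemma complete_ideal_subset_var_ideal: "complete_ideal V \<subseteq> (var_ideal (Inl ` V) :: ('v::finite + 'v, 'k::field) mpoly set)"
proof (rule edge_ideal_subset[OF gideal_var_ideal])
  fix u v assume "u \<in> V \<and> v \<in> V"
  then show "edge_binomial u v \<in> (var_ideal (Inl ` V) :: ('v + 'v, 'k) mpoly set)"
    using keys_edge_binomial[of u v, where ?'b = 'k]
    by (fastforce simp: var_ideal_def lookup_add lookup_single when_def)
qed

text \<open>The exponent at \<open>None\<close> is left out: b has degree 0, so that y_i and its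
  image b x_i have the same degree.\<close>

definition param_degree :: "(('v::finite + 'v) option \<Rightarrow>\<^sub>0 nat) \<Rightarrow> nat" where
  "param_degree n = (\<Sum>v\<in>UNIV. Poly_Mapping.lookup n (Some v))"

lemma sum_UNIV_sum:
  fixes f :: "'a::finite + 'b::finite \<Rightarrow> nat"
  shows "(\<Sum>v\<in>UNIV. f v) = (\<Sum>i\<in>UNIV. f (Inl i)) + (\<Sum>i\<in>UNIV. f (Inr i))"
  by (subst UNIV_Plus_UNIV[symmetric], subst sum.Plus) auto

lemma param_degree_param: "param_degree (param V m) = monomial_degree m"
proof -
  have "param_degree (param V m) = (\<Sum>i\<in>UNIV. Poly_Mapping.lookup m (Inl i) +
      ((if i \<in> V then Poly_Mapping.lookup m (Inr i) else 0) + (if i \<in> V then 0 else Poly_Mapping.lookup m (Inr i))))"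
    by (simp add: param_degree_def sum_UNIV_sum lookup_param sum.distrib)
  also have "\<dots> = (\<Sum>i\<in>UNIV. Poly_Mapping.lookup m (Inl i) + Poly_Mapping.lookup m (Inr i))"
    by (rule sum.cong) auto
  also have "\<dots> = monomial_degree m"
    by (simp add: monomial_degree_def sum_UNIV_sum sum.distrib)
  finally show ?thesis .
qed

lemma push_param_hcomp:
  "push (param V) (hcomp e p) = restr (\<lambda>n. int (param_degree n) = e) (push (param V) p)"
  by (simp add: restr_push hcomp_def param_degree_param)

text \<open>
  With \<open>D = y\<^sub>w - b x\<^sub>w\<close>, the substitution maps \<open>\<Sum> c\<^sub>i f\<^sub>i\<^sub>w\<close> to \<open>D\<close> times the image of \<open>\<Sum> c\<^sub>i x\<^sub>i\<close>. As \<open>D\<close> is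
  not a zero divisor, the complete ideal on \<open>insert w V\<close> modulo the one on \<open>V\<close> is isomorphic to
  \<open>(x\<^sub>i : i \<in> V)\<close> modulo the latter, shifted by one degree.
\<close>

lemma ideal_reg_le_complete_ideal:
  "ideal_reg_le 2 {0} (complete_ideal V :: ('v::finite + 'v, 'k::field) mpoly set)"
  using finite[of V]
proof (induction V rule: finite_induct)
  case empty
  have "complete_ideal {} = ({0} :: ('v + 'v, 'k) mpoly set)"
    by (simp add: edge_ideal_def)
  then show ?case by (simp add: ideal_reg_le_refl)
next
  case (insert w V)
  define J J' X where "J = (complete_ideal V :: ('v + 'v, 'k) mpoly set)"
    and "J' = (complete_ideal (insert w V) :: ('v + 'v, 'k) mpoly set)"
    and "X = (var_ideal (Inl ` V) :: ('v + 'v, 'k) mpoly set)"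
  have g: "gideal J" "gideal J'" "gideal X"
    by (auto simp: J_def J'_def X_def gideal_edge_ideal gideal_var_ideal)
  have JX: "J \<subseteq> X" unfolding J_def X_def by (rule complete_ideal_subset_var_ideal)
  have JJ': "J \<subseteq> J'"
    unfolding J_def J'_def by (intro edge_ideal_subset gideal_edge_ideal edge_ideal_base) auto
  have "ideal_reg_le 1 {0} X" unfolding X_def by (rule ideal_reg_le_var_ideal)
  \<comment> \<open>\<open>X\<close> has regularity at most 1, and the submodule \<open>J\<close>
    may have one more, which is the induction hypothesis.\<close>
  then have R: "ideal_reg_le 1 J X"
    by (rule ideal_reg_le_quotient) (use insert.IH g JX in \<open>auto simp: J_def gideal_0[OF gideal_edge_ideal]\<close>)
  define \<phi> where "\<phi> = (push (param V) :: ('v + 'v, 'k) mpoly \<Rightarrow> _)"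
  define D where "D = Poly_Mapping.single (Poly_Mapping.single (Some (Inr w :: 'v + 'v)) (1 :: nat)) (1 :: 'k) -
    Poly_Mapping.single (Poly_Mapping.single None 1 + Poly_Mapping.single (Some (Inl w)) 1) 1"
  have \<phi>: "\<phi> (p + q) = \<phi> p + \<phi> q" "\<phi> (p * q) = \<phi> p * \<phi> q" "\<phi> 0 = 0" "\<phi> (p - q) = \<phi> p - \<phi> q" for p q
    by (simp_all add: \<phi>_def push_add push_mult param_add push_diff)
  have \<phi>J: "p \<in> J \<longleftrightarrow> \<phi> p = 0" for p by (simp add: J_def \<phi>_def complete_ideal_iff)
  have D: "p = 0" if "p * D = 0" for p
    using that unfolding D_def
    by (rule mult_binomial_eq_0[where z = "Some (Inr w)"]) (simp add: lookup_add lookup_single when_def)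
  have \<phi>f: "\<phi> (edge_binomial i w) = \<phi> (indeterminate (Inl i)) * D" if "i \<in> V" for i
    using that insert.hyps
    by (simp add: \<phi>_def D_def edge_binomial_eq indeterminate_def push_diff param_add param_xvar[simplified]
        param_yvar[simplified] right_diff_distrib mult_single add_ac)
  \<comment> \<open>Both monomials of \<open>D\<close> have degree 1 in the grading where b has
    degree 0.\<close>
  have \<phi>h: "\<phi> (hcomp (e + 1) q) = \<phi> (hcomp e p) * D" if "\<phi> q = \<phi> p * D" for e p q
  proof -
    have "int (param_degree (m + n)) = e + 1 \<longleftrightarrow> int (param_degree m) = e"
      if "n \<in> Poly_Mapping.keys D" for m n
    proof -
      have "n = Poly_Mapping.single (Some (Inr w)) 1 \<or>
          n = Poly_Mapping.single None 1 + Poly_Mapping.single (Some (Inl w)) 1"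
        using that by (auto simp: D_def in_keys_iff lookup_minus lookup_single when_def split: if_splits)
      then have "param_degree n = 1"
        by (auto simp: param_degree_def lookup_add lookup_single when_def)
      then show ?thesis by (simp add: param_degree_def lookup_add sum.distrib)
    qed
    then have "restr (\<lambda>n. int (param_degree n) = e + 1) (\<phi> p * D)
        = restr (\<lambda>n. int (param_degree n) = e) (\<phi> p) * D"
      by (rule restr_mult)
    then show ?thesis using that by (simp add: \<phi>_def push_param_hcomp)
  qed
  define \<rho> where "\<rho> p q \<longleftrightarrow> p \<in> X \<and> q \<in> J' \<and> \<phi> q = \<phi> p * D" for p q
  have "ideal_reg_le (1 + 1) J J'"
  proof (rule ideal_reg_le_rel[OF R, of \<rho>])
    show "\<rho> 0 0" by (simp add: \<rho>_def \<phi> g gideal_0)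
    show "\<rho> (p + q) (p' + q')" if "\<rho> p p'" "\<rho> q q'" for p p' q q'
      using that g by (simp add: \<rho>_def \<phi> gideal_add distrib_right)
    show "\<rho> (c * p) (c * p')" if "\<rho> p p'" for c p p'
    proof -
      have "p \<in> X" "p' \<in> J'" "\<phi> p' = \<phi> p * D" using that by (simp_all add: \<rho>_def)
      moreover from this(3) have "\<phi> (c * p') = \<phi> (c * p) * D" by (simp only: \<phi> mult.assoc)
      ultimately show ?thesis using g by (simp only: \<rho>_def gideal_mult simp_thms)
    qed
    show "\<rho> (hcomp e p) (hcomp (e + 1) p')" if "\<rho> p p'" for e p p'
      using that g \<phi>h by (simp add: \<rho>_def gideal_hcomp)
    have fJ': "edge_binomial i w \<in> J'" if "i \<in> V" for i
      unfolding J'_def by (rule edge_ideal_base) (use that in auto)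
    have "\<exists>q. \<rho> p q" if "p \<in> X" for p
    proof -
      have "p \<in> poly_module.span (indeterminate ` Inl ` V)" using that by (simp add: X_def var_ideal_span)
      then have "\<exists>q\<in>J'. \<phi> q = \<phi> p * D"
      proof (induction p rule: poly_module.span_induct_alt)
        case base
        show ?case by (intro bexI[of _ 0]) (simp_all add: \<phi> g gideal_0)
      next
        case (step c x y)
        then obtain i q where "i \<in> V" "x = indeterminate (Inl i)" "q \<in> J'" "\<phi> q = \<phi> y * D" by auto
        then show ?case
          using g fJ'
          by (intro bexI[of _ "c * edge_binomial i w + q"] gideal_add gideal_mult)
            (simp_all only: \<phi> \<phi>f distrib_right mult.assoc)
      qed
      then show ?thesis using that by (auto simp: \<rho>_def)
    qed
    then show "p \<in> X \<longleftrightarrow> (\<exists>q. \<rho> p q)" for p by (auto simp: \<rho>_def)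
    have x: "indeterminate (Inl i) \<in> X" if "i \<in> V" for i
      using that by (auto simp: X_def var_ideal_span intro: poly_module.span_base)
    have "\<exists>p. \<rho> p q" if "q \<in> J'" for q
      using that unfolding J'_def
    proof (induction q rule: edge_ideal_induct)
      case zero
      show ?case by (intro exI[of _ 0]) (simp add: \<rho>_def \<phi> g gideal_0)
    next
      case (step c u v q)
      then obtain p where p: "\<rho> p q" by blast
      have J': "c * edge_binomial u v + q \<in> J'"
        using step p g by (auto simp: J'_def \<rho>_def intro!: gideal_add gideal_mult gideal_edge_ideal edge_ideal_base)
      \<comment> \<open>A generator on \<open>insert w V\<close> either lies in \<open>J\<close>, is
        zero, or joins \<open>w\<close> to a vertex of \<open>V\<close>, possibly with the opposite
        sign.\<close>
      have "\<exists>p'\<in>X. \<phi> (edge_binomial u v) = \<phi> p' * D"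
      proof -
        consider "u \<in> V" "v \<in> V" | "u = v" | "u \<in> V" "v = w" | "u = w" "v \<in> V" using step by auto
        then show ?thesis
        proof cases
          case 1
          then have "edge_binomial u v \<in> J" unfolding J_def by (intro edge_ideal_base) auto
          then show ?thesis using \<phi>J by (intro bexI[of _ 0]) (auto simp: \<phi> g gideal_0)
        next
          case 2
          then show ?thesis by (intro bexI[of _ 0]) (auto simp: \<phi> g gideal_0)
        next
          case 3
          then show ?thesis using \<phi>f x by blast
        next
          case 4
          have "\<phi> (edge_binomial u v) = \<phi> (- 1 * indeterminate (Inl v)) * D"
            using \<phi>f[OF 4(2)] \<phi>(4)[of 0 "edge_binomial v u"] \<phi>(4)[of 0 "indeterminate (Inl v)"] 4(1)
            by (simp add: edge_binomial_swap[of w v] \<phi>)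
          then show ?thesis using gideal_mult[OF g(3) x[OF 4(2)]] by blast
        qed
      qed
      then obtain p' where p': "p' \<in> X" "\<phi> (edge_binomial u v) = \<phi> p' * D" by blast
      have "\<rho> (c * p' + p) (c * edge_binomial u v + q)"
        unfolding \<rho>_def
      proof (intro conjI J')
        show "c * p' + p \<in> X" using p p' g by (simp add: \<rho>_def gideal_add gideal_mult)
        have "\<phi> q = \<phi> p * D" using p by (simp add: \<rho>_def)
        then show "\<phi> (c * edge_binomial u v + q) = \<phi> (c * p' + p) * D"
          by (simp only: \<phi> p' distrib_right mult.assoc)
      qed
      then show ?case by blast
    qed
    then show "q \<in> J' \<longleftrightarrow> (\<exists>p. \<rho> p q)" for q by (auto simp: \<rho>_def)
    show "p \<in> J \<longleftrightarrow> q \<in> J" if "\<rho> p q" for p q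
      using that D by (auto simp: \<rho>_def \<phi>J)
  qed
  then have "ideal_reg_le 2 J J'" by simp
  then have "ideal_reg_le 2 {0} J'"
    using insert.IH g JJ' gideal_0[OF g(1)] by (intro ideal_reg_le_extension[of 2 "{0}" J J']) (auto simp: J_def)
  then show ?case by (simp add: J'_def)
qed

section \<open>Binomial edge ideals of complete multipartite graphs\<close>

text \<open>Expansions of the 3 by 3 determinant on the columns of \<open>l\<close>,
  \<open>u\<close>, \<open>v\<close> in which the row of x or the row of y is repeated.\<close>

lemma minor_relations:
  fixes l :: "'a::comm_ring"
  shows "l * (u * yv - v * yu) = u * (l * yv - v * yl) - v * (l * yu - u * yl)"
    and "yl * (u * yv - v * yu) = yv * (u * yl - l * yu) - yu * (v * yl - l * yv)"
  by (simp_all add: algebra_simps)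

text \<open>A vertex \<open>l\<close> outside \<open>V\<close> is adjacent to both \<open>u\<close>
  and \<open>v\<close>, so the determinant relations express either variable of \<open>l\<close>
  times the binomial of the non-edge by binomials of edges at \<open>l\<close>.\<close>

lemma mult_var_ideal_edge_ideal:
  fixes d :: "('v::finite + 'v, 'k::field) mpoly"
  assumes d: "d \<in> var_ideal {z. case z of Inl l \<Rightarrow> l \<notin> V | Inr l \<Rightarrow> l \<notin> V}"
    and uv: "u \<in> V" "v \<in> V"
    and R: "\<And>u l. u \<in> V \<Longrightarrow> l \<notin> V \<Longrightarrow> R u l \<and> R l u"
  shows "d * edge_binomial u v \<in> edge_ideal R"
  using d unfolding var_ideal_span
proof (induction d rule: poly_module.span_induct_alt)
  case base
  show ?case by (simp add: gideal_0[OF gideal_edge_ideal])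
next
  case (step c z y)
  have "z * edge_binomial u v \<in> edge_ideal R"
  proof -
    obtain l where l: "l \<notin> V" and z: "z = indeterminate (Inl l) \<or> z = indeterminate (Inr l)"
      using step.hyps by (auto split: sum.splits)
    let ?x = "\<lambda>i. indeterminate (Inl i) :: ('v + 'v, 'k) mpoly"
    let ?y = "\<lambda>i. indeterminate (Inr i) :: ('v + 'v, 'k) mpoly"
    note E = gideal_diff[OF gideal_edge_ideal] gideal_mult[OF gideal_edge_ideal] edge_ideal_base[of R]
    show ?thesis
      using z
    proof
      assume z: "z = ?x l"
      have "z * edge_binomial u v = ?x u * edge_binomial l v - ?x v * edge_binomial l u"
        unfolding z edge_binomial_def by (rule minor_relations(1))
      then show ?thesis using R[OF uv(1) l] R[OF uv(2) l] by (auto intro!: E)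
    next
      assume z: "z = ?y l"
      have "z * edge_binomial u v = ?y v * edge_binomial u l - ?y u * edge_binomial v l"
        unfolding z edge_binomial_def by (rule minor_relations(2))
      then show ?thesis using R[OF uv(1) l] R[OF uv(2) l] by (auto intro!: E)
    qed
  qed
  then have "c * (z * edge_binomial u v) + y * edge_binomial u v \<in> edge_ideal R"
    by (rule gideal_add[OF gideal_edge_ideal gideal_mult[OF gideal_edge_ideal] step.IH])
  then show ?case by (simp only: distrib_right mult.assoc)
qed

text \<open>With \<open>U = {}\<close> this is the complete graph, with \<open>U = P\<close> the
  multipartite one; pairs \<open>u = v\<close> contribute the zero binomial.\<close>

definition uncompleted :: "'v set set \<Rightarrow> 'v \<Rightarrow> 'v \<Rightarrow> bool" where
  "uncompleted U u v \<longleftrightarrow> (\<forall>A\<in>U. \<not> (u \<in> A \<and> v \<in> A))"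

text \<open>
  The parts in \<open>U\<close> are still independent sets. Completing one more part \<open>V\<close> enlarges the ideal \<open>B\<close> to
  \<open>C = B + J\<close>, where \<open>J\<close> is the complete ideal on \<open>V\<close>, and \<open>J \<inter> B = J \<inter> (T)\<close> for the set \<open>T\<close> of the
  variables outside \<open>V\<close>. So \<open>C/B\<close> is \<open>J/(J \<inter> (T))\<close>, of regularity at most 2.
\<close>

lemma ideal_reg_le_uncompleted:
  assumes P: "disjoint P" and U: "U \<subseteq> P"
  shows "ideal_reg_le 3 {0} (edge_ideal (uncompleted U) :: ('v::finite + 'v, 'k::field) mpoly set)"
  using finite[of U] U
proof (induction U rule: finite_induct)
  case empty
  have "edge_ideal (uncompleted {}) = (complete_ideal UNIV :: ('v + 'v, 'k) mpoly set)"
    by (simp add: uncompleted_def[abs_def])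
  then show ?case using ideal_reg_le_mono[OF ideal_reg_le_complete_ideal, of 3 UNIV] by simp
next
  case (insert V U)
  define B C J where "B = (edge_ideal (uncompleted (insert V U)) :: ('v + 'v, 'k) mpoly set)"
    and "C = (edge_ideal (uncompleted U) :: ('v + 'v, 'k) mpoly set)"
    and "J = (complete_ideal V :: ('v + 'v, 'k) mpoly set)"
  define T where "T = {z :: 'v + 'v. case z of Inl l \<Rightarrow> l \<notin> V | Inr l \<Rightarrow> l \<notin> V}"
  have g: "gideal B" "gideal C" "gideal J" by (auto simp: B_def C_def J_def gideal_edge_ideal)
  have disj: "u \<notin> A" if "u \<in> V" "A \<in> U" for u A
  proof -
    have "V \<inter> A = {}"
      using that insert.prems insert.hyps by (intro disjointD[OF P]) auto
    then show ?thesis using that by auto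
  qed
  have T: "z \<in> T \<longleftrightarrow> (case z of Inl l \<Rightarrow> l \<notin> V | Inr l \<Rightarrow> l \<notin> V)" for z by (simp add: T_def)
  have av: "avoids T m" if "u \<in> V" "v \<in> V" "m \<in> Poly_Mapping.keys (edge_binomial u v :: ('v + 'v, 'k) mpoly)" for u v m
  proof -
    have "m = xvar u + yvar v \<or> m = xvar v + yvar u" by (rule keys_edge_binomialD[OF that(3)])
    then show ?thesis
      using that(1,2) by (auto simp: avoids_def T lookup_add lookup_single when_def)
  qed
  have BC: "B \<subseteq> C"
    unfolding B_def C_def
    by (intro edge_ideal_subset gideal_edge_ideal edge_ideal_base) (simp add: uncompleted_def)
  have JC: "J \<subseteq> C"
    unfolding J_def C_def
    by (intro edge_ideal_subset gideal_edge_ideal edge_ideal_base) (use disj in \<open>auto simp: uncompleted_def\<close>)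
  \<comment> \<open>An edge not inside \<open>V\<close> has an endpoint outside \<open>V\<close>,
    and both terms of its binomial contain a variable of that endpoint.\<close>
  have BT: "B \<subseteq> var_ideal T"
    unfolding B_def
  proof (rule edge_ideal_subset[OF gideal_var_ideal])
    fix u v assume "uncompleted (insert V U) u v"
    then have "u \<notin> V \<or> v \<notin> V" by (auto simp: uncompleted_def)
    then obtain l where l: "l \<notin> V" "l = u \<or> l = v" by auto
    show "edge_binomial u v \<in> (var_ideal T :: ('v + 'v, 'k) mpoly set)"
      unfolding var_ideal_def
    proof (intro CollectI ballI)
      fix m assume "m \<in> Poly_Mapping.keys (edge_binomial u v :: ('v + 'v, 'k) mpoly)"
      then have "m = xvar u + yvar v \<or> m = xvar v + yvar u" by (rule keys_edge_binomialD)
      then have "Poly_Mapping.lookup m (Inl l) \<noteq> 0 \<or> Poly_Mapping.lookup m (Inr l) \<noteq> 0"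
        using l(2) by (auto simp: lookup_add)
      then show "\<exists>v\<in>T. Poly_Mapping.lookup m v \<noteq> 0"
        using l(1) by (auto simp: T intro: bexI[of _ "Inl l"] bexI[of _ "Inr l"])
    qed
  qed
  \<comment> \<open>The part of \<open>p\<close> involving \<open>T\<close> comes from coefficients
    in \<open>(T)\<close>, as the generators of \<open>J\<close> avoid \<open>T\<close>; such
    multiples lie in \<open>B\<close> by the determinant relations. Hence
    \<open>J \<inter> (T)\<close> is contained in \<open>B\<close>.\<close>
  have JT: "p - restr (avoids T) p \<in> B" if "p \<in> J" for p
    using that unfolding J_def
  proof (induction p rule: edge_ideal_induct)
    case zero
    show ?case by (simp add: g gideal_0)
  next
    case (step c u v q)
    have "restr (avoids T) (c * edge_binomial u v) = restr (avoids T) c * edge_binomial u v"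
      by (rule restr_avoids_mult) (use av step in blast)
    moreover have "c - restr (avoids T) c \<in> var_ideal T"
      by (simp add: var_ideal_iff restr_diff restr_restr)
    then have "(c - restr (avoids T) c) * edge_binomial u v \<in> B"
      unfolding B_def T_def
      by (rule mult_var_ideal_edge_ideal) (use step disj in \<open>auto simp: uncompleted_def\<close>)
    ultimately have "c * edge_binomial u v - restr (avoids T) (c * edge_binomial u v) \<in> B"
      by (simp add: left_diff_distrib)
    from gideal_add[OF g(1) this step.IH] show ?case
      by (simp add: restr_add algebra_simps)
  qed
  have "ideal_reg_le 2 (J \<inter> var_ideal T) J"
    unfolding J_def edge_ideal_def
  proof (rule ideal_reg_le_mod_variables)
    show "ideal_reg_le 2 {0} (poly_module.span {edge_binomial u v :: ('v + 'v, 'k) mpoly | u v. u \<in> V \<and> v \<in> V})"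
      using ideal_reg_le_complete_ideal[of V] by (simp add: edge_ideal_def)
  qed (use av edge_binomial_homogeneous in blast)+
  \<comment> \<open>The second isomorphism theorem for \<open>C = B + J\<close>, with congruence
    modulo \<open>B\<close> as the relation.\<close>
  then have "ideal_reg_le (2 + 0) B C"
  proof (rule ideal_reg_le_rel[where \<rho> = "\<lambda>p q. p \<in> J \<and> q \<in> C \<and> q - p \<in> B"])
    show "0 \<in> J \<and> 0 \<in> C \<and> 0 - 0 \<in> B" using g by (simp add: gideal_0)
    show "p + q \<in> J \<and> p' + q' \<in> C \<and> p' + q' - (p + q) \<in> B"
      if "p \<in> J \<and> p' \<in> C \<and> p' - p \<in> B" "q \<in> J \<and> q' \<in> C \<and> q' - q \<in> B" for p p' q q'
      using that g gideal_add[OF g(1), of "p' - p" "q' - q"] by (simp add: gideal_add algebra_simps)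
    show "c * p \<in> J \<and> c * p' \<in> C \<and> c * p' - c * p \<in> B"
      if "p \<in> J \<and> p' \<in> C \<and> p' - p \<in> B" for c p p'
      using that g by (simp add: gideal_mult flip: right_diff_distrib)
    show "hcomp e p \<in> J \<and> hcomp (e + 0) p' \<in> C \<and> hcomp (e + 0) p' - hcomp e p \<in> B"
      if "p \<in> J \<and> p' \<in> C \<and> p' - p \<in> B" for e p p'
      using that g by (simp add: gideal_hcomp flip: hcomp_diff)
    show "p \<in> J \<longleftrightarrow> (\<exists>q. p \<in> J \<and> q \<in> C \<and> q - p \<in> B)" for p
      using JC gideal_0[OF g(1)] by (auto intro!: exI[of _ p])
    have "\<exists>p. p \<in> J \<and> q - p \<in> B" if "q \<in> C" for q
      using that unfolding C_def
    proof (induction q rule: edge_ideal_induct)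
      case zero
      show ?case using g by (intro exI[of _ 0]) (simp add: gideal_0)
    next
      case (step c u v q)
      then obtain p where p: "p \<in> J" "q - p \<in> B" by blast
      show ?case
      proof (cases "u \<in> V \<and> v \<in> V")
        case True
        then have "c * edge_binomial u v + p \<in> J"
          using p unfolding J_def by (intro gideal_add gideal_mult gideal_edge_ideal edge_ideal_base) auto
        then show ?thesis using p by (intro exI[of _ "c * edge_binomial u v + p"]) simp
      next
        case False
        then have "uncompleted (insert V U) u v" using step by (auto simp: uncompleted_def)
        then have "c * edge_binomial u v + (q - p) \<in> B"
          using p unfolding B_def by (intro gideal_add gideal_mult gideal_edge_ideal edge_ideal_base) auto
        then show ?thesis using p by (intro exI[of _ p]) (simp add: add_diff_eq)
      qed
    qed
    then show "q \<in> C \<longleftrightarrow> (\<exists>p. p \<in> J \<and> q \<in> C \<and> q - p \<in> B)" for q by blast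
    show "p \<in> J \<inter> var_ideal T \<longleftrightarrow> q \<in> B" if "p \<in> J \<and> q \<in> C \<and> q - p \<in> B" for p q
    proof
      assume "p \<in> J \<inter> var_ideal T"
      then have "p \<in> B" using JT[of p] by (auto simp: var_ideal_iff)
      then show "q \<in> B" using gideal_add[OF g(1), of "q - p" p] that by simp
    next
      assume "q \<in> B"
      then have "p \<in> B" using gideal_diff[OF g(1), of q "q - p"] that by simp
      then show "p \<in> J \<inter> var_ideal T" using BT that by auto
    qed
  qed
  moreover have "ideal_reg_le (2 + 1) {0} C"
    using insert by (simp add: C_def)
  \<comment> \<open>\<open>C\<close> has bound 3 and \<open>C/B\<close> has bound 2, so the kernel
    step keeps 3; the bound does not grow with the number of parts.\<close>
  ultimately have "ideal_reg_le (2 + 1) {0} B"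
    using ideal_reg_le_kernel[of 2 "{0}" C B] g BC gideal_0[OF g(1)] by simp
  then show ?case by (simp add: B_def)
qed

section \<open>A nonlinear syzygy\<close>

lemma lookup_mult_single_eq_0:
  fixes p :: "('x \<Rightarrow>\<^sub>0 nat) \<Rightarrow>\<^sub>0 'k::field"
  assumes "Poly_Mapping.lookup n z < Poly_Mapping.lookup t z"
  shows "Poly_Mapping.lookup (p * Poly_Mapping.single t 1) n = 0"
proof (rule ccontr)
  assume "Poly_Mapping.lookup (p * Poly_Mapping.single t 1) n \<noteq> 0"
  then have "n \<in> Poly_Mapping.keys (Poly_Mapping.single t 1 * p)"
    by (simp add: in_keys_iff mult.commute)
  then obtain m where "n = t + m" using in_keys_single_mult by blast
  then show False using assms by (simp add: lookup_add)
qed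

lemma lookup_mult_single:
  fixes p :: "('x \<Rightarrow>\<^sub>0 nat) \<Rightarrow>\<^sub>0 'k::field"
  shows "Poly_Mapping.lookup (p * Poly_Mapping.single t 1) (t + m) = Poly_Mapping.lookup p m"
  using lookup_single_mult[of t 1 p m] by (simp add: mult.commute)

lemma monomial_degree_le_1:
  assumes "monomial_degree m \<le> 1" "Poly_Mapping.lookup m v \<noteq> 0"
  shows "m = Poly_Mapping.single v 1"
proof -
  have "monomial_degree m = Poly_Mapping.lookup m v + (\<Sum>w\<in>UNIV - {v}. Poly_Mapping.lookup m w)"
    unfolding monomial_degree_def by (rule sum.remove) auto
  then have "Poly_Mapping.lookup m v = 1" "(\<Sum>w\<in>UNIV - {v}. Poly_Mapping.lookup m w) = 0"
    using assms by linarith+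
  then have "Poly_Mapping.lookup m w = (if w = v then 1 else 0)" for w
    by (cases "w = v") auto
  then show ?thesis by (intro poly_mapping_eqI) (auto simp: lookup_single when_def)
qed

text \<open>Compare coefficients: a monomial \<open>m\<close> of \<open>p\<close> has at most one
  variable, so for one of the two terms of the first binomial its product with \<open>m\<close>
  cannot be reached by the other three products.\<close>

lemma linear_syzygy_eq_0:
  fixes p q :: "('v::finite + 'v, 'k::field) mpoly"
  assumes d: "distinct [u, a, v]"
    and lin: "\<And>m. m \<in> Poly_Mapping.keys p \<Longrightarrow> monomial_degree m \<le> 1"
    and eq: "p * edge_binomial u a + q * edge_binomial a v = 0"
  shows "p = 0"
proof (rule poly_mapping_eqI, rule ccontr)
  fix m assume nz: "Poly_Mapping.lookup p m \<noteq> Poly_Mapping.lookup 0 m"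
  then have "m \<in> Poly_Mapping.keys p" by (simp add: in_keys_iff)
  then have m1: "monomial_degree m \<le> 1" by (rule lin)
  let ?L = "\<lambda>p t n. Poly_Mapping.lookup (p * Poly_Mapping.single t 1) n"
  have E: "?L p (xvar u + yvar a) n - ?L p (xvar a + yvar u) n
      + (?L q (xvar a + yvar v) n - ?L q (xvar v + yvar a) n) = 0" for n
    using arg_cong[OF eq, of "\<lambda>p. Poly_Mapping.lookup p n"]
    by (simp add: edge_binomial_eq right_diff_distrib lookup_add lookup_minus)
  have ne: "u \<noteq> a" "a \<noteq> u" "a \<noteq> v" "v \<noteq> a" "u \<noteq> v" "v \<noteq> u" using d by auto
  show False
  proof (cases "Poly_Mapping.lookup m (Inl v) = 0")
    case False
    then have m: "m = xvar v" using monomial_degree_le_1[OF m1] by simp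
    \<comment> \<open>Here x_u y_a times \<open>m\<close> could be cancelled by the term x_v y_a of
      the other binomial, so the second term is used.\<close>
    let ?n = "(xvar a + yvar u) + m"
    have "?L p (xvar u + yvar a) ?n = 0"
      by (rule lookup_mult_single_eq_0[where z = "Inl u"]) (use ne in \<open>auto simp: m lookup_add lookup_single when_def\<close>)
    moreover have "?L q (xvar a + yvar v) ?n = 0"
      by (rule lookup_mult_single_eq_0[where z = "Inr v"]) (use ne in \<open>auto simp: m lookup_add lookup_single when_def\<close>)
    moreover have "?L q (xvar v + yvar a) ?n = 0"
      by (rule lookup_mult_single_eq_0[where z = "Inr a"]) (use ne in \<open>auto simp: m lookup_add lookup_single when_def\<close>)
    ultimately show False using E[of ?n] nz lookup_mult_single[of p "xvar a + yvar u" m] by simp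
  next
    case xv: True
    let ?n = "(xvar u + yvar a) + m"
    have "?L p (xvar a + yvar u) ?n = 0"
    proof (cases "Poly_Mapping.lookup m (Inl a) = 0")
      case True
      then show ?thesis
        by (intro lookup_mult_single_eq_0[where z = "Inl a"]) (use ne in \<open>auto simp: lookup_add lookup_single when_def\<close>)
    next
      case False
      then have m: "m = xvar a" using monomial_degree_le_1[OF m1] by simp
      show ?thesis
        by (rule lookup_mult_single_eq_0[where z = "Inr u"]) (use ne in \<open>auto simp: m lookup_add lookup_single when_def\<close>)
    qed
    moreover have "?L q (xvar a + yvar v) ?n = 0"
    proof (cases "Poly_Mapping.lookup m (Inl a) = 0")
      case True
      then show ?thesis
        by (intro lookup_mult_single_eq_0[where z = "Inl a"]) (use ne in \<open>auto simp: lookup_add lookup_single when_def\<close>)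
    next
      case False
      then have m: "m = xvar a" using monomial_degree_le_1[OF m1] by simp
      show ?thesis
        by (rule lookup_mult_single_eq_0[where z = "Inr v"]) (use ne in \<open>auto simp: m lookup_add lookup_single when_def\<close>)
    qed
    moreover have "?L q (xvar v + yvar a) ?n = 0"
      by (rule lookup_mult_single_eq_0[where z = "Inl v"]) (use ne xv in \<open>auto simp: lookup_add lookup_single when_def\<close>)
    ultimately show False using E[of ?n] nz lookup_mult_single[of p "xvar u + yvar a" m] by simp
  qed
qed

text \<open>A product of monomials avoids \<open>T\<close> iff both factors do: setting the
  variables in \<open>T\<close> to 0 is a ring homomorphism.\<close>

lemma restr_avoids_mult2:
  fixes p q :: "('x, 'k::field) mpoly"
  shows "restr (avoids T) (p * q) = restr (avoids T) p * restr (avoids T) q"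
proof (induction p rule: poly_mapping_additive_induct)
  case (single m c)
  show ?case
    by (induction q rule: poly_mapping_additive_induct)
      (auto simp: mult_single restr_single avoids_add restr_add distrib_left)
qed (simp add: distrib_right restr_add)

lemma homogeneous_restr: "p \<in> homogeneous d \<Longrightarrow> restr P p \<in> homogeneous d"
  by (auto simp: homogeneous_def keys_restr)

lemma homogeneous_le_0:
  assumes "p \<in> homogeneous d" "d \<le> 0"
  shows "\<exists>c. p = Poly_Mapping.single 0 c \<and> (d < 0 \<longrightarrow> c = 0)"
proof (cases "d = 0")
  case True
  then show ?thesis using homogeneous_0_const assms(1) by blast
next
  case False
  then have "p = 0" using homogeneous_neg[OF assms(1)] assms(2) by simp
  then show ?thesis by (intro exI[of _ 0]) simp
qed

text \<open>
  After killing all variables outside \<open>u, a, v\<close>, only \<open>f\<^sub>u\<^sub>a\<close> and \<open>f\<^sub>a\<^sub>v\<close> survive among the generators, and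
  these have no linear syzygy. Hence their Koszul syzygy, of degree 4, is not a combination of
  syzygies of degree at most 3.
\<close>

lemma nonlinear_syzygy:
  fixes R :: "'v::finite \<Rightarrow> 'v \<Rightarrow> bool"
  assumes s: "minimal_resolution_seq (edge_ideal R :: ('v + 'v, 'k::field) mpoly set) k e g"
    and d: "distinct [u, a, v]" and R: "R u a" "R a v" "\<not> R u v" "\<not> R v u"
  shows "\<exists>i p. p < k i \<and> 3 \<le> e i p - int i"
proof (rule ccontr)
  assume "\<not> ?thesis"
  \<comment> \<open>So generators have degree at most 2 and first syzygies degree at most 3.\<close>
  then have small: "e i p - int i < 3" if "p < k i" for i p using that not_le by blast
  define J where "J = (edge_ideal R :: ('v + 'v, 'k) mpoly set)"
  have gJ: "gideal J" unfolding J_def by (rule gideal_edge_ideal)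
  define T where "T = {z :: 'v + 'v. case z of Inl l \<Rightarrow> l \<notin> {u, a, v} | Inr l \<Rightarrow> l \<notin> {u, a, v}}"
  define \<pi> where "\<pi> = (restr (avoids T) :: ('v + 'v, 'k) mpoly \<Rightarrow> _)"
  define f1 f2 where "f1 = (edge_binomial u a :: ('v + 'v, 'k) mpoly)"
    and "f2 = (edge_binomial a v :: ('v + 'v, 'k) mpoly)"
  have f2: "f1 \<in> homogeneous 2" "f2 \<in> homogeneous 2" by (auto simp: f1_def f2_def edge_binomial_homogeneous)
  have fJ: "f1 \<in> J" "f2 \<in> J" using R by (auto simp: f1_def f2_def J_def intro: edge_ideal_base)
  have \<pi>: "\<pi> (p + q) = \<pi> p + \<pi> q" "\<pi> (p - q) = \<pi> p - \<pi> q" "\<pi> (p * q) = \<pi> p * \<pi> q" "\<pi> 0 = 0" for p q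
    by (simp_all add: \<pi>_def restr_add restr_diff restr_avoids_mult2)
  have \<pi>sum: "\<pi> (\<Sum>i\<in>I. h i) = (\<Sum>i\<in>I. \<pi> (h i))" for h and I :: "nat set"
    by (simp add: \<pi>_def restr_sum)
  have \<pi>id: "\<pi> (edge_binomial x y) = edge_binomial x y" if "{x, y} \<subseteq> {u, a, v}" for x y
    unfolding \<pi>_def
  proof (rule restr_eq_self)
    fix m assume "m \<in> Poly_Mapping.keys (edge_binomial x y :: ('v + 'v, 'k) mpoly)"
    then have "m = xvar x + yvar y \<or> m = xvar y + yvar x" by (rule keys_edge_binomialD)
    then show "avoids T m"
      using that by (auto simp: avoids_def T_def lookup_add lookup_single when_def)
  qed
  have \<pi>0: "\<pi> (edge_binomial x y) = 0" if xy: "\<not> {x, y} \<subseteq> {u, a, v}" for x y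
    unfolding \<pi>_def
  proof (rule restr_eq_0)
    fix m assume "m \<in> Poly_Mapping.keys (edge_binomial x y :: ('v + 'v, 'k) mpoly)"
    then have m: "m = xvar x + yvar y \<or> m = xvar y + yvar x" by (rule keys_edge_binomialD)
    obtain l where l: "l \<notin> {u, a, v}" "l = x \<or> l = y" using xy by blast
    have "Poly_Mapping.lookup m (Inl l) \<noteq> 0 \<or> Poly_Mapping.lookup m (Inr l) \<noteq> 0"
      using m l(2) by (auto simp: lookup_add)
    moreover have "Inl l \<in> T" "Inr l \<in> T" using l(1) by (auto simp: T_def)
    ultimately show "\<not> avoids T m" by (auto simp: avoids_def)
  qed
  have \<pi>f: "\<pi> f1 = f1" "\<pi> f2 = f2" by (auto simp: f1_def f2_def \<pi>id)
  have \<pi>J: "\<exists>A B. \<pi> p = A * f1 + B * f2" if "p \<in> J" for p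
    using that unfolding J_def
  proof (induction p rule: edge_ideal_induct)
    case zero
    show ?case by (intro exI[of _ 0]) (simp add: \<pi>)
  next
    case (step c x y q)
    then obtain A B where AB: "\<pi> q = A * f1 + B * f2" by blast
    have "\<exists>A B. \<pi> (edge_binomial x y) = A * f1 + B * f2"
    proof (cases "{x, y} \<subseteq> {u, a, v}")
      case False
      then show ?thesis by (intro exI[of _ 0]) (simp add: \<pi>0)
    next
      case True
      consider "x = y" | "x = u" "y = a" | "x = a" "y = u" | "x = a" "y = v" | "x = v" "y = a"
        using True step.hyps R(3,4) by auto
      then show ?thesis
      proof cases
        case 1
        then show ?thesis by (intro exI[of _ 0]) (simp add: \<pi>)
      next
        case 2
        then show ?thesis by (intro exI[of _ 1] exI[of _ 0]) (simp add: \<pi>f flip: f1_def)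
      next
        case 3
        have "edge_binomial x y = - f1" using edge_binomial_swap[of a u] 3 by (simp add: f1_def)
        then show ?thesis using \<pi>(2)[of 0 f1] by (intro exI[of _ "- 1"] exI[of _ 0]) (simp add: \<pi> \<pi>f)
      next
        case 4
        then show ?thesis by (intro exI[of _ 0] exI[of _ 1]) (simp add: \<pi>f flip: f2_def)
      next
        case 5
        have "edge_binomial x y = - f2" using edge_binomial_swap[of v a] 5 by (simp add: f2_def)
        then show ?thesis using \<pi>(2)[of 0 f2] by (intro exI[of _ 0] exI[of _ "- 1"]) (simp add: \<pi> \<pi>f)
      qed
    qed
    then obtain A' B' where AB': "\<pi> (edge_binomial x y) = A' * f1 + B' * f2" by blast
    have "\<pi> (c * edge_binomial x y + q) = (\<pi> c * A' + A) * f1 + (\<pi> c * B' + B) * f2"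
      by (simp only: \<pi> AB AB' distrib_left distrib_right mult.assoc add.assoc add.left_commute)
    then show ?case by blast
  qed
  define G where "G q = g 0 q 0" for q
  define E where "E = e 0"
  obtain r where g0: "generates r deg0 {0} (embv ` J) (k 0) (g 0) E"
    using s by (auto simp: minimal_resolution_seq_def J_def E_def)
  obtain r' where g1: "generates r' E {0} (syz (k 0) (g 0) {0}) (k 1) (g 1) (e 1)"
    using s by (auto simp: minimal_resolution_seq_def E_def)
  have G: "G q \<in> J" "G q \<in> homogeneous (E q)" "g 0 q = embv (G q)" if q: "q < k 0" for q
  proof -
    obtain p where "p \<in> J" "g 0 q = embv p" using g0 q by (auto simp: generates_def)
    then show "G q \<in> J" "g 0 q = embv (G q)" by (auto simp: G_def embv_def)
    have "hom deg0 (E q) (g 0 q)" using g0 q by (auto simp: generates_def)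
    then show "G q \<in> homogeneous (E q)" by (auto simp: hom_def G_def dest: spec[of _ 0])
  qed
  have lc0: "lc (k 0) c (g 0) 0 = (\<Sum>q<k 0. c q * G q)" for c
    by (simp add: lc_def G_def)
  have lcj: "lc (k 0) c (g 0) j = 0" if "j \<noteq> 0" for c j
    using that G(3) by (simp add: lc_def embv_def)
  have syz0: "c \<in> syz (k 0) (g 0) {0} \<longleftrightarrow> c \<in> supp (k 0) \<and> (\<Sum>q<k 0. c q * G q) = 0" for c
  proof -
    have "lc (k 0) c (g 0) = 0 \<longleftrightarrow> (\<Sum>q<k 0. c q * G q) = 0"
    proof
      assume "lc (k 0) c (g 0) = 0"
      then show "(\<Sum>q<k 0. c q * G q) = 0" by (simp flip: lc0)
    next
      assume z: "(\<Sum>q<k 0. c q * G q) = 0"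
      show "lc (k 0) c (g 0) = 0"
      proof
        fix j
        show "lc (k 0) c (g 0) j = 0 j" using lc0[of c] lcj[of j c] z by (cases "j = 0") simp_all
      qed
    qed
    then show ?thesis by (simp add: syz_def)
  qed
  \<comment> \<open>Since \<open>E q\<close> is at most 2 and \<open>f1\<close>, \<open>f2\<close>
    have degree 2, the coefficients can be taken of degree at most 0: scalars, which vanish if
    \<open>E q < 2\<close>.\<close>
  have "\<exists>\<alpha> \<beta>. \<pi> (G q) = Poly_Mapping.single 0 \<alpha> * f1 + Poly_Mapping.single 0 \<beta> * f2 \<and>
      (E q < 2 \<longrightarrow> \<alpha> = 0 \<and> \<beta> = 0)" if q: "q < k 0" for q
  proof -
    have E2: "E q - 2 \<le> 0" using small[of q 0] q by (simp add: E_def)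
    obtain A B where AB: "\<pi> (G q) = A * f1 + B * f2" using \<pi>J[OF G(1)[OF q]] by blast
    have "\<pi> (G q) \<in> homogeneous (E q)" unfolding \<pi>_def by (rule homogeneous_restr[OF G(2)[OF q]])
    then have "\<pi> (G q) = hcomp (E q) (A * f1 + B * f2)" by (simp add: hcomp_homogeneous flip: AB)
    also have "\<dots> = hcomp (E q - 2) A * f1 + hcomp (E q - 2) B * f2"
      by (simp only: hcomp_add hcomp_mult[OF f2(1)] hcomp_mult[OF f2(2)])
    finally have 1: "\<pi> (G q) = hcomp (E q - 2) A * f1 + hcomp (E q - 2) B * f2" .
    obtain \<alpha> where "hcomp (E q - 2) A = Poly_Mapping.single 0 \<alpha>" "E q - 2 < 0 \<longrightarrow> \<alpha> = 0"
      using homogeneous_le_0[OF homogeneous_hcomp E2] by blast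
    moreover obtain \<beta> where "hcomp (E q - 2) B = Poly_Mapping.single 0 \<beta>" "E q - 2 < 0 \<longrightarrow> \<beta> = 0"
      using homogeneous_le_0[OF homogeneous_hcomp E2] by blast
    ultimately show ?thesis using 1 by auto
  qed
  then have "\<forall>q. \<exists>\<alpha> \<beta>. q < k 0 \<longrightarrow> \<pi> (G q) = Poly_Mapping.single 0 \<alpha> * f1 + Poly_Mapping.single 0 \<beta> * f2 \<and>
      (E q < 2 \<longrightarrow> \<alpha> = 0 \<and> \<beta> = 0)" by blast
  then obtain \<alpha> \<beta> where ab: "\<And>q. q < k 0 \<Longrightarrow>
      \<pi> (G q) = Poly_Mapping.single 0 (\<alpha> q) * f1 + Poly_Mapping.single 0 (\<beta> q) * f2"
    and ab0: "\<And>q. q < k 0 \<Longrightarrow> E q < 2 \<Longrightarrow> \<alpha> q = 0 \<and> \<beta> q = 0"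
    by metis
  \<comment> \<open>\<open>L \<alpha> w\<close> and \<open>L \<beta> w\<close> are coefficients of
    \<open>f1\<close> and \<open>f2\<close> in the image under \<open>\<pi>\<close> of the
    combination of generators given by \<open>w\<close>.\<close>
  define L where "L \<gamma> w = (\<Sum>q<k 0. Poly_Mapping.single 0 (\<gamma> q) * \<pi> (w q))" for \<gamma> :: "nat \<Rightarrow> 'k" and w
  have L: "L \<gamma> (w + w') = L \<gamma> w + L \<gamma> w'" "L \<gamma> (w - w') = L \<gamma> w - L \<gamma> w'" "L \<gamma> (smul c w) = \<pi> c * L \<gamma> w" 
    "L \<gamma> 0 = 0" for \<gamma> w w' c
  proof -
    show "L \<gamma> (smul c w) = \<pi> c * L \<gamma> w"
      by (simp only: L_def smul_def \<pi> sum_distrib_left mult.left_commute)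
  qed (simp_all add: L_def \<pi> distrib_left right_diff_distrib sum.distrib sum_subtractf)
  have \<pi>lc: "\<pi> (\<Sum>q<k 0. w q * G q) = L \<alpha> w * f1 + L \<beta> w * f2" for w
  proof -
    have "\<pi> (\<Sum>q<k 0. w q * G q) = (\<Sum>q<k 0. \<pi> (w q) *
        (Poly_Mapping.single 0 (\<alpha> q) * f1 + Poly_Mapping.single 0 (\<beta> q) * f2))"
      by (simp add: \<pi>sum \<pi> ab)
    also have "\<dots> = (\<Sum>q<k 0. Poly_Mapping.single 0 (\<alpha> q) * \<pi> (w q) * f1
        + Poly_Mapping.single 0 (\<beta> q) * \<pi> (w q) * f2)"
      by (simp only: distrib_left mult.assoc mult.left_commute)
    finally show ?thesis by (simp only: L_def sum_distrib_right sum.distrib)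
  qed
  have Lhom: "L \<alpha> w \<in> homogeneous (f - 2)" if "hom E f w" for f w
    unfolding L_def
  proof (rule homogeneous_sum)
    fix q assume "q \<in> {..<k 0}"
    then have q: "q < k 0" by simp
    have w: "\<pi> (w q) \<in> homogeneous (f - E q)"
      using that unfolding \<pi>_def hom_def by (intro homogeneous_restr) simp
    show "Poly_Mapping.single 0 (\<alpha> q) * \<pi> (w q) \<in> homogeneous (f - 2)"
    proof (cases "E q < 2")
      case True
      then show ?thesis using ab0[OF q] by simp
    next
      case False
      then have "E q = 2" using small[of q 0] q by (simp add: E_def)
      then show ?thesis
        using homogeneous_mult[OF homogeneous_single[of 0 0 "\<alpha> q"] w] by simp
    qed
  qed
  have lin: "p = 0" if "p \<in> homogeneous f" "f \<le> 1" "p * f1 + q * f2 = 0" for p q f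
    using linear_syzygy_eq_0[OF d _ that(3)[unfolded f1_def f2_def]] that(1,2)
    by (force simp: homogeneous_def)
  \<comment> \<open>A generating syzygy has degree at most 3, so its image is a syzygy of
    \<open>f1\<close> and \<open>f2\<close> with coefficients of degree at most 1.\<close>
  have "L \<alpha> (g 1 p) = 0" if p: "p < k 1" for p
  proof -
    have h: "hom E (e 1 p) (g 1 p)" "g 1 p \<in> syz (k 0) (g 0) {0}" using g1 p by (auto simp: generates_def)
    have "(\<Sum>q<k 0. g 1 p q * G q) = 0" using h(2) unfolding syz0 by simp
    then have "L \<alpha> (g 1 p) * f1 + L \<beta> (g 1 p) * f2 = 0"
      using \<pi>lc[of "g 1 p"] by (simp only: \<pi>)
    then show ?thesis
      by (rule lin[OF Lhom[OF h(1)], rotated]) (use small[of p 1] p in simp)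
  qed
  then have Lspan: "L \<alpha> (lc (k 1) c (g 1)) = 0" for c
  proof -
    have "L \<alpha> (lc n c (g 1)) = 0" if "n \<le> k 1" for n
      using that \<open>\<And>p. p < k 1 \<Longrightarrow> L \<alpha> (g 1 p) = 0\<close>
      by (induction n) (simp_all add: lc_Suc L)
    then show ?thesis by simp
  qed
  have Lsyz: "L \<alpha> w = 0" if "w \<in> syz (k 0) (g 0) {0}" for w
  proof -
    have "\<forall>b\<in>syz (k 0) (g 0) {0}. \<exists>c. b - lc (k 1) c (g 1) \<in> {0}"
      using g1 unfolding generates_def by (rule conjunct2)
    from bspec[OF this that] obtain c where "w - lc (k 1) c (g 1) \<in> {0}" ..
    then have "w = lc (k 1) c (g 1)" by simp
    then show ?thesis by (simp only: Lspan)
  qed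
  have gen: "\<exists>c. c \<in> supp (k 0) \<and> hom E 2 c \<and> f = (\<Sum>q<k 0. c q * G q)" if "f \<in> J" "f \<in> homogeneous 2" for f
  proof -
    have hg: "\<And>q. q < k 0 \<Longrightarrow> hom deg0 (E q) (g 0 q)" using g0 by (auto simp: generates_def)
    have "embv f \<in> embv ` J" using that by simp
    then obtain c where c: "embv f = lc (k 0) c (g 0)" using g0 unfolding generates_def by auto
    have "embv f = vcomp deg0 2 (lc (k 0) c (g 0))"
      using vcomp_hom[OF hom_embv[OF that(2)]] c by simp
    also have "\<dots> = lc (k 0) (vcomp E 2 c) (g 0)" by (rule lc_vcomp[OF hg, symmetric])
    also have "\<dots> = lc (k 0) (trunc (k 0) (vcomp E 2 c)) (g 0)" by simp
    finally have "f = (\<Sum>q<k 0. trunc (k 0) (vcomp E 2 c) q * G q)"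
      using lc0 by (metis embv_def)
    moreover have "hom E 2 (trunc (k 0) (vcomp E 2 c))"
      using hom_vcomp[of E 2 c] by (auto simp: hom_def trunc_def)
    ultimately show ?thesis using trunc_supp by blast
  qed
  obtain c where c: "c \<in> supp (k 0)" "hom E 2 c" "f1 = (\<Sum>q<k 0. c q * G q)"
    using gen[OF fJ(1) f2(1)] by auto
  obtain b where b: "b \<in> supp (k 0)" "hom E 2 b" "f2 = (\<Sum>q<k 0. b q * G q)"
    using gen[OF fJ(2) f2(2)] by auto
  \<comment> \<open>For \<open>c\<close> representing \<open>f1\<close> and \<open>b\<close>
    representing \<open>f2\<close>, scalar coefficients are determined: \<open>L \<alpha>\<close>
    takes the values 1 and 0.\<close>
  have "(L \<alpha> c - 1) * f1 + L \<beta> c * f2 = (L \<alpha> c * f1 + L \<beta> c * f2) - f1"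
    by (simp add: left_diff_distrib)
  also have "\<dots> = 0" using \<pi>lc[of c] by (simp add: \<pi>f flip: c(3))
  finally have eqc: "(L \<alpha> c - 1) * f1 + L \<beta> c * f2 = 0" .
  have "L \<alpha> c \<in> homogeneous 0" using Lhom[OF c(2)] by simp
  then have "L \<alpha> c - 1 \<in> homogeneous 0" by (rule homogeneous_diff[OF _ homogeneous_1])
  then have Lc: "L \<alpha> c - 1 = 0"
    by (rule lin[OF _ _ eqc]) simp
  have "L \<alpha> b * f1 + (L \<beta> b - 1) * f2 = (L \<alpha> b * f1 + L \<beta> b * f2) - f2"
    by (simp add: left_diff_distrib)
  also have "\<dots> = 0" using \<pi>lc[of b] by (simp add: \<pi>f flip: b(3))
  finally have eqb: "L \<alpha> b * f1 + (L \<beta> b - 1) * f2 = 0" .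
  have Lb: "L \<alpha> b = 0"
    by (rule lin[OF Lhom[OF b(2)] _ eqb]) simp
  \<comment> \<open>The Koszul syzygy, lifted to the chosen generators. \<open>L \<alpha>\<close>
    sends it to \<open>f2\<close>, yet vanishes on all syzygies.\<close>
  have "(\<Sum>q<k 0. (smul f2 c - smul f1 b) q * G q) = f2 * (\<Sum>q<k 0. c q * G q) - f1 * (\<Sum>q<k 0. b q * G q)"
    by (simp only: fun_diff_def smul_def left_diff_distrib sum_subtractf sum_distrib_left mult.assoc)
  also have "\<dots> = 0" unfolding c(3)[symmetric] b(3)[symmetric] by (simp add: mult.commute)
  finally have "smul f2 c - smul f1 b \<in> syz (k 0) (g 0) {0}"
    using c(1) b(1) by (auto simp: syz0 supp_def smul_def)
  from Lsyz[OF this] have "f2 = 0" using Lb Lc by (simp add: L \<pi>f)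
  moreover have "f2 \<noteq> 0"
  proof
    assume "f2 = 0"
    then have "Poly_Mapping.lookup f2 (xvar a + yvar v) = 0" by simp
    moreover have "xvar v + yvar a \<noteq> xvar a + yvar v"
    proof
      assume "xvar v + yvar a = xvar a + yvar v"
      from arg_cong[OF this, of "\<lambda>m. Poly_Mapping.lookup m (Inl a)"] d
      show False by (auto simp: lookup_add lookup_single when_def split: if_splits)
    qed
    ultimately show False by (simp add: f2_def edge_binomial_eq lookup_minus lookup_single when_def)
  qed
  ultimately show False by simp
qed

section \<open>The regularity\<close>

text \<open>By minimality no basis vector maps to 0, and the nonzero entries of a differential have
  positive degree; so the least degree rises in every step.\<close>

lemma minimal_resolution_seq_lower:
  assumes s: "minimal_resolution_seq (I :: ('x::finite, 'k::field) mpoly set) k e g"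
    and c: "\<And>p. p < k 0 \<Longrightarrow> c \<le> e 0 p"
  shows "p < k i \<Longrightarrow> c + int i \<le> e i p"
proof (induction i arbitrary: p)
  case 0
  then show ?case using c by simp
next
  case (Suc i q)
  obtain r where gen: "generates r (e i) {0} (syz (k i) (g i) {0}) (k (Suc i)) (g (Suc i)) (e (Suc i))"
    using s by (auto simp: minimal_resolution_seq_def)
  then have h: "g (Suc i) q \<in> syz (k i) (g i) {0}" "hom (e i) (e (Suc i) q) (g (Suc i) q)"
    using Suc.prems by (auto simp: generates_def)
  have "g (Suc i) q \<noteq> 0"
  proof
    assume z: "g (Suc i) q = 0"
    define u where "u = (\<lambda>j. if j = q then 1 else 0 :: ('x, 'k) mpoly)"
    have "lc (k (Suc i)) u (g (Suc i)) = g (Suc i) q"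
      using Suc.prems by (auto simp: u_def lc_def fun_eq_iff if_distrib[of "\<lambda>x. x * _"] cong: if_cong)
    then have "u \<in> syz (k (Suc i)) (g (Suc i)) {0}"
      using z Suc.prems by (auto simp: u_def syz_def supp_def)
    moreover have "minimal_gens (k (Suc i)) (g (Suc i))" using s by (simp add: minimal_resolution_seq_def)
    ultimately have "Poly_Mapping.lookup (u q) 0 = 0"
      using Suc.prems unfolding minimal_gens_def by blast
    then show False by (simp add: u_def)
  qed
  then obtain p where p: "g (Suc i) q p \<noteq> 0" by (auto simp: fun_eq_iff)
  then have pk: "p < k i" using h(1) by (auto simp: syz_def supp_def) (meson not_le)
  have hg: "g (Suc i) q p \<in> homogeneous (e (Suc i) q - e i p)" using h(2) by (simp add: hom_def)
  have "minimal_gens (k i) (g i)" using s by (simp add: minimal_resolution_seq_def)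
  then have "Poly_Mapping.lookup (g (Suc i) q p) 0 = 0"
    using h(1) pk by (auto simp: minimal_gens_def)
  then have "0 < e (Suc i) q - e i p"
    using homogeneous_le_0[OF hg] p by (fastforce simp: not_less[symmetric])
  then show ?case using Suc.IH[OF pk] by simp
qed

text \<open>The bound \<open>R\<close> also yields the existence of a minimal resolution, so the
  choice in the definition is a genuine one. As it is unknown which one is chosen, the lower bound
  asks its hypothesis of all of them.\<close>

lemma ideal_regularity_bounds:
  assumes I: "gideal I" and R: "ideal_reg_le r {0} I" and nz: "I \<noteq> {0}"
  shows "ideal_regularity I \<le> r"
    and "(\<And>k e g. minimal_resolution_seq I k e g \<Longrightarrow> \<exists>i p. p < k i \<and> s \<le> e i p - int i) \<Longrightarrow>
      s \<le> ideal_regularity I"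
proof -
  define b where "b = (SOME b. \<exists>g A. minimal_graded_free_resolution (*) I (\<lambda>d. I \<inter> homogeneous d) b g A)"
  have reg: "\<And>n. reg_upto n r deg0 {0} (embv ` I)"
    using R by (simp add: ideal_reg_le_def embv_simps)
  have "\<exists>b g A. minimal_graded_free_resolution (*) I (\<lambda>d. I \<inter> homogeneous d) b g A"
    using minimal_resolution_seq_exists[OF I reg] resolution_of_minimal_resolution_seq[OF I] by blast
  then have "\<exists>g A. minimal_graded_free_resolution (*) I (\<lambda>d. I \<inter> homogeneous d) b g A"
    unfolding b_def by (rule someI_ex)
  then obtain G where res: "minimal_resolution_seq I (\<lambda>i. length (b i)) (\<lambda>i. (!) (b i)) G"
    using minimal_resolution_seq_of_resolution by blast
  define S where "S = {j - int i | i j. j \<in> set (b i)}"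
  have reg_eq: "ideal_regularity I = Max S"
    by (simp add: ideal_regularity_def regularity_def betti_def S_def count_list_0_iff flip: b_def)
  have upper: "x \<le> r" if "x \<in> S" for x
    using that minimal_resolution_seq_bound[OF I reg res] by (fastforce simp: S_def in_set_conv_nth)
  \<comment> \<open>Inserting 0 gives a lower bound without first knowing that \<open>b 0\<close> is
    nonempty; with \<open>r\<close> it encloses \<open>S\<close> in a finite interval.\<close>
  define c where "c = Min (insert 0 (set (b 0)))"
  have "c \<le> b 0 ! p" if "p < length (b 0)" for p
    using that by (auto simp: c_def)
  from minimal_resolution_seq_lower[OF res this]
  have lower: "c \<le> x" if "x \<in> S" for x
    using that by (fastforce simp: S_def in_set_conv_nth)
  have fin: "finite S"
    by (rule finite_subset[of _ "{c..r}"]) (use upper lower in auto)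
  have "b 0 \<noteq> []"
  proof
    assume b0: "b 0 = []"
    obtain r' where "generates r' deg0 {0} (embv ` I) 0 (G 0) ((!) (b 0))"
      using res by (auto simp: minimal_resolution_seq_def b0)
    then have "embv p = embv 0" if "p \<in> I" for p
      using that by (auto simp: generates_def embv_simps)
    then have "I \<subseteq> {0}" by (auto simp: embv_inj)
    then show False using nz gideal_0[OF I] by auto
  qed
  then have ne: "S \<noteq> {}" by (auto simp: S_def)
  show "ideal_regularity I \<le> r" unfolding reg_eq using upper fin ne by simp
  assume "\<And>k e g. minimal_resolution_seq I k e g \<Longrightarrow> \<exists>i p. p < k i \<and> s \<le> e i p - int i"
  then obtain i p where "p < length (b i)" "s \<le> b i ! p - int i" using res by blast
  moreover from this(1) have "b i ! p - int i \<in> S" unfolding S_def using nth_mem by blast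
  then have "b i ! p - int i \<le> Max S" using fin by (intro Max_ge)
  ultimately show "s \<le> ideal_regularity I" unfolding reg_eq by simp
qed

lemma edge_binomial_neq_0:
  assumes "u \<noteq> v"
  shows "edge_binomial u v \<noteq> (0 :: ('v + 'v, 'k::field) mpoly)"
proof
  assume "edge_binomial u v = (0 :: ('v + 'v, 'k) mpoly)"
  then have "Poly_Mapping.lookup (edge_binomial u v :: ('v + 'v, 'k) mpoly) (xvar u + yvar v) = 0" by simp
  moreover have "xvar v + yvar u \<noteq> xvar u + yvar v"
  proof
    assume "xvar v + yvar u = xvar u + yvar v"
    from arg_cong[OF this, of "\<lambda>m. Poly_Mapping.lookup m (Inl u)"] assms
    show False by (auto simp: lookup_add lookup_single when_def split: if_splits)
  qed
  ultimately show False by (simp add: edge_binomial_eq lookup_minus lookup_single when_def)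
qed

text \<open>Reversing an edge only changes the sign of its binomial, so listing both orders adds
  nothing to the span.\<close>

lemma binomial_edge_ideal_eq:
  assumes "simple_graph E"
  shows "binomial_edge_ideal E = (edge_ideal (\<lambda>u v. {u, v} \<in> E) :: ('v::{finite,linorder} + 'v, 'k::field) mpoly set)"
proof (intro equalityI)
  show "binomial_edge_ideal E \<subseteq> (edge_ideal (\<lambda>u v. {u, v} \<in> E) :: ('v + 'v, 'k) mpoly set)"
    unfolding binomial_edge_ideal_def edge_ideal_def by (intro poly_module.span_mono) auto
  let ?B = "binomial_edge_ideal E :: ('v + 'v, 'k) mpoly set"
  have g: "gideal ?B"
    unfolding binomial_edge_ideal_def by (rule gideal_span) (auto intro: edge_binomial_homogeneous)
  have base: "edge_binomial u v \<in> ?B" if "u < v" "{u, v} \<in> E" for u v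
    unfolding binomial_edge_ideal_def by (rule poly_module.span_base) (use that in auto)
  show "edge_ideal (\<lambda>u v. {u, v} \<in> E) \<subseteq> ?B"
  proof (rule edge_ideal_subset[OF g])
    fix u v assume uv: "{u, v} \<in> E"
    consider "u < v" | "u = v" | "v < u" by fastforce
    then show "edge_binomial u v \<in> ?B"
    proof cases
      case 3
      then have "edge_binomial v u \<in> ?B" using uv by (intro base) (auto simp: insert_commute)
      then show ?thesis
        using gideal_mult[OF g, of _ "- 1"] by (simp add: edge_binomial_swap[of u v])
    qed (use uv base gideal_0[OF g] in auto)
  qed
qed

theorem corollary3p25:
  fixes E :: "'v::{finite, linorder} set set" and t :: nat
  assumes "simple_graph E"
    and "t \<ge> 2"
    and "complete_multipartite t E"
  shows "(\<not> complete_graph E \<longrightarrow>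
            ideal_regularity (binomial_edge_ideal E :: ('v + 'v, 'k::field) mpoly set) = 3) \<and>
         (\<not> path_graph E \<longrightarrow>
            ideal_regularity (binomial_edge_ideal E :: ('v + 'v, 'k) mpoly set)
              \<le> int CARD('v) - 1)"
proof -
  obtain P where P: "partition_on UNIV P" "card P = t"
    and E: "\<And>u v. {u, v} \<in> E \<longleftrightarrow> (\<exists>A\<in>P. \<exists>B\<in>P. A \<noteq> B \<and> u \<in> A \<and> v \<in> B)"
    using assms(3) unfolding complete_multipartite_def by blast
  have disj: "disjoint P" using P(1) by (simp add: partition_on_def)
  have cover: "\<exists>A\<in>P. u \<in> A" for u using P(1) by (auto simp: partition_on_def)
  have uniq: "A = B" if "A \<in> P" "B \<in> P" "u \<in> A" "u \<in> B" for A B u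
    using disjointD[OF disj that(1,2)] that(3,4) by auto
  have E': "{u, v} \<in> E \<longleftrightarrow> uncompleted P u v" for u v
  proof
    assume "{u, v} \<in> E"
    then obtain A B where AB: "A \<in> P" "B \<in> P" "A \<noteq> B" "u \<in> A" "v \<in> B" using E by blast
    then show "uncompleted P u v" unfolding uncompleted_def using uniq by blast
  next
    assume R: "uncompleted P u v"
    obtain A B where "A \<in> P" "u \<in> A" "B \<in> P" "v \<in> B" using cover by blast
    then show "{u, v} \<in> E" using E R unfolding uncompleted_def by blast
  qed
  define I where "I = (binomial_edge_ideal E :: ('v + 'v, 'k) mpoly set)"
  have I: "I = edge_ideal (uncompleted P)"
    unfolding I_def binomial_edge_ideal_eq[OF assms(1)] E' ..
  have g: "gideal I" unfolding I by (rule gideal_edge_ideal)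
  \<comment> \<open>\<open>t \<ge> 2\<close> supplies a second part, all of whose vertices are
    adjacent to \<open>u\<close>.\<close>
  have part: "\<exists>a. {u, a} \<in> E" for u
  proof -
    obtain A where A: "A \<in> P" "u \<in> A" using cover by blast
    have "P \<noteq> {A}" using P(2) assms(2) by auto
    then obtain B where B: "B \<in> P" "B \<noteq> A" using A(1) by blast
    then have "B \<noteq> {}" using P(1) by (auto simp: partition_on_def)
    then show ?thesis using A B E by blast
  qed
  have neq: "u \<noteq> v" if "{u, v} \<in> E" for u v
    using assms(1) that by (force simp: simple_graph_def)
  have nz: "I \<noteq> {0}"
  proof -
    obtain u a :: 'v where ua: "{u, a} \<in> E" using part by blast
    then have "edge_binomial u a \<in> I" unfolding I by (intro edge_ideal_base) (simp flip: E')
    moreover have "edge_binomial u a \<noteq> (0 :: ('v + 'v, 'k) mpoly)"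
      by (rule edge_binomial_neq_0) (rule neq[OF ua])
    ultimately show ?thesis by blast
  qed
  have le3: "ideal_regularity I \<le> 3"
    by (rule ideal_regularity_bounds(1)[OF g _ nz]) (unfold I, rule ideal_reg_le_uncompleted[OF disj order_refl])
  show ?thesis
  proof (cases "complete_graph E")
    case True
    then have "I = complete_ideal UNIV"
    proof -
      have "I = edge_ideal (\<lambda>u v. {u, v} \<in> E)" unfolding I E' ..
      also have "\<dots> = complete_ideal UNIV"
      proof (intro equalityI edge_ideal_subset gideal_edge_ideal)
        show "edge_binomial u v \<in> edge_ideal (\<lambda>u v. {u, v} \<in> E)" for u v :: 'v
          using True gideal_0[OF gideal_edge_ideal]
          by (cases "u = v") (auto simp: complete_graph_def intro!: edge_ideal_base)
      qed (auto intro: edge_ideal_base)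
      finally show ?thesis .
    qed
    then have le2: "ideal_regularity I \<le> 2"
      by (intro ideal_regularity_bounds(1)[OF g _ nz]) (simp only: ideal_reg_le_complete_ideal)
    \<comment> \<open>Every vertex has a neighbour, so with fewer than three vertices the graph is a
      single edge, a path. This gives 2 <= n - 1.\<close>
    have "3 \<le> CARD('v)" if np: "\<not> path_graph E"
    proof (rule ccontr)
      assume "\<not> 3 \<le> CARD('v)"
      obtain u a :: 'v where ua: "{u, a} \<in> E" using part by blast
      have "u \<noteq> a" by (rule neq[OF ua])
      have univ: "{u, a} = UNIV"
        by (rule card_seteq) (use \<open>\<not> 3 \<le> CARD('v)\<close> \<open>u \<noteq> a\<close> in auto)
      have "CARD('v) = 2" using arg_cong[OF univ, of card] \<open>u \<noteq> a\<close> by simp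
      then have "e = UNIV" if "e \<in> E" for e
        using assms(1) that by (intro card_subset_eq) (auto simp: simple_graph_def)
      then have "e = {u, a}" if "e \<in> E" for e
        using that univ by simp
      then have "E = {{u, a}}" using ua by blast
      also have "\<dots> = {{[u, a] ! i, [u, a] ! Suc i} | i. Suc i < length [u, a]}" by auto
      finally have "path_graph E"
        unfolding path_graph_def using univ \<open>u \<noteq> a\<close> by (intro exI[of _ "[u, a]"] conjI) simp_all
      then show False using np by simp
    qed
    then show ?thesis using True le2 by (auto simp flip: I_def)
  next
    case False
    then obtain u v where uv: "u \<noteq> v" "{u, v} \<notin> E" unfolding complete_graph_def by blast
    obtain a where a: "{u, a} \<in> E" using part by blast
    \<comment> \<open>Nonadjacent vertices lie in the same part, hence have the same
      neighbours.\<close>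
    have "{a, v} \<in> E"
    proof -
      obtain A B where AB: "A \<in> P" "B \<in> P" "A \<noteq> B" "u \<in> A" "a \<in> B" using a E by blast
      obtain C where C: "C \<in> P" "v \<in> C" using cover by blast
      have "A = C" using uv(2) E AB C by blast
      then show ?thesis using E AB C by blast
    qed
    have d: "distinct [u, a, v]" using uv(1) neq a \<open>{a, v} \<in> E\<close> by auto
    have "3 \<le> ideal_regularity I"
    proof (rule ideal_regularity_bounds(2)[OF g _ nz])
      show "ideal_reg_le 3 {0} I" unfolding I by (rule ideal_reg_le_uncompleted[OF disj order_refl])
      fix k e g' assume "minimal_resolution_seq I k e g'"
      then show "\<exists>i p. p < k i \<and> 3 \<le> e i p - int i"
        unfolding I by (rule nonlinear_syzygy[OF _ d])
          (use a \<open>{a, v} \<in> E\<close> uv(2) in \<open>auto simp: insert_commute simp flip: E'\<close>)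
    qed
    then have eq3: "ideal_regularity I = 3" using le3 by simp
    \<comment> \<open>With only three vertices the graph would be the path u - a - v; so 3 <= n - 1
      otherwise.\<close>
    have "4 \<le> CARD('v)" if np: "\<not> path_graph E"
    proof (rule ccontr)
      assume "\<not> 4 \<le> CARD('v)"
      then have univ: "{u, a, v} = UNIV"
        by (intro card_seteq) (use d in auto)
      have "E = {{u, a}, {a, v}}"
      proof (intro equalityI subsetI)
        fix e assume e: "e \<in> E"
        then obtain x y where xy: "e = {x, y}" "x \<noteq> y"
          using assms(1) by (auto simp: simple_graph_def card_2_iff)
        have "x \<in> {u, a, v}" "y \<in> {u, a, v}" unfolding univ by auto
        then show "e \<in> {{u, a}, {a, v}}" using xy e uv(2) by (auto simp: insert_commute)
      qed (use a \<open>{a, v} \<in> E\<close> in auto)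
      also have "\<dots> = {{[u, a, v] ! i, [u, a, v] ! Suc i} | i. Suc i < length [u, a, v]}"
      proof -
        have "Suc i < length [u, a, v] \<longleftrightarrow> i = 0 \<or> i = 1" for i by auto
        then have "{{[u, a, v] ! i, [u, a, v] ! Suc i} | i. Suc i < length [u, a, v]}
            = {{[u, a, v] ! i, [u, a, v] ! Suc i} | i. i = 0 \<or> i = 1}" by (simp only:)
        also have "\<dots> = {{u, a}, {a, v}}"
          unfolding conj_disj_distribL ex_disj_distrib by (auto intro: exI[of _ 0] exI[of _ 1])
        finally show ?thesis ..
      qed
      finally have "path_graph E"
        unfolding path_graph_def using univ d by (intro exI[of _ "[u, a, v]"] conjI) simp_all
      then show False using np by simp
    qed
    then show ?thesis using False eq3 by (auto simp flip: I_def)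
  qed
qed

end
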